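(* Let $\ell,k\in\{1,2,\dots\}\cup\{\infty\}$, let $K\ge 1$, and let $M$ be a $C^\ell$ Finsler manifold in the sense of Neeb-Upmeier which is $K$-weak-uniform and modeled on a Banach space $X$. Assume that $X$ admits property $( *^k)$ with a constant $C_0\ge 1$ that does not depend on the (equivalent) norm considered on $X$. Then for every Lipschitz function $f:M\to\mathbb{R}$ and every continuous function $\varepsilon:M\to(0,\infty)$ there is a Lipschitz, $C^m$-smooth function $g:M\to\mathbb{R}$, where $m:=\min\{\ell,k\}$, such that $$|g(p)-f(p)|<\varepsilon(p)\quad\text{and}\quad \|dg(p)\|_p\le C_1\operatorname{Lip}(f)\qquad\text{for every } p\in M,$$ and therefore $\operatorname{Lip}(g)\le C_1\operatorname{Lip}(f)$, where $C_1:=2C_0K^2$.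
   Context: Let $M$ be a paracompact $C^\ell$ Banach manifold ($\ell\ge1$) modeled on a real Banach space $(X,\|\cdot\|)$, with tangent bundle $TM$, and let $\|\cdot\|_M:TM\to[0,\infty)$ be a continuous map; write $\|\cdot\|_x$ for its restriction to $T_xM$. Condition (P1): for every $x\in M$, $\|\cdot\|_x$ is a norm on $T_xM$ such that for every chart $\varphi:U\to X$ with $x\in U$, the norm $v\in X\mapsto\|d\varphi^{-1}(\varphi(x))(v)\|_x$ is equivalent to $\|\cdot\|$ on $X$. $(M,\|\cdot\|_M)$ is a $C^\ell$ Finsler manifold in the sense of Neeb-Upmeier which is $K$-weak-uniform ($K\ge1$) if (P1) holds and for every $x_0\in M$ there is a chart $\varphi:U\to X$ with $x_0\in U$ such that for every $x\in U$ and $v\in X$, $$\tfrac1K\|d\varphi^{-1}(\varphi(x_0))(v)\|_{x_0}\le\|d\varphi^{-1}(\varphi(x))(v)\|_x\le K\|d\varphi^{-1}(\varphi(x_0))(v)\|_{x_0}.$$ The length of a piecewise $C^1$ path $c:[a,b]\to M$ is $\ell(c)=\int_a^b\|c'(t)\|_{c(t)}\,dt$, and the Finsler metric is $d_M(p,q)=\inf\{\ell(c): c \text{ a piecewise } C^1 \text{ path joining } p \text{ to } q\}$ (with value $+\infty$ if $p,q$ lie in different connected components). Lipschitz constants on $M$ are with respect to $d_M$: $\operatorname{Lip}(f)$ is the least $L\ge 0$ with $|f(p)-f(q)|\le L\,d_M(p,q)$ for all $p,q$ with $d_M(p,q)<\infty$. For a differentiable $g:M\to\mathbb{R}$, $\|dg(p)\|_p=\sup\{|dg(p)(v)|: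 v\in T_pM,\ \|v\|_p\le1\}$. Property $( *^k)$: a Banach space $(X,\|\cdot\|)$ satisfies property $( *^k)$ with constant $C_0\ge1$ (depending only on $(X,\|\cdot\|)$) if for every Lipschitz function $f:X\to\mathbb{R}$ and every $\varepsilon>0$ there is a Lipschitz, $C^k$-smooth function $h:X\to\mathbb{R}$ with $|f(x)-h(x)|<\varepsilon$ for all $x\in X$ and $\operatorname{Lip}(h)\le C_0\operatorname{Lip}(f)$. "The constant $C_0$ does not depend on the (equivalent) norm" means that for every norm $|\cdot|$ on $X$ equivalent to $\|\cdot\|$, the space $(X,|\cdot|)$ satisfies property $( *^k)$ with the same constant $C_0$. *)

theory Defs
  imports "HOL-Analysis.Analysis"
begin

section \<open>\<open>C\<^sup>k\<close> maps between normed spaces\<close>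

text \<open>
  \<open>D n x\<close> is the \<open>n\<close>-th Frechet derivative at \<open>x\<close>, a bounded \<open>n\<close>-linear map fed with the list of
  its \<open>n\<close> arguments.  HOL has no type of bounded \<open>n\<close>-linear maps for variable \<open>n\<close>, so the operator
  norm estimates are written out: \<open>mlin_le n T B\<close> says that the operator norm of \<open>T\<close> is at most \<open>B\<close>.
\<close>

definition mlin_le :: "nat \<Rightarrow> ('a::real_normed_vector list \<Rightarrow> 'b::real_normed_vector) \<Rightarrow> real \<Rightarrow> bool" where
  "mlin_le n T B \<longleftrightarrow> (\<forall>vs. length vs = n \<longrightarrow> norm (T vs) \<le> B * prod_list (map norm vs))"

definition bounded_mlin :: "nat \<Rightarrow> ('a::real_normed_vector list \<Rightarrow> 'b::real_normed_vector) \<Rightarrow> bool" where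
  "bounded_mlin n T \<longleftrightarrow>
     (\<forall>us ws. length us + Suc (length ws) = n \<longrightarrow> linear (\<lambda>v. T (us @ v # ws))) \<and> (\<exists>B. mlin_le n T B)"

text \<open>
  The identification \<open>L(X, L\<^sup>n(X, Y)) = L\<^sup>n\<^sup>+\<^sup>1(X, Y)\<close> puts the direction of the last
  differentiation first.  On an open set the derivatives are unique, so one family \<open>D\<close> serves all
  orders, including for \<open>k = \<infinity>\<close>.
\<close>

definition smooth_map_on ::
    "enat \<Rightarrow> 'a::real_normed_vector set \<Rightarrow> ('a \<Rightarrow> 'b::real_normed_vector) \<Rightarrow> bool" where
  "smooth_map_on k S f \<longleftrightarrow> open S \<and>
     (\<exists>D :: nat \<Rightarrow> 'a \<Rightarrow> 'a list \<Rightarrow> 'b.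
        (\<forall>x\<in>S. D 0 x [] = f x) \<and>
        (\<forall>n. enat n \<le> k \<longrightarrow> (\<forall>x\<in>S. bounded_mlin n (D n x))) \<and>
        (\<forall>n. enat n \<le> k \<longrightarrow> (\<forall>x\<in>S. \<forall>e>0. \<exists>\<delta>>0. \<forall>y\<in>S. norm (y - x) < \<delta> \<longrightarrow>
            mlin_le n (\<lambda>vs. D n y vs - D n x vs) e)) \<and>
        (\<forall>n. enat n < k \<longrightarrow> (\<forall>x\<in>S. \<forall>e>0. \<exists>\<delta>>0. \<forall>y\<in>S. norm (y - x) < \<delta> \<longrightarrow>
            mlin_le n (\<lambda>vs. D n y vs - D n x vs - D (Suc n) x ((y - x) # vs)) (e * norm (y - x)))))"


section \<open>Lipschitz functions and property \<open>(*\<^sup>k)\<close>\<close>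

text \<open>Distances are extended reals; pairs at infinite distance impose no condition.\<close>

definition lipschitz_bound :: "('p \<Rightarrow> 'p \<Rightarrow> ereal) \<Rightarrow> ('p \<Rightarrow> real) \<Rightarrow> real \<Rightarrow> bool" where
  "lipschitz_bound d f L \<longleftrightarrow>
     0 \<le> L \<and> (\<forall>p q. d p q < \<infinity> \<longrightarrow> ereal \<bar>f p - f q\<bar> \<le> ereal L * d p q)"

definition lipschitz_fun :: "('p \<Rightarrow> 'p \<Rightarrow> ereal) \<Rightarrow> ('p \<Rightarrow> real) \<Rightarrow> bool" where
  "lipschitz_fun d f \<longleftrightarrow> (\<exists>L. lipschitz_bound d f L)"

definition Lip :: "('p \<Rightarrow> 'p \<Rightarrow> ereal) \<Rightarrow> ('p \<Rightarrow> real) \<Rightarrow> real" where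
  "Lip d f = Inf {L. lipschitz_bound d f L}"

text \<open>The infimum is attained, so \<open>Lip d f\<close> is the least Lipschitz constant.\<close>

lemma lipschitz_bound_Lip:
  assumes "lipschitz_fun d f" and nonneg: "\<And>p q. 0 \<le> d p q"
  shows "lipschitz_bound d f (Lip d f)" and "lipschitz_bound d f L \<Longrightarrow> Lip d f \<le> L"
proof -
  let ?A = "{L. lipschitz_bound d f L}"
  have bdd: "bdd_below ?A"
    by (rule bdd_belowI[of _ 0]) (auto simp: lipschitz_bound_def)
  have ne: "?A \<noteq> {}"
    using assms(1) unfolding lipschitz_fun_def by blast
  show "lipschitz_bound d f L \<Longrightarrow> Lip d f \<le> L"
    unfolding Lip_def using bdd by (auto intro: cInf_lower)
  have 0: "0 \<le> Lip d f"
    unfolding Lip_def by (rule cInf_greatest[OF ne]) (simp add: lipschitz_bound_def)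
  have "ereal \<bar>f p - f q\<bar> \<le> ereal (Lip d f) * d p q" if fin: "d p q < \<infinity>" for p q
  proof -
    obtain r where r: "d p q = ereal r" "0 \<le> r"
      using fin nonneg[of p q] by (cases "d p q") auto
    have *: "\<bar>f p - f q\<bar> \<le> L * r" if "L \<in> ?A" for L
      using that fin r unfolding lipschitz_bound_def by fastforce
    have "\<bar>f p - f q\<bar> \<le> Lip d f * r"
    proof (cases "r = 0")
      case True
      then show ?thesis using * ne by fastforce
    next
      case False
      then have "\<bar>f p - f q\<bar> / r \<le> Lip d f"
        unfolding Lip_def using * r
        by (intro cInf_greatest[OF ne]) (simp add: pos_divide_le_eq)
      then show ?thesis using False r by (simp add: pos_divide_le_eq)
    qed
    then show ?thesis by (simp add: r)
  qed
  then show "lipschitz_bound d f (Lip d f)"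
    using 0 by (auto simp: lipschitz_bound_def)
qed

definition equivalent_norm :: "('a::real_normed_vector \<Rightarrow> real) \<Rightarrow> bool" where
  "equivalent_norm \<nu> \<longleftrightarrow>
     (\<forall>x y. \<nu> (x + y) \<le> \<nu> x + \<nu> y) \<and> (\<forall>r x. \<nu> (r *\<^sub>R x) = \<bar>r\<bar> * \<nu> x) \<and>
     (\<exists>a>0. \<exists>b>0. \<forall>x. a * norm x \<le> \<nu> x \<and> \<nu> x \<le> b * norm x)"

text \<open>
  Smoothness of \<open>h\<close> is taken with respect to the norm of the type; it is the same for all
  equivalent norms.
\<close>

definition property_star :: "enat \<Rightarrow> ('a::real_normed_vector \<Rightarrow> real) \<Rightarrow> real \<Rightarrow> bool" where
  "property_star k \<nu> C \<longleftrightarrow>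
     (let d = (\<lambda>x y. ereal (\<nu> (x - y))) in
       \<forall>f. lipschitz_fun d f \<longrightarrow> (\<forall>\<epsilon>>0. \<exists>h. lipschitz_fun d h \<and> smooth_map_on k UNIV h \<and>
         (\<forall>x. \<bar>f x - h x\<bar> < \<epsilon>) \<and> Lip d h \<le> C * Lip d f))"


section \<open>Banach manifolds\<close>

definition paracompact_topology :: "'m topology \<Rightarrow> bool" where
  "paracompact_topology T \<longleftrightarrow> Hausdorff_space T \<and>
     (\<forall>\<U>. (\<forall>U\<in>\<U>. openin T U) \<and> \<Union>\<U> = topspace T \<longrightarrow>
        (\<exists>\<V>. (\<forall>V\<in>\<V>. openin T V \<and> (\<exists>U\<in>\<U>. V \<subseteq> U)) \<and> \<Union>\<V> = topspace T \<and> locally_finite_in T \<V>))"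

text \<open>
  A chart \<open>(U, \<phi>)\<close> is its domain together with a map of which only the values on \<open>U\<close> matter.
\<close>

type_synonym ('m, 'x) chart = "'m set \<times> ('m \<Rightarrow> 'x)"

definition chart_image :: "('m, 'x) chart \<Rightarrow> 'x set" where
  "chart_image c = snd c ` fst c"

definition chart_inv :: "('m, 'x) chart \<Rightarrow> 'x \<Rightarrow> 'm" where
  "chart_inv c = inv_into (fst c) (snd c)"

definition is_chart :: "('m::topological_space, 'x::real_normed_vector) chart \<Rightarrow> bool" where
  "is_chart c \<longleftrightarrow> open (fst c) \<and> open (chart_image c) \<and>
     homeomorphism (fst c) (chart_image c) (snd c) (chart_inv c)"

definition transition :: "('m, 'x) chart \<Rightarrow> ('m, 'x) chart \<Rightarrow> 'x \<Rightarrow> 'x" where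
  "transition c d = snd d \<circ> chart_inv c"

definition compatible ::
    "enat \<Rightarrow> ('m, 'x::real_normed_vector) chart \<Rightarrow> ('m, 'x) chart \<Rightarrow> bool" where
  "compatible l c d \<longleftrightarrow>
     smooth_map_on l (snd c ` (fst c \<inter> fst d)) (transition c d) \<and>
     smooth_map_on l (snd d ` (fst c \<inter> fst d)) (transition d c)"

text \<open>
  The manifold is the whole type \<open>'m\<close>, and \<open>A\<close> is its maximal atlas: "every chart" and "there is a
  chart" refer to members of \<open>A\<close>.
\<close>

definition banach_manifold ::
    "enat \<Rightarrow> ('m::topological_space, 'x::banach) chart set \<Rightarrow> bool" where
  "banach_manifold l A \<longleftrightarrow>
     (\<forall>c\<in>A. is_chart c) \<and> (\<Union>c\<in>A. fst c) = UNIV \<and> (\<forall>c\<in>A. \<forall>d\<in>A. compatible l c d) \<and>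
     (\<forall>c. is_chart c \<and> (\<forall>d\<in>A. compatible l c d) \<longrightarrow> c \<in> A)"

definition charts_at :: "('m, 'x) chart set \<Rightarrow> 'm \<Rightarrow> ('m, 'x) chart set" where
  "charts_at A x = {c\<in>A. x \<in> fst c}"

definition smooth_function ::
    "('m, 'x::real_normed_vector) chart set \<Rightarrow> enat \<Rightarrow> ('m \<Rightarrow> real) \<Rightarrow> bool" where
  "smooth_function A m g \<longleftrightarrow> (\<forall>c\<in>A. smooth_map_on m (chart_image c) (g \<circ> chart_inv c))"


section \<open>Tangent bundle\<close>

text \<open>
  A tangent vector at \<open>x\<close> is the compatible family of its coordinate representatives in all charts
  around \<open>x\<close>; off these charts the family is \<open>0\<close>, so that \<open>tangent_space A x\<close> is a
  vector space under pointwise operations.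
\<close>

type_synonym ('m, 'x) tangent = "('m, 'x) chart \<Rightarrow> 'x"

definition transition_deriv ::
    "'m \<Rightarrow> ('m, 'x) chart \<Rightarrow> ('m, 'x::real_normed_vector) chart \<Rightarrow> 'x \<Rightarrow> 'x" where
  "transition_deriv x c d = frechet_derivative (transition c d) (at (snd c x))"

definition tangent_space ::
    "('m, 'x::real_normed_vector) chart set \<Rightarrow> 'm \<Rightarrow> ('m, 'x) tangent set" where
  "tangent_space A x =
     {\<xi>. (\<forall>c\<in>charts_at A x. \<forall>d\<in>charts_at A x. \<xi> d = transition_deriv x c d (\<xi> c)) \<and>
          (\<forall>d. d \<notin> charts_at A x \<longrightarrow> \<xi> d = 0)}"

text \<open>\<open>tangent_vec A c x v\<close> is \<open>d\<phi>\<inverse>(\<phi>(x))(v)\<close> for the chart \<open>c = (U, \<phi>)\<close>.\<close>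

definition tangent_vec ::
    "('m, 'x) chart set \<Rightarrow> ('m, 'x) chart \<Rightarrow> 'm \<Rightarrow> 'x::real_normed_vector \<Rightarrow> ('m, 'x) tangent" where
  "tangent_vec A c x v = (\<lambda>d. if d \<in> charts_at A x then transition_deriv x c d v else 0)"

definition tangent_bundle ::
    "('m, 'x::real_normed_vector) chart set \<Rightarrow> ('m \<times> ('m, 'x) tangent) set" where
  "tangent_bundle A = Sigma UNIV (tangent_space A)"

text \<open>
  The topology of the tangent bundle is the final topology for the inverse bundle charts
  \<open>(y, v) \<mapsto> (\<phi>\<inverse>(y), d\<phi>\<inverse>(y)(v))\<close> on \<open>\<phi>(U) \<times> X\<close>.
\<close>

definition tangent_preimage ::
    "('m, 'x::real_normed_vector) chart set \<Rightarrow> ('m, 'x) chart \<Rightarrow> ('m \<times> ('m, 'x) tangent) set \<Rightarrow> ('x \<times> 'x) set"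
  where "tangent_preimage A c W =
     {(y, v). y \<in> chart_image c \<and> (chart_inv c y, tangent_vec A c (chart_inv c y) v) \<in> W}"

definition tangent_topology ::
    "('m, 'x::real_normed_vector) chart set \<Rightarrow> ('m \<times> ('m, 'x) tangent) topology" where
  "tangent_topology A =
     topology (\<lambda>W. W \<subseteq> tangent_bundle A \<and> (\<forall>c\<in>A. open (tangent_preimage A c W)))"

lemma openin_tangent_topology:
  "openin (tangent_topology A) W \<longleftrightarrow>
     W \<subseteq> tangent_bundle A \<and> (\<forall>c\<in>A. open (tangent_preimage A c W))"
proof -
  have "tangent_preimage A c (S \<inter> T) = tangent_preimage A c S \<inter> tangent_preimage A c T"
    and "tangent_preimage A c (\<Union>\<K>) = (\<Union>K\<in>\<K>. tangent_preimage A c K)" for c S T \<K>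
    by (auto simp: tangent_preimage_def)
  then have "istopology (\<lambda>W. W \<subseteq> tangent_bundle A \<and> (\<forall>c\<in>A. open (tangent_preimage A c W)))"
    unfolding istopology_def by (auto intro!: open_UN)
  then show ?thesis
    by (simp add: tangent_topology_def)
qed

text \<open>
  The differential of \<open>g\<close> is computed in an arbitrary chart around \<open>p\<close>; for \<open>g\<close> differentiable
  and \<open>\<xi>\<close> tangent at \<open>p\<close> the value does not depend on the choice.
\<close>

definition differential ::
    "('m, 'x::real_normed_vector) chart set \<Rightarrow> ('m \<Rightarrow> real) \<Rightarrow> 'm \<Rightarrow> ('m, 'x) tangent \<Rightarrow> real" where
  "differential A g p \<xi> =
     (let c = (SOME c. c \<in> charts_at A p) in
        frechet_derivative (g \<circ> chart_inv c) (at (snd c p)) (\<xi> c))"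


section \<open>Finsler manifolds\<close>

definition is_norm_on_tangent ::
    "('m, 'x::real_normed_vector) chart set \<Rightarrow> 'm \<Rightarrow> (('m, 'x) tangent \<Rightarrow> real) \<Rightarrow> bool" where
  "is_norm_on_tangent A x \<nu> \<longleftrightarrow>
     (\<forall>\<xi>\<in>tangent_space A x. 0 \<le> \<nu> \<xi> \<and> (\<nu> \<xi> = 0 \<longrightarrow> \<xi> = (\<lambda>_. 0)) \<and>
        (\<forall>r. \<nu> (\<lambda>c. r *\<^sub>R \<xi> c) = \<bar>r\<bar> * \<nu> \<xi>) \<and>
        (\<forall>\<eta>\<in>tangent_space A x. \<nu> (\<lambda>c. \<xi> c + \<eta> c) \<le> \<nu> \<xi> + \<nu> \<eta>))"

definition finsler_P1 ::
    "('m, 'x::real_normed_vector) chart set \<Rightarrow> ('m \<Rightarrow> ('m, 'x) tangent \<Rightarrow> real) \<Rightarrow> bool" where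
  "finsler_P1 A N \<longleftrightarrow>
     (\<forall>x. is_norm_on_tangent A x (N x) \<and>
          (\<forall>c\<in>charts_at A x. equivalent_norm (\<lambda>v. N x (tangent_vec A c x v))))"

definition weak_uniform ::
    "real \<Rightarrow> ('m, 'x::real_normed_vector) chart set \<Rightarrow> ('m \<Rightarrow> ('m, 'x) tangent \<Rightarrow> real) \<Rightarrow> bool" where
  "weak_uniform K A N \<longleftrightarrow>
     (\<forall>x0. \<exists>c\<in>charts_at A x0. \<forall>x\<in>fst c. \<forall>v.
        1 / K * N x0 (tangent_vec A c x0 v) \<le> N x (tangent_vec A c x v) \<and>
        N x (tangent_vec A c x v) \<le> K * N x0 (tangent_vec A c x0 v))"

definition weak_uniform_finsler_manifold ::
    "enat \<Rightarrow> real \<Rightarrow> ('m::topological_space, 'x::banach) chart set \<Rightarrow>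
      ('m \<Rightarrow> ('m, 'x) tangent \<Rightarrow> real) \<Rightarrow> bool" where
  "weak_uniform_finsler_manifold l K A N \<longleftrightarrow>
     paracompact_topology (euclidean :: 'm topology) \<and> banach_manifold l A \<and>
     continuous_map (tangent_topology A) euclideanreal (\<lambda>(x, \<xi>). N x \<xi>) \<and>
     finsler_P1 A N \<and> weak_uniform K A N"

text \<open>
  A \<open>C\<^sup>1\<close> path on a compact interval has one-sided derivatives at the end points.  The library's
  \<^const>\<open>piecewise_C1_differentiable_on\<close> is weaker: it lets the derivative blow up at the exceptional
  points, and the path may then have infinite length.
\<close>

definition C1_path ::
    "('m::topological_space, 'x::real_normed_vector) chart set \<Rightarrow> (real \<Rightarrow> 'm) \<Rightarrow> real \<Rightarrow> real \<Rightarrow> bool" where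
  "C1_path A \<gamma> s t \<longleftrightarrow> continuous_on {s..t} \<gamma> \<and>
     (\<forall>c\<in>A. \<exists>\<gamma>'. continuous_on {\<tau>\<in>{s..t}. \<gamma> \<tau> \<in> fst c} \<gamma>' \<and>
        (\<forall>\<tau>\<in>{s..t}. \<gamma> \<tau> \<in> fst c \<longrightarrow>
           (snd c \<circ> \<gamma> has_vector_derivative \<gamma>' \<tau>) (at \<tau> within {s..t})))"

definition piecewise_C1_path ::
    "('m::topological_space, 'x::real_normed_vector) chart set \<Rightarrow> (real \<Rightarrow> 'm) \<Rightarrow> real \<Rightarrow> real \<Rightarrow> bool" where
  "piecewise_C1_path A \<gamma> a b \<longleftrightarrow> a < b \<and>
     (\<exists>n. \<exists>\<tau> :: nat \<Rightarrow> real. \<tau> 0 = a \<and> \<tau> n = b \<and>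
        (\<forall>i<n. \<tau> i < \<tau> (Suc i) \<and> C1_path A \<gamma> (\<tau> i) (\<tau> (Suc i))))"

text \<open>At the finitely many break points the velocity is arbitrary, which does not affect the length.\<close>

definition velocity ::
    "('m, 'x::real_normed_vector) chart set \<Rightarrow> (real \<Rightarrow> 'm) \<Rightarrow> real \<Rightarrow> ('m, 'x) tangent" where
  "velocity A \<gamma> t =
     (\<lambda>d. if d \<in> charts_at A (\<gamma> t) then vector_derivative (snd d \<circ> \<gamma>) (at t) else 0)"

definition path_len ::
    "('m, 'x::real_normed_vector) chart set \<Rightarrow> ('m \<Rightarrow> ('m, 'x) tangent \<Rightarrow> real) \<Rightarrow>
      (real \<Rightarrow> 'm) \<Rightarrow> real \<Rightarrow> real \<Rightarrow> real" where
  "path_len A N \<gamma> a b = integral {a..b} (\<lambda>t. N (\<gamma> t) (velocity A \<gamma> t))"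

definition finsler_dist ::
    "('m::topological_space, 'x::real_normed_vector) chart set \<Rightarrow>
      ('m \<Rightarrow> ('m, 'x) tangent \<Rightarrow> real) \<Rightarrow> 'm \<Rightarrow> 'm \<Rightarrow> ereal" where
  "finsler_dist A N p q =
     Inf {ereal (path_len A N \<gamma> a b) | \<gamma> a b. piecewise_C1_path A \<gamma> a b \<and> \<gamma> a = p \<and> \<gamma> b = q}"

text \<open>The supremum is taken in the extended reals, so that a finite bound on it is a genuine bound.\<close>

definition dual_norm ::
    "('m, 'x::real_normed_vector) chart set \<Rightarrow> ('m \<Rightarrow> ('m, 'x) tangent \<Rightarrow> real) \<Rightarrow>
      'm \<Rightarrow> (('m, 'x) tangent \<Rightarrow> real) \<Rightarrow> ereal" where
  "dual_norm A N p \<omega> = (SUP \<xi>\<in>{\<xi>\<in>tangent_space A p. N p \<xi> \<le> 1}. ereal \<bar>\<omega> \<xi>\<bar>)"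

end

(*
  Locally, straight segments in a weak-uniform chart centred at x show that an L-Lipschitz f is
  KL-Lipschitz for the norm of the tangent space at x; extend it by McShane, smooth it with the
  approximation property of X, and come back to M, losing another factor K.

  To glue with a loss of only a factor 2, the partition of unity has to be countable with bounded
  differentials: then the error allowed in the n-th approximation can be chosen after the n-th
  differential bound.  It comes from Stone's proof that metric spaces are paracompact, with Lipschitz
  functions in place of sets.  Let psi_x be the largest 1-Lipschitz function into [0,1] vanishing off
  a chart ball V_x, well-order the points, and let sigma_x be the supremum of the earlier psi_y.  For
  fixed n the functions max(0, min(psi_x - 1/n, 1/n - sigma_x)) have pairwise disjoint positivity
  sets, so all of them can be smoothed at once, each in its own chart, and cut off to a single
  function z_n with bounded differential; mu_n = z_n * prod_{j<n} (1 - z_j) is the partition.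

  Paracompactness of M enters only through regularity, which gives the bump functions that make
  psi_x positive at x.  The distance controls functions through the mean value inequality along
  paths, so a pointwise bound on the differential is a Lipschitz constant.
*)
theory Submission
  imports Defs
begin

section \<open>Multilinear families and \<open>C\<^sup>k\<close> maps\<close>

text \<open>Origin of the constant: near p only finitely many mu_n are nonzero and they sum to 1, so
  g - f(p) = sum mu_n (G_n - f(p)) for the local approximations G_n, and dg(p) = sum mu_n dG_n + sum
  (G_n - f(p)) dmu_n. The first sum is a convex combination of differentials bounded by C = C0 K^2
  Lip(f); the second is at most sum C / 2^(n+1) <= C once |G_n - f| is small against the bound of
  dmu_n. Subtracting the number f(p) avoids differentiating f. The errors need C > 0, so locally
  constant f are treated apart; a partition indexed by the points of M would offer no such summable
  errors.

  C0 has to serve all equivalent norms because the property of X is used once per point x, for the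
  norm of the tangent space at x, and these norms need not be uniformly comparable on X.

  On the analytic side the obstacle is the chain rule for C^k maps, k possibly infinite.
  Compositions are therefore expanded into Faa di Bruno summands with explicit blocks of argument
  positions.\<close>

definition cont_fam ::
    "nat \<Rightarrow> 'a::real_normed_vector set \<Rightarrow> ('a \<Rightarrow> 'a list \<Rightarrow> 'b::real_normed_vector) \<Rightarrow> bool" where
  "cont_fam n S \<Phi> \<longleftrightarrow> (\<forall>x\<in>S. bounded_mlin n (\<Phi> x)) \<and>
     (\<forall>x\<in>S. \<forall>e>0. \<exists>\<delta>>0. \<forall>y\<in>S. norm (y - x) < \<delta> \<longrightarrow> mlin_le n (\<lambda>vs. \<Phi> y vs - \<Phi> x vs) e)"

definition fam_deriv ::
    "nat \<Rightarrow> 'a::real_normed_vector set \<Rightarrow> ('a \<Rightarrow> 'a list \<Rightarrow> 'b::real_normed_vector) \<Rightarrow>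
      ('a \<Rightarrow> 'a list \<Rightarrow> 'b) \<Rightarrow> bool" where
  "fam_deriv n S \<Phi> \<Phi>' \<longleftrightarrow> (\<forall>x\<in>S. \<forall>e>0. \<exists>\<delta>>0. \<forall>y\<in>S. norm (y - x) < \<delta> \<longrightarrow>
     mlin_le n (\<lambda>vs. \<Phi> y vs - \<Phi> x vs - \<Phi>' x ((y - x) # vs)) (e * norm (y - x)))"

text \<open>
  A \<open>C\<^sup>j\<close> family of \<open>n\<close>-linear maps.  Differentiating raises the rank \<open>n\<close> and keeps the type, so that
  inductions on \<open>j\<close> are possible; with \<open>L(X, Y)\<close>-valued derivatives the codomain type would change.
\<close>

primrec Cfam ::
    "nat \<Rightarrow> nat \<Rightarrow> 'a::real_normed_vector set \<Rightarrow> ('a \<Rightarrow> 'a list \<Rightarrow> 'b::real_normed_vector) \<Rightarrow> bool" where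
  "Cfam 0 n S \<Phi> = cont_fam n S \<Phi>"
| "Cfam (Suc j) n S \<Phi> =
     (cont_fam n S \<Phi> \<and> (\<exists>\<Phi>'. fam_deriv n S \<Phi> \<Phi>' \<and> Cfam j (Suc n) S \<Phi>'))"

lemma Cfam_SucI:
  "cont_fam n S \<Phi> \<Longrightarrow> fam_deriv n S \<Phi> \<Phi>' \<Longrightarrow> Cfam j (Suc n) S \<Phi>' \<Longrightarrow> Cfam (Suc j) n S \<Phi>"
  by auto

lemma Cfam_SucE:
  assumes "Cfam (Suc j) n S \<Phi>"
  obtains \<Phi>' where "cont_fam n S \<Phi>" "fam_deriv n S \<Phi> \<Phi>'" "Cfam j (Suc n) S \<Phi>'"
  using assms by auto

section \<open>Estimates for bounded multilinear maps\<close>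

lemma mlin_leI: "(\<And>vs. length vs = n \<Longrightarrow> norm (T vs) \<le> B * prod_list (map norm vs)) \<Longrightarrow> mlin_le n T B"
  by (simp add: mlin_le_def)

lemma mlin_leD: "mlin_le n T B \<Longrightarrow> length vs = n \<Longrightarrow> norm (T vs) \<le> B * prod_list (map norm vs)"
  by (simp add: mlin_le_def)

lemma prod_list_norm_nonneg: "0 \<le> prod_list (map norm vs)"
  by (induction vs) auto

lemma mlin_le_mono: "mlin_le n T B \<Longrightarrow> B \<le> C \<Longrightarrow> mlin_le n T C"
  unfolding mlin_le_def by (blast intro: order_trans mult_right_mono prod_list_norm_nonneg)

lemma mlin_le_cong:
  "(\<And>vs. length vs = n \<Longrightarrow> T vs = U vs) \<Longrightarrow> mlin_le n T B = mlin_le n U B"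
  by (simp add: mlin_le_def)

lemma mlin_le_add:
  assumes "mlin_le n T B" "mlin_le n U C"
  shows "mlin_le n (\<lambda>vs. T vs + U vs) (B + C)"
proof (rule mlin_leI)
  fix vs :: "'a list" assume "length vs = n"
  then show "norm (T vs + U vs) \<le> (B + C) * prod_list (map norm vs)"
    using mlin_leD[OF assms(1)] mlin_leD[OF assms(2)]
    by (smt (verit) distrib_right norm_triangle_ineq)
qed

lemma mlin_le_scaleR:
  assumes "mlin_le n T B"
  shows "mlin_le n (\<lambda>vs. c *\<^sub>R T vs) (\<bar>c\<bar> * B)"
  using assms by (auto simp: mlin_le_def mult.assoc intro!: mult_left_mono)

lemma bounded_mlinE:
  assumes "bounded_mlin n T"
  obtains B where "0 < B" "mlin_le n T B"
proof -
  obtain B where "mlin_le n T B" using assms by (auto simp: bounded_mlin_def)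
  then have "mlin_le n T (max B 1)" by (rule mlin_le_mono) simp
  then show ?thesis by (rule that[rotated]) simp
qed

lemma bounded_mlin_linear:
  "bounded_mlin n T \<Longrightarrow> length us + Suc (length ws) = n \<Longrightarrow> linear (\<lambda>v. T (us @ v # ws))"
  by (simp add: bounded_mlin_def)

lemma bounded_mlin_diff:
  "bounded_mlin n T \<Longrightarrow> length us + Suc (length ws) = n \<Longrightarrow>
    T (us @ (v - w) # ws) = T (us @ v # ws) - T (us @ w # ws)"
  by (drule (1) bounded_mlin_linear) (rule linear_diff)

lemma bounded_mlin_bounded_linear:
  assumes T: "bounded_mlin n T" and len: "length us + Suc (length ws) = n"
  shows "bounded_linear (\<lambda>v. T (us @ v # ws))"
proof -
  obtain B where B: "0 < B" "mlin_le n T B" using T by (rule bounded_mlinE)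
  show ?thesis
  proof (rule bounded_linear_intro[where K = "B * (prod_list (map norm us) * prod_list (map norm ws))"])
    show "T (us @ (v + w) # ws) = T (us @ v # ws) + T (us @ w # ws)" for v w
      by (rule linear_add[OF bounded_mlin_linear[OF T len]])
    show "T (us @ (r *\<^sub>R v) # ws) = r *\<^sub>R T (us @ v # ws)" for r v
      by (rule linear_scale[OF bounded_mlin_linear[OF T len]])
    show "norm (T (us @ v # ws)) \<le> norm v * (B * (prod_list (map norm us) * prod_list (map norm ws)))" for v
      using mlin_leD[OF B(2), of "us @ v # ws"] len by (simp add: mult.assoc mult.left_commute)
  qed
qed

lemma bounded_mlin_cong:
  assumes "\<And>vs. length vs = n \<Longrightarrow> T vs = U vs"
  shows "bounded_mlin n T = bounded_mlin n U"
proof -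
  have "(\<lambda>v. T (us @ v # ws)) = (\<lambda>v. U (us @ v # ws))" if "length us + Suc (length ws) = n" for us ws
    using that by (intro ext assms) simp
  moreover have eq: "mlin_le n T = mlin_le n U"
    by (intro ext mlin_le_cong assms)
  ultimately show ?thesis
    unfolding bounded_mlin_def using eq by simp
qed

lemma bounded_mlin_add:
  assumes "bounded_mlin n T" "bounded_mlin n U"
  shows "bounded_mlin n (\<lambda>vs. T vs + U vs)"
  using assms unfolding bounded_mlin_def by (auto intro: linear_compose_add mlin_le_add)

lemma bounded_mlin_scaleR:
  assumes "bounded_mlin n T"
  shows "bounded_mlin n (\<lambda>vs. c *\<^sub>R T vs)"
  using assms unfolding bounded_mlin_def by (auto intro: linear_compose_scale_right mlin_le_scaleR)

section \<open>Continuity and differentiability of families\<close>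

lemma cont_famD: "cont_fam n S \<Phi> \<Longrightarrow> x \<in> S \<Longrightarrow> bounded_mlin n (\<Phi> x)"
  by (simp add: cont_fam_def)

lemma fam_derivE:
  assumes "fam_deriv n S \<Phi> \<Phi>'" "x \<in> S" "0 < e"
  obtains \<delta> where "\<delta> > 0" "\<And>y. y \<in> S \<Longrightarrow> norm (y - x) < \<delta> \<Longrightarrow>
     mlin_le n (\<lambda>vs. \<Phi> y vs - \<Phi> x vs - \<Phi>' x ((y - x) # vs)) (e * norm (y - x))"
  using assms(1)[unfolded fam_deriv_def, rule_format, OF assms(2,3)] that by blast

lemma cont_fam_eventually:
  assumes "cont_fam n S \<Phi>" "x \<in> S" "0 < e"
  shows "eventually (\<lambda>y. mlin_le n (\<lambda>vs. \<Phi> y vs - \<Phi> x vs) e) (at x within S)"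
  using assms(1)[unfolded cont_fam_def, THEN conjunct2, rule_format, OF assms(2,3)]
  unfolding eventually_at dist_norm by auto

lemma cont_famI:
  assumes "\<And>x. x \<in> S \<Longrightarrow> bounded_mlin n (\<Phi> x)"
    and "\<And>x e. x \<in> S \<Longrightarrow> 0 < e \<Longrightarrow>
      eventually (\<lambda>y. mlin_le n (\<lambda>vs. \<Phi> y vs - \<Phi> x vs) e) (at x within S)"
  shows "cont_fam n S \<Phi>"
  unfolding cont_fam_def
proof (intro conjI ballI allI impI)
  fix x e assume *: "x \<in> S" "0 < (e::real)"
  obtain d where d: "d > 0" "\<And>y. y \<in> S \<Longrightarrow> y \<noteq> x \<Longrightarrow> dist y x < d \<Longrightarrow>
      mlin_le n (\<lambda>vs. \<Phi> y vs - \<Phi> x vs) e"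
    using assms(2)[OF *] unfolding eventually_at by auto
  moreover have "mlin_le n (\<lambda>vs. \<Phi> x vs - \<Phi> x vs) e"
    using * by (simp add: mlin_le_def prod_list_norm_nonneg)
  ultimately have "mlin_le n (\<lambda>vs. \<Phi> y vs - \<Phi> x vs) e" if "y \<in> S" "norm (y - x) < d" for y
    using that by (cases "y = x") (auto simp: dist_norm)
  then show "\<exists>\<delta>>0. \<forall>y\<in>S. norm (y - x) < \<delta> \<longrightarrow> mlin_le n (\<lambda>vs. \<Phi> y vs - \<Phi> x vs) e"
    using d(1) by (intro exI[of _ d]) simp
qed (rule assms(1))

text \<open>Freezing the arguments turns the estimate in operator norm into an ordinary Frechet
  derivative, to which the usual calculus rules apply. \<open>fam_deriv_of_has_derivative\<close> is
  the way back.\<close>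

lemma fam_deriv_has_derivative:
  assumes d: "fam_deriv n S \<Phi> \<Phi>'" and c: "cont_fam (Suc n) S \<Phi>'" and S: "open S" "x \<in> S"
    and len: "length vs = n"
  shows "((\<lambda>y. \<Phi> y vs) has_derivative (\<lambda>h. \<Phi>' x (h # vs))) (at x)"
proof -
  have "((\<lambda>y. \<Phi> y vs) has_derivative (\<lambda>h. \<Phi>' x (h # vs))) (at x within S)"
    unfolding has_derivative_within_alt
  proof (intro conjI allI impI)
    show "bounded_linear (\<lambda>h. \<Phi>' x (h # vs))"
      using bounded_mlin_bounded_linear[OF cont_famD[OF c S(2)], of "[]" vs] len by simp
    fix e :: real assume e: "0 < e"
    \<comment> \<open>The summand 1 keeps the divisor positive when some argument is 0.\<close>
    define P where "P = prod_list (map norm vs) + 1"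
    have P: "0 < P" using prod_list_norm_nonneg[of vs] by (simp add: P_def)
    obtain \<delta> where \<delta>: "\<delta> > 0" "\<And>y. y \<in> S \<Longrightarrow> norm (y - x) < \<delta> \<Longrightarrow>
        mlin_le n (\<lambda>vs. \<Phi> y vs - \<Phi> x vs - \<Phi>' x ((y - x) # vs)) (e / P * norm (y - x))"
      by (rule fam_derivE[OF d S(2) divide_pos_pos[OF e P]]) (rule that)
    have "norm (\<Phi> y vs - \<Phi> x vs - \<Phi>' x ((y - x) # vs)) \<le> e * norm (y - x)"
      if "y \<in> S" "norm (y - x) < \<delta>" for y
    proof -
      have "norm (\<Phi> y vs - \<Phi> x vs - \<Phi>' x ((y - x) # vs)) \<le> e / P * norm (y - x) * prod_list (map norm vs)"
        using mlin_leD[OF \<delta>(2)[OF that] len] .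
      also have "\<dots> \<le> e / P * norm (y - x) * P"
        using e P by (intro mult_left_mono) (auto simp: P_def)
      finally show ?thesis using P by simp
    qed
    then show "\<exists>d>0. \<forall>y\<in>S. norm (y - x) < d \<longrightarrow>
        norm (\<Phi> y vs - \<Phi> x vs - \<Phi>' x ((y - x) # vs)) \<le> e * norm (y - x)"
      by (intro exI[of _ \<delta>] conjI ballI impI \<delta>(1))
  qed
  then show ?thesis unfolding at_within_open[OF S(2,1)] .
qed

text \<open>A derivative that depends on the family alone and not on a domain or a choice:
  derivatives found on different neighbourhoods fit together in \<open>Cfam_local\<close>, and they
  can be iterated in \<open>smooth_map_on_iff_Cfam\<close>. The head of the list is the direction,
  as in \<open>fam_deriv\<close>.\<close>

definition fder ::
    "('a::real_normed_vector \<Rightarrow> 'a list \<Rightarrow> 'b::real_normed_vector) \<Rightarrow> 'a \<Rightarrow> 'a list \<Rightarrow> 'b" where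
  "fder \<Phi> x ws = frechet_derivative (\<lambda>y. \<Phi> y (tl ws)) (at x) (hd ws)"

lemma cont_fam_cong:
  assumes "\<And>x vs. x \<in> S \<Longrightarrow> length vs = n \<Longrightarrow> \<Phi> x vs = \<Psi> x vs"
  shows "cont_fam n S \<Phi> = cont_fam n S \<Psi>"
proof -
  have "bounded_mlin n (\<Phi> x) = bounded_mlin n (\<Psi> x)" if "x \<in> S" for x
    using assms[OF that] by (rule bounded_mlin_cong)
  moreover have "mlin_le n (\<lambda>vs. \<Phi> y vs - \<Phi> x vs) e = mlin_le n (\<lambda>vs. \<Psi> y vs - \<Psi> x vs) e"
    if "x \<in> S" "y \<in> S" for x y e
    using assms that by (intro mlin_le_cong) auto
  ultimately show ?thesis unfolding cont_fam_def by (simp cong: ball_cong)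
qed

lemma fam_deriv_cong:
  assumes "\<And>x vs. x \<in> S \<Longrightarrow> length vs = n \<Longrightarrow> \<Phi> x vs = \<Psi> x vs"
    and "\<And>x vs. x \<in> S \<Longrightarrow> length vs = Suc n \<Longrightarrow> \<Phi>' x vs = \<Psi>' x vs"
  shows "fam_deriv n S \<Phi> \<Phi>' = fam_deriv n S \<Psi> \<Psi>'"
proof -
  have "mlin_le n (\<lambda>vs. \<Phi> y vs - \<Phi> x vs - \<Phi>' x ((y - x) # vs)) e =
      mlin_le n (\<lambda>vs. \<Psi> y vs - \<Psi> x vs - \<Psi>' x ((y - x) # vs)) e"
    if "x \<in> S" "y \<in> S" for x y e
    using assms that by (intro mlin_le_cong) auto
  then show ?thesis unfolding fam_deriv_def by (simp cong: ball_cong)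
qed

text \<open>One derivative family serves both sides, so a case distinction on \<open>j\<close>
  replaces an induction.\<close>

lemma Cfam_cong:
  assumes "\<And>x vs. x \<in> S \<Longrightarrow> length vs = n \<Longrightarrow> \<Phi> x vs = \<Psi> x vs"
  shows "Cfam j n S \<Phi> = Cfam j n S \<Psi>"
proof (cases j)
  case 0
  then show ?thesis using cont_fam_cong[of S n \<Phi> \<Psi>] assms by simp
next
  case (Suc i)
  have "cont_fam n S \<Phi> = cont_fam n S \<Psi>"
    by (rule cont_fam_cong) (use assms in auto)
  moreover
  have "fam_deriv n S \<Phi> \<Phi>' = fam_deriv n S \<Psi> \<Phi>'" for \<Phi>'
    by (rule fam_deriv_cong) (use assms in auto)
  ultimately show ?thesis using Suc by simp
qed

lemma Cfam_cont: "Cfam j n S \<Phi> \<Longrightarrow> cont_fam n S \<Phi>"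
  by (cases j) auto

text \<open>Derivatives on an open set are unique, so the witness hidden in \<open>Cfam\<close>
  agrees with \<open>fder\<close> wherever it matters: at points of \<open>S\<close> and on lists of
  length \<open>Suc n\<close>.\<close>

lemma Cfam_SucD:
  assumes "Cfam (Suc j) n S \<Phi>" "open S"
  shows "fam_deriv n S \<Phi> (fder \<Phi>)" "Cfam j (Suc n) S (fder \<Phi>)"
proof -
  obtain \<Phi>' where \<Phi>': "fam_deriv n S \<Phi> \<Phi>'" "Cfam j (Suc n) S \<Phi>'" using assms by auto
  have eq: "fder \<Phi> x vs = \<Phi>' x vs" if "x \<in> S" "length vs = Suc n" for x vs
  proof -
    have "((\<lambda>y. \<Phi> y (tl vs)) has_derivative (\<lambda>h. \<Phi>' x (h # tl vs))) (at x)"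
      by (rule fam_deriv_has_derivative[OF \<Phi>'(1) Cfam_cont[OF \<Phi>'(2)] assms(2) that(1)])
        (use that in simp)
    then have "frechet_derivative (\<lambda>y. \<Phi> y (tl vs)) (at x) = (\<lambda>h. \<Phi>' x (h # tl vs))"
      by (rule frechet_derivative_at[symmetric])
    then show ?thesis using that by (cases vs) (auto simp: fder_def)
  qed
  show "fam_deriv n S \<Phi> (fder \<Phi>)"
    using \<Phi>'(1) fam_deriv_cong[of S n \<Phi> \<Phi> "fder \<Phi>" \<Phi>'] eq by blast
  show "Cfam j (Suc n) S (fder \<Phi>)" using \<Phi>'(2) Cfam_cong[of S "Suc n" "fder \<Phi>" \<Phi>'] eq by blast
qed

lemma Cfam_Suc_imp: "Cfam (Suc j) n S \<Phi> \<Longrightarrow> Cfam j n S \<Phi>"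
  by (induction j arbitrary: n \<Phi>) auto

lemma smooth_map_on_alt:
  "smooth_map_on k S f \<longleftrightarrow> open S \<and> (\<exists>D. (\<forall>x\<in>S. D 0 x [] = f x) \<and>
     (\<forall>n. enat n \<le> k \<longrightarrow> cont_fam n S (D n)) \<and>
     (\<forall>n. enat n < k \<longrightarrow> fam_deriv n S (D n) (D (Suc n))))"
  unfolding smooth_map_on_def cont_fam_def fam_deriv_def
  by (simp only: imp_conjR all_conj_distrib conj_assoc)

text \<open>Reduces every k, including \<infinity>, to inductions on a natural number. From right to
  left the orders \<open>j\<close> come with unrelated witnesses, whereas
  \<open>smooth_map_on\<close> asks for a single sequence \<open>D\<close>; iterating
  \<open>fder\<close> supplies it.\<close>

lemma smooth_map_on_iff_Cfam:
  "smooth_map_on k S f \<longleftrightarrow> open S \<and> (\<forall>j. enat j \<le> k \<longrightarrow> Cfam j 0 S (\<lambda>x _. f x))"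
proof
  assume "smooth_map_on k S f"
  then obtain D :: "nat \<Rightarrow> 'a \<Rightarrow> 'a list \<Rightarrow> 'b" where S: "open S" and D0: "\<forall>x\<in>S. D 0 x [] = f x"
    and c: "\<And>n. enat n \<le> k \<Longrightarrow> cont_fam n S (D n)"
    and d: "\<And>n. enat n < k \<Longrightarrow> fam_deriv n S (D n) (D (Suc n))"
    unfolding smooth_map_on_alt by blast
  have C: "Cfam j n S (D n)" if "enat (n + j) \<le> k" for j n
    using that
  proof (induction j arbitrary: n)
    case 0
    then show ?case using c by simp
  next
    case (Suc j)
    have "enat n \<le> k" "enat n < k"
      using Suc.prems by (metis enat_ord_simps(1) le_add1 order_trans,
          metis enat_ord_simps(2) less_add_same_cancel1 order_less_le_trans zero_less_Suc)
    then show ?case using c d Suc.IH[of "Suc n"] Suc.prems by auto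
  qed
  have "Cfam j 0 S (D 0) = Cfam j 0 S (\<lambda>x _. f x)" for j
    using D0 by (intro Cfam_cong) auto
  then show "open S \<and> (\<forall>j. enat j \<le> k \<longrightarrow> Cfam j 0 S (\<lambda>x _. f x))" using S C[of 0] by simp
next
  assume *: "open S \<and> (\<forall>j. enat j \<le> k \<longrightarrow> Cfam j 0 S (\<lambda>x _. f x))"
  define D where "D n = (fder ^^ n) (\<lambda>x _. f x)" for n
  have C: "Cfam j n S (D n)" if "enat (n + j) \<le> k" for j n
    using that
  proof (induction n arbitrary: j)
    case 0
    then show ?case using * by (simp add: D_def)
  next
    case (Suc n)
    then have "Cfam (Suc j) n S (D n)" by (simp del: Cfam.simps)
    from Cfam_SucD(2)[OF this] * show ?case by (simp add: D_def)
  qed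
  have "cont_fam n S (D n)" if "enat n \<le> k" for n using C[of n 0] that by simp
  moreover have "fam_deriv n S (D n) (D (Suc n))" if "enat n < k" for n
  proof -
    have "enat (n + Suc 0) \<le> k" using that by (simp add: Suc_ile_eq)
    from Cfam_SucD(1)[OF C[OF this]] * show ?thesis by (simp add: D_def)
  qed
  moreover have "\<forall>x\<in>S. D 0 x [] = f x" by (simp add: D_def)
  ultimately show "smooth_map_on k S f"
    using * unfolding smooth_map_on_alt by blast
qed

section \<open>Locality and restriction of smoothness\<close>

lemma cont_fam_local:
  assumes "\<And>x. x \<in> S \<Longrightarrow> \<exists>U. open U \<and> x \<in> U \<and> cont_fam n U \<Phi>"
  shows "cont_fam n S \<Phi>"
proof (rule cont_famI)
  fix x assume x: "x \<in> S"
  then obtain U where U: "open U" "x \<in> U" "cont_fam n U \<Phi>" using assms by blast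
  then show "bounded_mlin n (\<Phi> x)" by (auto dest: cont_famD)
  fix e :: real assume "0 < e"
  then have "eventually (\<lambda>y. mlin_le n (\<lambda>vs. \<Phi> y vs - \<Phi> x vs) e) (at x)"
    by (rule cont_fam_eventually[OF U(3,2), unfolded at_within_open[OF U(2,1)]])
  then show "eventually (\<lambda>y. mlin_le n (\<lambda>vs. \<Phi> y vs - \<Phi> x vs) e) (at x within S)"
    by (rule filter_leD[OF at_le[OF subset_UNIV]])
qed

lemma fam_deriv_local:
  assumes "\<And>x. x \<in> S \<Longrightarrow> \<exists>U. open U \<and> x \<in> U \<and> fam_deriv n U \<Phi> \<Phi>'"
  shows "fam_deriv n S \<Phi> \<Phi>'"
  unfolding fam_deriv_def
proof (intro ballI allI impI)
  fix x and e :: real assume x: "x \<in> S" and e: "0 < e"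
  obtain U where U: "open U" "x \<in> U" "fam_deriv n U \<Phi> \<Phi>'" using assms[OF x] by blast
  obtain r where r: "r > 0" "ball x r \<subseteq> U"
    using U(1,2) by (rule openE)
  obtain \<delta> where \<delta>: "\<delta> > 0" "\<And>y. y \<in> U \<Longrightarrow> norm (y - x) < \<delta> \<Longrightarrow>
     mlin_le n (\<lambda>vs. \<Phi> y vs - \<Phi> x vs - \<Phi>' x ((y - x) # vs)) (e * norm (y - x))"
    by (rule fam_derivE[OF U(3,2) e]) (rule that)
  show "\<exists>\<delta>>0. \<forall>y\<in>S. norm (y - x) < \<delta> \<longrightarrow>
     mlin_le n (\<lambda>vs. \<Phi> y vs - \<Phi> x vs - \<Phi>' x ((y - x) # vs)) (e * norm (y - x))"
  proof (intro exI conjI ballI impI)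
    show "0 < min r \<delta>" using r \<delta> by simp
    fix y assume y: "norm (y - x) < min r \<delta>"
    then have "y \<in> U" using r by (auto simp: dist_norm norm_minus_commute)
    then show "mlin_le n (\<lambda>vs. \<Phi> y vs - \<Phi> x vs - \<Phi>' x ((y - x) # vs)) (e * norm (y - x))"
      by (rule \<delta>(2)) (use y in simp)
  qed
qed

lemma Cfam_local:
  assumes "\<And>x. x \<in> S \<Longrightarrow> \<exists>U. open U \<and> x \<in> U \<and> Cfam j n U \<Phi>"
  shows "Cfam j n S \<Phi>"
  using assms
proof (induction j arbitrary: n \<Phi>)
  case 0
  then show ?case unfolding Cfam.simps(1) by (rule cont_fam_local)
next
  case (Suc j)
  have U: "\<exists>U. open U \<and> x \<in> U \<and> cont_fam n U \<Phi> \<and> fam_deriv n U \<Phi> (fder \<Phi>) \<and> Cfam j (Suc n) U (fder \<Phi>)"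
    if x: "x \<in> S" for x
  proof -
    obtain U where U: "open U" "x \<in> U" "Cfam (Suc j) n U \<Phi>" using Suc.prems[OF x] by (elim exE conjE)
    show ?thesis
      by (intro exI[of _ U] conjI U Cfam_SucD[OF U(3,1)] Cfam_cont[OF U(3)])
  qed
  have "cont_fam n S \<Phi>" by (rule cont_fam_local) (use U in blast)
  moreover have "fam_deriv n S \<Phi> (fder \<Phi>)" by (rule fam_deriv_local) (use U in blast)
  moreover have "Cfam j (Suc n) S (fder \<Phi>)" by (rule Suc.IH) (use U in blast)
  ultimately show ?case by auto
qed

lemma smooth_map_on_local:
  assumes "open S" "\<And>x. x \<in> S \<Longrightarrow> \<exists>U f'. x \<in> U \<and> smooth_map_on k U f' \<and> (\<forall>y\<in>U. f' y = f y)"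
  shows "smooth_map_on k S f"
  unfolding smooth_map_on_iff_Cfam
proof (intro conjI allI impI Cfam_local)
  fix j x assume j: "enat j \<le> k" and x: "x \<in> S"
  obtain U f' where U: "x \<in> U" "smooth_map_on k U f'" "\<forall>y\<in>U. f' y = f y" using assms(2)[OF x] by blast
  have "Cfam j 0 U (\<lambda>x _. f' x) = Cfam j 0 U (\<lambda>x _. f x)"
    by (rule Cfam_cong) (use U in auto)
  then show "\<exists>U. open U \<and> x \<in> U \<and> Cfam j 0 U (\<lambda>x _. f x)"
    using U(1,2) j unfolding smooth_map_on_iff_Cfam by auto
qed (use assms in auto)

lemma smooth_map_on_open: "smooth_map_on k S f \<Longrightarrow> open S"
  by (simp add: smooth_map_on_def)

lemma smooth_map_on_le: "smooth_map_on k S f \<Longrightarrow> m \<le> k \<Longrightarrow> smooth_map_on m S f"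
  unfolding smooth_map_on_iff_Cfam by (auto simp del: Cfam.simps dest: order_trans)

lemma smooth_map_on_subset:
  assumes "smooth_map_on k S f" "open U" "U \<subseteq> S" shows "smooth_map_on k U f"
proof (rule smooth_map_on_local[OF assms(2)])
  show "\<exists>V f'. x \<in> V \<and> smooth_map_on k V f' \<and> (\<forall>y\<in>V. f' y = f y)" if "x \<in> U" for x
    by (rule exI[of _ S], rule exI[of _ f]) (use assms that in auto)
qed

lemma smooth_map_on_cong:
  assumes "smooth_map_on k S f" "\<And>x. x \<in> S \<Longrightarrow> f x = g x" shows "smooth_map_on k S g"
proof (rule smooth_map_on_local[OF smooth_map_on_open[OF assms(1)]])
  show "\<exists>V f'. x \<in> V \<and> smooth_map_on k V f' \<and> (\<forall>y\<in>V. f' y = g y)" if "x \<in> S" for x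
    by (rule exI[of _ S], rule exI[of _ f]) (use assms that in auto)
qed

text \<open>Continuity of the derivative is extracted direction by direction: segments in a chart
  have a fixed coordinate direction, and the cutoff function has a one-dimensional domain.\<close>

lemma smooth_map_on_C1:
  assumes "smooth_map_on k S f" "1 \<le> k"
  obtains D where "\<And>x. x \<in> S \<Longrightarrow> (f has_derivative D x) (at x)"
    and "\<And>v. continuous_on S (\<lambda>x. D x v)"
proof -
  have S: "open S" by (rule smooth_map_on_open[OF assms(1)])
  have C: "Cfam (Suc 0) 0 S (\<lambda>x _. f x)"
    using assms unfolding smooth_map_on_iff_Cfam by (simp add: one_enat_def del: Cfam.simps)
  note d = Cfam_SucD[OF C S]
  then have c: "cont_fam (Suc 0) S (fder (\<lambda>x _. f x))" by simp
  show ?thesis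
  proof (rule that[of "\<lambda>x v. fder (\<lambda>x _. f x) x [v]"])
    show "(f has_derivative (\<lambda>v. fder (\<lambda>x _. f x) x [v])) (at x)" if "x \<in> S" for x
      using fam_deriv_has_derivative[OF d(1) c S that, of "[]"] by simp
    show "continuous_on S (\<lambda>x. fder (\<lambda>x _. f x) x [v])" for v
      unfolding continuous_on_def
    proof
      fix x assume x: "x \<in> S"
      show "((\<lambda>x. fder (\<lambda>x _. f x) x [v]) \<longlongrightarrow> fder (\<lambda>x _. f x) x [v]) (at x within S)"
      proof (rule tendstoI)
        fix e :: real assume e: "0 < e"
        have "0 < e / (norm v + 1)" using e by (simp add: add_nonneg_pos)
        from cont_fam_eventually[OF c x this]
        show "\<forall>\<^sub>F y in at x within S. dist (fder (\<lambda>x _. f x) y [v]) (fder (\<lambda>x _. f x) x [v]) < e"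
        proof eventually_elim
          case (elim y)
          from mlin_leD[OF elim, of "[v]"]
          have "norm (fder (\<lambda>x _. f x) y [v] - fder (\<lambda>x _. f x) x [v]) \<le> e / (norm v + 1) * norm v"
            by simp
          also have "\<dots> < e"
            using e by (simp add: pos_divide_less_eq add_pos_nonneg add_nonneg_pos distrib_left)
          finally show ?case by (simp add: dist_norm)
        qed
      qed
    qed
  qed
qed

section \<open>Sums, scalar multiples and constants\<close>

lemma cont_fam_add:
  assumes "cont_fam n S \<Phi>" "cont_fam n S \<Psi>"
  shows "cont_fam n S (\<lambda>x vs. \<Phi> x vs + \<Psi> x vs)"
proof (rule cont_famI)
  fix x assume x: "x \<in> S"
  show "bounded_mlin n (\<lambda>vs. \<Phi> x vs + \<Psi> x vs)"
    by (rule bounded_mlin_add[OF cont_famD[OF assms(1) x] cont_famD[OF assms(2) x]])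
  fix e :: real assume e: "0 < e"
  then have "0 < e / 2" by simp
  from cont_fam_eventually[OF assms(1) x this] cont_fam_eventually[OF assms(2) x this]
  show "\<forall>\<^sub>F y in at x within S. mlin_le n (\<lambda>vs. \<Phi> y vs + \<Psi> y vs - (\<Phi> x vs + \<Psi> x vs)) e"
  proof eventually_elim
    case (elim y)
    from mlin_le_add[OF elim] show ?case by (simp add: add_diff_add)
  qed
qed

lemma fam_deriv_add:
  assumes "fam_deriv n S \<Phi> \<Phi>'" "fam_deriv n S \<Psi> \<Psi>'"
  shows "fam_deriv n S (\<lambda>x vs. \<Phi> x vs + \<Psi> x vs) (\<lambda>x vs. \<Phi>' x vs + \<Psi>' x vs)"
  unfolding fam_deriv_def
proof (intro ballI allI impI)
  fix x and e :: real assume x: "x \<in> S" and e: "0 < e"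
  then have e2: "0 < e / 2" by simp
  obtain \<delta>1 where 1: "\<delta>1 > 0" "\<And>y. y \<in> S \<Longrightarrow> norm (y - x) < \<delta>1 \<Longrightarrow>
     mlin_le n (\<lambda>vs. \<Phi> y vs - \<Phi> x vs - \<Phi>' x ((y - x) # vs)) (e / 2 * norm (y - x))"
    by (rule fam_derivE[OF assms(1) x e2]) (rule that)
  obtain \<delta>2 where 2: "\<delta>2 > 0" "\<And>y. y \<in> S \<Longrightarrow> norm (y - x) < \<delta>2 \<Longrightarrow>
     mlin_le n (\<lambda>vs. \<Psi> y vs - \<Psi> x vs - \<Psi>' x ((y - x) # vs)) (e / 2 * norm (y - x))"
    by (rule fam_derivE[OF assms(2) x e2]) (rule that)
  have "mlin_le n (\<lambda>vs. \<Phi> y vs + \<Psi> y vs - (\<Phi> x vs + \<Psi> x vs) -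
      (\<Phi>' x ((y - x) # vs) + \<Psi>' x ((y - x) # vs))) (e * norm (y - x))"
    if "y \<in> S" "norm (y - x) < min \<delta>1 \<delta>2" for y
  proof -
    have "e / 2 * norm (y - x) + e / 2 * norm (y - x) = e * norm (y - x)" by simp
    then show ?thesis
      using mlin_le_add[OF 1(2) 2(2), of y y] that by (simp add: add_diff_add)
  qed
  then show "\<exists>\<delta>>0. \<forall>y\<in>S. norm (y - x) < \<delta> \<longrightarrow>
     mlin_le n (\<lambda>vs. \<Phi> y vs + \<Psi> y vs - (\<Phi> x vs + \<Psi> x vs) -
      (\<Phi>' x ((y - x) # vs) + \<Psi>' x ((y - x) # vs))) (e * norm (y - x))"
    using 1(1) 2(1) by (intro exI[of _ "min \<delta>1 \<delta>2"]) simp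
qed

lemma Cfam_add:
  "Cfam j n S \<Phi> \<Longrightarrow> Cfam j n S \<Psi> \<Longrightarrow> Cfam j n S (\<lambda>x vs. \<Phi> x vs + \<Psi> x vs)"
proof (induction j arbitrary: n \<Phi> \<Psi>)
  case 0
  then show ?case unfolding Cfam.simps(1) by (rule cont_fam_add)
next
  case (Suc j)
  from Suc.prems(1) obtain \<Phi>' where P: "cont_fam n S \<Phi>" "fam_deriv n S \<Phi> \<Phi>'" "Cfam j (Suc n) S \<Phi>'"
    by (rule Cfam_SucE)
  from Suc.prems(2) obtain \<Psi>' where Q: "cont_fam n S \<Psi>" "fam_deriv n S \<Psi> \<Psi>'" "Cfam j (Suc n) S \<Psi>'"
    by (rule Cfam_SucE)
  show ?case
    by (rule Cfam_SucI[OF cont_fam_add[OF P(1) Q(1)] fam_deriv_add[OF P(2) Q(2)] Suc.IH[OF P(3) Q(3)]])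
qed

lemma cont_fam_scaleR:
  assumes "cont_fam n S \<Phi>"
  shows "cont_fam n S (\<lambda>x vs. c *\<^sub>R \<Phi> x vs)"
proof (rule cont_famI)
  fix x assume x: "x \<in> S"
  show "bounded_mlin n (\<lambda>vs. c *\<^sub>R \<Phi> x vs)"
    by (rule bounded_mlin_scaleR[OF cont_famD[OF assms x]])
  fix e :: real assume e: "0 < e"
  then have "0 < e / (\<bar>c\<bar> + 1)" by (simp add: add_nonneg_pos)
  from cont_fam_eventually[OF assms(1) x this]
  show "\<forall>\<^sub>F y in at x within S. mlin_le n (\<lambda>vs. c *\<^sub>R \<Phi> y vs - c *\<^sub>R \<Phi> x vs) e"
  proof eventually_elim
    case (elim y)
    have "\<bar>c\<bar> * (e / (\<bar>c\<bar> + 1)) \<le> e" using e by (simp add: field_simps)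
    from mlin_le_mono[OF mlin_le_scaleR[OF elim] this] show ?case
      by (simp add: scaleR_diff_right)
  qed
qed

lemma fam_deriv_scaleR:
  assumes "fam_deriv n S \<Phi> \<Phi>'"
  shows "fam_deriv n S (\<lambda>x vs. c *\<^sub>R \<Phi> x vs) (\<lambda>x vs. c *\<^sub>R \<Phi>' x vs)"
  unfolding fam_deriv_def
proof (intro ballI allI impI)
  fix x and e :: real assume x: "x \<in> S" and e: "0 < e"
  then have e2: "0 < e / (\<bar>c\<bar> + 1)" by (simp add: add_nonneg_pos)
  obtain \<delta> where d: "\<delta> > 0" "\<And>y. y \<in> S \<Longrightarrow> norm (y - x) < \<delta> \<Longrightarrow>
     mlin_le n (\<lambda>vs. \<Phi> y vs - \<Phi> x vs - \<Phi>' x ((y - x) # vs)) (e / (\<bar>c\<bar> + 1) * norm (y - x))"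
    by (rule fam_derivE[OF assms(1) x e2]) (rule that)
  have "mlin_le n (\<lambda>vs. c *\<^sub>R \<Phi> y vs - c *\<^sub>R \<Phi> x vs - c *\<^sub>R \<Phi>' x ((y - x) # vs)) (e * norm (y - x))"
    if "y \<in> S" "norm (y - x) < \<delta>" for y
  proof -
    have "\<bar>c\<bar> * (e / (\<bar>c\<bar> + 1)) \<le> e" using e by (simp add: field_simps)
    then have "\<bar>c\<bar> * (e / (\<bar>c\<bar> + 1) * norm (y - x)) \<le> e * norm (y - x)"
      by (metis mult.assoc mult_right_mono norm_ge_zero)
    from mlin_le_mono[OF mlin_le_scaleR[OF d(2)[OF that]] this] show ?thesis
      by (simp add: scaleR_diff_right)
  qed
  then show "\<exists>\<delta>>0. \<forall>y\<in>S. norm (y - x) < \<delta> \<longrightarrow>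
     mlin_le n (\<lambda>vs. c *\<^sub>R \<Phi> y vs - c *\<^sub>R \<Phi> x vs - c *\<^sub>R \<Phi>' x ((y - x) # vs)) (e * norm (y - x))"
    using d(1) by (intro exI[of _ \<delta>]) simp
qed

lemma Cfam_scaleR: "Cfam j n S \<Phi> \<Longrightarrow> Cfam j n S (\<lambda>x vs. c *\<^sub>R \<Phi> x vs)"
proof (induction j arbitrary: n \<Phi>)
  case 0
  then show ?case unfolding Cfam.simps(1) by (rule cont_fam_scaleR)
next
  case (Suc j)
  from Suc.prems obtain \<Phi>' where P: "cont_fam n S \<Phi>" "fam_deriv n S \<Phi> \<Phi>'" "Cfam j (Suc n) S \<Phi>'"
    by (rule Cfam_SucE)
  show ?case
    by (rule Cfam_SucI[OF cont_fam_scaleR[OF P(1)] fam_deriv_scaleR[OF P(2)] Suc.IH[OF P(3)]])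
qed

lemma linear_zero_fun: "linear (\<lambda>_. 0)"
  by (rule linearI) auto

lemma bounded_mlin_zero: "bounded_mlin n (\<lambda>_. 0)"
  unfolding bounded_mlin_def mlin_le_def by (auto intro!: linear_zero_fun exI[of _ 0])

lemma cont_fam_zero: "cont_fam n S (\<lambda>_ _. 0)"
  by (auto simp: cont_fam_def bounded_mlin_zero mlin_le_def intro!: exI[of _ 1] mult_nonneg_nonneg prod_list_norm_nonneg)

lemma Cfam_zero: "Cfam j n S (\<lambda>_ _. 0)"
proof (induction j arbitrary: n)
  case 0
  show ?case by (simp add: cont_fam_zero)
next
  case (Suc j)
  have "fam_deriv n S (\<lambda>_ _. 0) (\<lambda>_ _. 0)"
    unfolding fam_deriv_def mlin_le_def by (auto intro!: exI[of _ 1] mult_nonneg_nonneg prod_list_norm_nonneg)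
  from Cfam_SucI[OF cont_fam_zero this Suc.IH] show ?case .
qed

lemma Cfam_sum:
  "finite A \<Longrightarrow> (\<And>i. i \<in> A \<Longrightarrow> Cfam j n S (\<Phi> i)) \<Longrightarrow> Cfam j n S (\<lambda>x vs. \<Sum>i\<in>A. \<Phi> i x vs)"
proof (induction A rule: finite_induct)
  case (insert i A)
  then show ?case using Cfam_add[of j n S "\<Phi> i"] by simp
qed (simp add: Cfam_zero)

lemma smooth_map_on_const:
  assumes "open S" shows "smooth_map_on k S (\<lambda>_. c)"
  unfolding smooth_map_on_iff_Cfam
proof (intro conjI allI impI)
  fix j
  have c: "cont_fam 0 S (\<lambda>_ _. c)"
    unfolding cont_fam_def bounded_mlin_def mlin_le_def by (auto intro: exI[of _ 1])
  show "Cfam j 0 S (\<lambda>_ _. c)"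
  proof (cases j)
    case (Suc i)
    have "fam_deriv 0 S (\<lambda>_ _. c) (\<lambda>_ _. 0)"
      unfolding fam_deriv_def mlin_le_def by (auto intro!: exI[of _ 1])
    from Cfam_SucI[OF c this Cfam_zero] show ?thesis using Suc by simp
  qed (use c in auto)
qed (fact assms)

lemma smooth_map_on_add:
  "smooth_map_on k S f \<Longrightarrow> smooth_map_on k S g \<Longrightarrow> smooth_map_on k S (\<lambda>x. f x + g x)"
  unfolding smooth_map_on_iff_Cfam by (intro conjI allI impI Cfam_add) auto

lemma smooth_map_on_scaleR:
  "smooth_map_on k S f \<Longrightarrow> smooth_map_on k S (\<lambda>x. c *\<^sub>R f x)"
  unfolding smooth_map_on_iff_Cfam by (intro conjI allI impI Cfam_scaleR) auto

section \<open>Derivatives of multilinear expressions\<close>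

lemma prod_list_norm_le:
  fixes \<alpha> :: "'i \<Rightarrow> 'a::real_normed_vector"
  assumes "0 \<le> M" "\<And>i. i \<in> set xs \<Longrightarrow> norm (\<alpha> i) \<le> M * p i"
  shows "prod_list (map norm (map \<alpha> xs)) \<le> M ^ length xs * prod_list (map p xs)"
  using assms(2)
proof (induction xs)
  case (Cons i xs)
  have "norm (\<alpha> i) * prod_list (map norm (map \<alpha> xs)) \<le> (M * p i) * (M ^ length xs * prod_list (map p xs))"
    using Cons prod_list_norm_nonneg[of "map \<alpha> xs"]
    by (intro mult_mono) (auto intro: order_trans[OF norm_ge_zero])
  then show ?case by (simp add: mult_ac)
qed simp

text \<open>The entries \<alpha> are exchanged for \<beta> one at a time; the prefix
  \<open>us\<close> holds the entries already passed. The weights \<open>p\<close> allow an entry to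
  be a multilinear expression itself, measured against the norms of its own arguments, as in
  \<open>cont_fam_comp\<close>.\<close>

lemma multilinear_telescope:
  fixes M \<eta> B :: real and p :: "'i \<Rightarrow> real"
  assumes T: "bounded_mlin n T" and B: "mlin_le n T B" "0 \<le> B" and M: "1 \<le> M" and \<eta>: "0 \<le> \<eta>"
    and "length us + length xs = n"
    and "\<And>i. i \<in> set xs \<Longrightarrow> norm (\<alpha> i) \<le> M * p i"
    and "\<And>i. i \<in> set xs \<Longrightarrow> norm (\<beta> i) \<le> M * p i"
    and "\<And>i. i \<in> set xs \<Longrightarrow> norm (\<alpha> i - \<beta> i) \<le> \<eta> * p i"
  shows "norm (T (us @ map \<alpha> xs) - T (us @ map \<beta> xs)) \<le>
    B * prod_list (map norm us) * (length xs * \<eta> * M ^ length xs * prod_list (map p xs))"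
  using assms(6-9)
proof (induction xs arbitrary: us)
  case (Cons i xs)
  define U P where "U = prod_list (map norm us)" and "P = prod_list (map p xs)"
  have U: "0 \<le> U" unfolding U_def by (rule prod_list_norm_nonneg)
  have M0: "0 \<le> M" using M by simp
  have "0 \<le> M * p i" using order_trans[OF norm_ge_zero Cons.prems(2)[of i]] by simp
  then have pi: "0 \<le> p i" using M by (simp add: zero_le_mult_iff)
  have Pb: "prod_list (map norm (map \<beta> xs)) \<le> M ^ length xs * P"
    unfolding P_def using Cons.prems M0 by (intro prod_list_norm_le) auto
  have P: "0 \<le> M ^ length xs * P" using Pb prod_list_norm_nonneg[of "map \<beta> xs"] by linarith
  have 1: "norm (T ((us @ [\<alpha> i]) @ map \<alpha> xs) - T ((us @ [\<alpha> i]) @ map \<beta> xs)) \<le>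
      B * prod_list (map norm (us @ [\<alpha> i])) * (length xs * \<eta> * M ^ length xs * prod_list (map p xs))"
    by (rule Cons.IH) (use Cons.prems in auto)
  also have "\<dots> = B * U * (length xs * \<eta> * (M ^ length xs * P)) * norm (\<alpha> i)"
    by (simp add: U_def P_def mult_ac)
  also have "\<dots> \<le> B * U * (length xs * \<eta> * (M ^ length xs * P)) * (M * p i)"
    by (intro mult_left_mono mult_nonneg_nonneg[OF mult_nonneg_nonneg[OF B(2) U] mult_nonneg_nonneg[OF _ P]])
      (use \<eta> Cons.prems(2)[of i] in auto)
  finally have A: "norm (T (us @ \<alpha> i # map \<alpha> xs) - T (us @ \<alpha> i # map \<beta> xs)) \<le>
      B * U * (length xs * \<eta> * (M ^ length xs * P)) * (M * p i)" by simp
  have "norm (T (us @ (\<alpha> i - \<beta> i) # map \<beta> xs)) \<le> B * prod_list (map norm (us @ (\<alpha> i - \<beta> i) # map \<beta> xs))"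
    by (rule mlin_leD[OF B(1)]) (use Cons.prems in simp)
  also have "\<dots> = B * U * (norm (\<alpha> i - \<beta> i) * prod_list (map norm (map \<beta> xs)))"
    by (simp add: U_def mult_ac)
  also have "\<dots> \<le> B * U * ((\<eta> * p i) * (M ^ length xs * P))"
    using B(2) U \<eta> pi Pb Cons.prems(4)[of i] prod_list_norm_nonneg[of "map \<beta> xs"]
    by (intro mult_left_mono mult_mono mult_nonneg_nonneg) auto
  \<comment> \<open>As 1 \<le> M, a spare factor M can be inserted, so that this summand matches the
    one from the induction hypothesis.\<close>
  also have "\<dots> \<le> B * U * ((\<eta> * p i) * (M * (M ^ length xs * P)))"
  proof -
    have "1 * (M ^ length xs * P) \<le> M * (M ^ length xs * P)"
      by (rule mult_right_mono[OF M P])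
    then show ?thesis using B(2) U \<eta> pi by (intro mult_left_mono mult_nonneg_nonneg) auto
  qed
  finally have C: "norm (T (us @ (\<alpha> i - \<beta> i) # map \<beta> xs)) \<le> B * U * ((\<eta> * p i) * (M * (M ^ length xs * P)))" .
  have "T (us @ (\<alpha> i - \<beta> i) # map \<beta> xs) = T (us @ \<alpha> i # map \<beta> xs) - T (us @ \<beta> i # map \<beta> xs)"
    by (rule bounded_mlin_diff[OF T]) (use Cons.prems in simp)
  then have eq: "T (us @ map \<alpha> (i # xs)) - T (us @ map \<beta> (i # xs)) =
      (T (us @ \<alpha> i # map \<alpha> xs) - T (us @ \<alpha> i # map \<beta> xs)) + T (us @ (\<alpha> i - \<beta> i) # map \<beta> xs)"
    by simp
  have "norm (T (us @ map \<alpha> (i # xs)) - T (us @ map \<beta> (i # xs))) \<le>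
      B * U * (length xs * \<eta> * (M ^ length xs * P)) * (M * p i) + B * U * ((\<eta> * p i) * (M * (M ^ length xs * P)))"
    unfolding eq by (rule norm_triangle_mono[OF A C])
  also have "\<dots> = B * prod_list (map norm us) *
      (length (i # xs) * \<eta> * M ^ length (i # xs) * prod_list (map p (i # xs)))"
    by (simp add: U_def P_def algebra_simps)
  finally show ?case .
qed simp

text \<open>H y y is the mixed difference plus H y x + H x y - H x x, and the mixed difference has
  derivative 0. This is the common core of the product rule and the chain rule below.\<close>

lemma has_derivative_diagonal:
  assumes P: "((\<lambda>y. H y x) has_derivative P) (at x)" and Q: "((\<lambda>y. H x y) has_derivative Q) (at x)"
    and R: "\<And>e. 0 < e \<Longrightarrow> eventually (\<lambda>y. norm (H y y - H y x - (H x y - H x x)) \<le> e * norm (y - x)) (at x)"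
  shows "((\<lambda>y. H y y) has_derivative (\<lambda>h. P h + Q h)) (at x)"
proof -
  have "((\<lambda>y. H y y - H y x - (H x y - H x x)) has_derivative (\<lambda>h. 0)) (at x)"
    unfolding has_derivative_within_alt2 by (intro conjI allI impI bounded_linear_zero) (simp add: R)
  from has_derivative_add[OF this has_derivative_add[OF P has_derivative_diff[OF Q has_derivative_const[of "H x x"]]]]
  show ?thesis by simp
qed

lemma eventually_mult_norm_diff_le:
  fixes x :: "'a::real_normed_vector"
  assumes "0 < (e::real)"
  shows "eventually (\<lambda>y. Q * norm (y - x) \<le> e) (at x)"
proof -
  have "((\<lambda>y. Q * norm (y - x)) \<longlongrightarrow> Q * norm (x - x)) (at x)"
    by (intro tendsto_intros)
  then have "eventually (\<lambda>y. Q * norm (y - x) < e) (at x)"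
    by (rule order_tendstoD(2)) (use assms in simp)
  then show ?thesis by (rule eventually_mono) simp
qed

lemma has_derivative_locally_lipschitz:
  assumes "(f has_derivative f') (at x)"
  obtains C where "0 \<le> C" "eventually (\<lambda>y. norm (f y - f x) \<le> C * norm (y - x)) (at x)"
proof -
  have bl: "bounded_linear f'" and *: "eventually (\<lambda>y. norm (f y - f x - f' (y - x)) \<le> 1 * norm (y - x)) (at x)"
    using assms unfolding has_derivative_within_alt2 by (blast, metis zero_less_one)
  obtain K where K: "0 < K" "\<And>h. norm (f' h) \<le> norm h * K"
    using bounded_linear.pos_bounded[OF bl] by blast
  from * have "eventually (\<lambda>y. norm (f y - f x) \<le> (1 + K) * norm (y - x)) (at x)"
  proof eventually_elim
    case (elim y)
    have "norm (f y - f x) \<le> norm (f y - f x - f' (y - x)) + norm (f' (y - x))"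
      by (metis diff_add_cancel norm_triangle_ineq)
    then show ?case using elim K(2)[of "y - x"] by (simp add: algebra_simps)
  qed
  then show ?thesis by (rule that[rotated]) (use K in simp)
qed

lemma has_derivative_list_locally_lipschitz:
  assumes "\<And>i. i \<in> set xs \<Longrightarrow> (\<alpha> i has_derivative \<alpha>' i) (at x)"
  obtains C where "0 \<le> C" "eventually (\<lambda>y. \<forall>i\<in>set xs. norm (\<alpha> i y - \<alpha> i x) \<le> C * norm (y - x)) (at x)"
proof -
  have "\<forall>i\<in>set xs. \<exists>C\<ge>0. eventually (\<lambda>y. norm (\<alpha> i y - \<alpha> i x) \<le> C * norm (y - x)) (at x)"
    using has_derivative_locally_lipschitz[OF assms] by blast
  then obtain C where C: "\<And>i. i \<in> set xs \<Longrightarrow> 0 \<le> C i"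
    "\<And>i. i \<in> set xs \<Longrightarrow> eventually (\<lambda>y. norm (\<alpha> i y - \<alpha> i x) \<le> C i * norm (y - x)) (at x)"
    by metis
  define D where "D = sum C (set xs)"
  have D: "C i \<le> D" if "i \<in> set xs" for i
    unfolding D_def using that C(1) by (intro member_le_sum) auto
  have "eventually (\<lambda>y. norm (\<alpha> i y - \<alpha> i x) \<le> D * norm (y - x)) (at x)" if "i \<in> set xs" for i
    using C(2)[OF that] by eventually_elim (meson D mult_right_mono norm_ge_zero order_trans that)
  then have "eventually (\<lambda>y. \<forall>i\<in>set xs. norm (\<alpha> i y - \<alpha> i x) \<le> D * norm (y - x)) (at x)"
    by (intro eventually_ball_finite) auto
  moreover have "0 \<le> D" unfolding D_def using C(1) by (rule sum_nonneg)
  ultimately show ?thesis by (rule that[rotated])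
qed

lemma list_norm_bound:
  obtains M :: real where "1 \<le> M" "\<And>i. i \<in> set xs \<Longrightarrow> norm (\<alpha> i) + 1 \<le> M"
proof (rule that[of "1 + (\<Sum>i\<in>set xs. norm (\<alpha> i))"])
  show "norm (\<alpha> i) + 1 \<le> 1 + (\<Sum>i\<in>set xs. norm (\<alpha> i))" if "i \<in> set xs" for i
    using member_le_sum[OF that, of "\<lambda>i. norm (\<alpha> i)"] by simp
qed (simp add: sum_nonneg)

lemma prod_list_const_one: "prod_list (map (\<lambda>_. 1::real) xs) = 1"
  by (induction xs) auto

text \<open>C and the neighbourhood are fixed before the map, the prefix and the bound B, because
  the lemma is applied to prefixes and maps that vary with y.\<close>

lemma multilinear_differences:
  fixes T :: "'y::real_normed_vector list \<Rightarrow> 'z::real_normed_vector" and x :: "'a::real_normed_vector"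
  assumes d: "\<And>i. i \<in> set xs \<Longrightarrow> (\<alpha> i has_derivative \<alpha>' i) (at x)"
  obtains C where "0 \<le> C"
    "eventually (\<lambda>y. \<forall>(T :: 'y list \<Rightarrow> 'z) n us B. bounded_mlin n T \<longrightarrow> mlin_le n T B \<longrightarrow> 0 \<le> B \<longrightarrow> length us + length xs = n \<longrightarrow>
      norm (T (us @ map (\<lambda>i. \<alpha> i y) xs) - T (us @ map (\<lambda>i. \<alpha> i x) xs)) \<le>
        B * prod_list (map norm us) * (C * norm (y - x))) (at x)"
proof -
  obtain C where C: "0 \<le> C" "eventually (\<lambda>y. \<forall>i\<in>set xs. norm (\<alpha> i y - \<alpha> i x) \<le> C * norm (y - x)) (at x)"
    using has_derivative_list_locally_lipschitz[OF d] .
  obtain M where M: "1 \<le> M" "\<And>i. i \<in> set xs \<Longrightarrow> norm (\<alpha> i x) + 1 \<le> M"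
    using list_norm_bound[of xs "\<lambda>i. \<alpha> i x"] by blast
  show ?thesis
  proof (rule that[of "length xs * C * M ^ length xs"])
    show "0 \<le> length xs * C * M ^ length xs" using C M by simp
    have "eventually (\<lambda>y. C * norm (y - x) \<le> 1) (at x)"
      by (rule eventually_mult_norm_diff_le) simp
    with C(2) show "eventually (\<lambda>y. \<forall>(T :: 'y list \<Rightarrow> 'z) n us B. bounded_mlin n T \<longrightarrow> mlin_le n T B \<longrightarrow> 0 \<le> B \<longrightarrow>
      length us + length xs = n \<longrightarrow>
      norm (T (us @ map (\<lambda>i. \<alpha> i y) xs) - T (us @ map (\<lambda>i. \<alpha> i x) xs)) \<le>
        B * prod_list (map norm us) * (length xs * C * M ^ length xs * norm (y - x))) (at x)"
    proof eventually_elim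
      case (elim y)
      show ?case
      proof (intro allI impI)
        fix T :: "'y list \<Rightarrow> 'z" and n and us :: "'y list" and B :: real
        assume T: "bounded_mlin n T" "mlin_le n T B" "0 \<le> B" "length us + length xs = n"
        have "norm (T (us @ map (\<lambda>i. \<alpha> i y) xs) - T (us @ map (\<lambda>i. \<alpha> i x) xs)) \<le> B * prod_list (map norm us) *
          (length xs * (C * norm (y - x)) * M ^ length xs * prod_list (map (\<lambda>_. 1) xs))"
        proof (rule multilinear_telescope[OF T(1-3) M(1) _ T(4)])
          show "0 \<le> C * norm (y - x)" using C by simp
          fix i assume i: "i \<in> set xs"
          have 1: "norm (\<alpha> i y - \<alpha> i x) \<le> C * norm (y - x)" using elim i by blast
          have "norm (\<alpha> i y) \<le> norm (\<alpha> i x) + norm (\<alpha> i y - \<alpha> i x)"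
            by (rule norm_triangle_sub)
          then show "norm (\<alpha> i y) \<le> M * 1" using 1 elim(2) M(2)[OF i] by linarith
          show "norm (\<alpha> i x) \<le> M * 1" using M(2)[OF i] by linarith
          show "norm (\<alpha> i y - \<alpha> i x) \<le> C * norm (y - x) * 1" using 1 by simp
        qed
        then show "norm (T (us @ map (\<lambda>i. \<alpha> i y) xs) - T (us @ map (\<lambda>i. \<alpha> i x) xs)) \<le>
          B * prod_list (map norm us) * (length xs * C * M ^ length xs * norm (y - x))"
          by (simp add: prod_list_const_one mult_ac)
      qed
    qed
  qed
qed

text \<open>Product rule for a list of factors. Once the first entry is split off, the mixed
  difference contains the increment of that entry and an increment of the tail, so it is of second
  order in y - x.\<close>

lemma multilinear_has_derivative:
  assumes "bounded_mlin n T" "length us + length xs = n"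
    and "\<And>i. i \<in> set xs \<Longrightarrow> (\<alpha> i has_derivative \<alpha>' i) (at x)"
  shows "((\<lambda>y. T (us @ map (\<lambda>i. \<alpha> i y) xs)) has_derivative
    (\<lambda>h. \<Sum>j<length xs. T (us @ (map (\<lambda>i. \<alpha> i x) xs)[j := \<alpha>' (xs ! j) h]))) (at x)"
  using assms(2-)
proof (induction xs arbitrary: us)
  case (Cons i xs)
  obtain B where B: "0 < B" "mlin_le n T B" using assms(1) by (rule bounded_mlinE)
  define U where "U = prod_list (map norm us)"
  have U: "0 \<le> U" unfolding U_def by (rule prod_list_norm_nonneg)
  let ?cs = "\<lambda>y. map (\<lambda>i. \<alpha> i y) xs"
  have i: "(\<alpha> i has_derivative \<alpha>' i) (at x)" using Cons.prems by simp
  have len: "length us + Suc (length (?cs y)) = n" for y using Cons.prems(1) by simp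
  have 1: "((\<lambda>y. T (us @ \<alpha> i y # ?cs x)) has_derivative (\<lambda>h. T (us @ \<alpha>' i h # ?cs x))) (at x)"
    by (rule bounded_linear.has_derivative[OF bounded_mlin_bounded_linear[OF assms(1) len] i])
  have 2: "((\<lambda>y. T ((us @ [\<alpha> i x]) @ ?cs y)) has_derivative
      (\<lambda>h. \<Sum>j<length xs. T ((us @ [\<alpha> i x]) @ (?cs x)[j := \<alpha>' (xs ! j) h]))) (at x)"
    by (rule Cons.IH) (use Cons.prems in auto)
  obtain C1 where C1: "0 \<le> C1" "eventually (\<lambda>y. norm (\<alpha> i y - \<alpha> i x) \<le> C1 * norm (y - x)) (at x)"
    by (rule has_derivative_locally_lipschitz[OF i])
  obtain C where C: "0 \<le> C"
    "eventually (\<lambda>y. \<forall>(T :: 'a list \<Rightarrow> 'b) n us B. bounded_mlin n T \<longrightarrow> mlin_le n T B \<longrightarrow> 0 \<le> B \<longrightarrow> length us + length xs = n \<longrightarrow>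
      norm (T (us @ ?cs y) - T (us @ ?cs x)) \<le>
        B * prod_list (map norm us) * (C * norm (y - x))) (at x)"
    by (rule multilinear_differences[of xs \<alpha> \<alpha>' x]) (use Cons.prems in auto)
  have 3: "eventually (\<lambda>y. norm (T (us @ \<alpha> i y # ?cs y) - T (us @ \<alpha> i y # ?cs x) -
      (T (us @ \<alpha> i x # ?cs y) - T (us @ \<alpha> i x # ?cs x))) \<le> e * norm (y - x)) (at x)" if e: "0 < e" for e
    using C1(2) C(2) eventually_mult_norm_diff_le[OF e, of "B * U * C1 * C" x]
  proof eventually_elim
    case (elim y)
    let ?v = "\<alpha> i y - \<alpha> i x"
    have d: "T (us @ ?v # ?cs z) = T (us @ \<alpha> i y # ?cs z) - T (us @ \<alpha> i x # ?cs z)" for z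
      by (rule bounded_mlin_diff[OF assms(1) len])
    have "norm (T ((us @ [?v]) @ ?cs y) - T ((us @ [?v]) @ ?cs x)) \<le>
        B * prod_list (map norm (us @ [?v])) * (C * norm (y - x))"
      by (rule elim(2)[rule_format, OF assms(1) B(2)]) (use B len in auto)
    also have "\<dots> = B * U * norm ?v * (C * norm (y - x))" by (simp add: U_def)
    also have "\<dots> \<le> B * U * (C1 * norm (y - x)) * (C * norm (y - x))"
      using elim(1) B U C by (intro mult_right_mono mult_left_mono) auto
    also have "\<dots> = (B * U * C1 * C * norm (y - x)) * norm (y - x)" by (simp add: mult_ac)
    also have "\<dots> \<le> e * norm (y - x)" using elim(3) by (intro mult_right_mono) auto
    finally show ?case by (simp add: d algebra_simps)
  qed
  have "((\<lambda>y. T (us @ \<alpha> i y # ?cs y)) has_derivative (\<lambda>h. T (us @ \<alpha>' i h # ?cs x) +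
      (\<Sum>j<length xs. T ((us @ [\<alpha> i x]) @ (?cs x)[j := \<alpha>' (xs ! j) h])))) (at x)"
    by (rule has_derivative_diagonal[of "\<lambda>y z. T (us @ \<alpha> i y # ?cs z)", OF 1 _ 3]) (use 2 in simp)
  then show ?case by (simp add: sum.lessThan_Suc_shift del: sum.lessThan_Suc)
qed simp

text \<open>Here the multilinear map moves as well. The mixed difference is G (f y) - G (f x), small
  in operator norm by continuity, applied to entries whose change is of first order.\<close>

lemma family_has_derivative:
  fixes G :: "'y::real_normed_vector \<Rightarrow> 'y list \<Rightarrow> 'z::real_normed_vector"
    and x :: "'a::real_normed_vector"
  assumes G: "cont_fam (length xs) V G" "cont_fam (Suc (length xs)) V G'" "fam_deriv (length xs) V G G'"
    and V: "open V" "f x \<in> V" and f: "(f has_derivative f') (at x)"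
    and d: "\<And>i. i \<in> set xs \<Longrightarrow> (\<alpha> i has_derivative \<alpha>' i) (at x)"
  shows "((\<lambda>y. G (f y) (map (\<lambda>i. \<alpha> i y) xs)) has_derivative
    (\<lambda>h. G' (f x) (f' h # map (\<lambda>i. \<alpha> i x) xs) +
      (\<Sum>j<length xs. G (f x) ((map (\<lambda>i. \<alpha> i x) xs)[j := \<alpha>' (xs ! j) h])))) (at x)"
proof -
  let ?cs = "\<lambda>y. map (\<lambda>i. \<alpha> i y) xs"
  have 1: "((\<lambda>y. G (f y) (?cs x)) has_derivative (\<lambda>h. G' (f x) (f' h # ?cs x))) (at x)"
    by (rule has_derivative_compose[OF f fam_deriv_has_derivative[OF G(3,2) V]]) simp
  have 2: "((\<lambda>y. G (f x) (?cs y)) has_derivative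
      (\<lambda>h. \<Sum>j<length xs. G (f x) ((?cs x)[j := \<alpha>' (xs ! j) h]))) (at x)"
    using multilinear_has_derivative[OF cont_famD[OF G(1) V(2)], of "[]" xs \<alpha> \<alpha>' x] d by simp
  obtain C where C: "0 \<le> C"
    "eventually (\<lambda>y. \<forall>(T :: 'y list \<Rightarrow> 'z) n us B. bounded_mlin n T \<longrightarrow> mlin_le n T B \<longrightarrow> 0 \<le> B \<longrightarrow> length us + length xs = n \<longrightarrow>
      norm (T (us @ ?cs y) - T (us @ ?cs x)) \<le>
        B * prod_list (map norm us) * (C * norm (y - x))) (at x)"
    by (rule multilinear_differences[of xs \<alpha> \<alpha>' x]) (use d in auto)
  have 3: "eventually (\<lambda>y. norm (G (f y) (?cs y) - G (f y) (?cs x) -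
      (G (f x) (?cs y) - G (f x) (?cs x))) \<le> e * norm (y - x)) (at x)" if e: "0 < e" for e
  proof -
    have eC: "0 < e / (C + 1)" using e C by simp
    obtain \<delta> where \<delta>: "\<delta> > 0" "\<And>u. u \<in> V \<Longrightarrow> norm (u - f x) < \<delta> \<Longrightarrow>
        mlin_le (length xs) (\<lambda>vs. G u vs - G (f x) vs) (e / (C + 1))"
      using G(1)[unfolded cont_fam_def, THEN conjunct2, rule_format, OF V(2) eC] by auto
    have "isCont f x" by (rule has_derivative_continuous[OF f])
    then have t: "(f \<longlongrightarrow> f x) (at x)" by (simp add: isCont_def)
    have ev: "eventually (\<lambda>y. f y \<in> V) (at x)" by (rule topological_tendstoD[OF t V])
    have ev2: "eventually (\<lambda>y. dist (f y) (f x) < \<delta>) (at x)" by (rule tendstoD[OF t \<delta>(1)])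
    from ev ev2 C(2) show ?thesis
    proof eventually_elim
      case (elim y)
      define T where "T = (\<lambda>vs. G (f y) vs + (-1) *\<^sub>R G (f x) vs)"
      have T: "bounded_mlin (length xs) T"
        unfolding T_def by (intro bounded_mlin_add bounded_mlin_scaleR cont_famD[OF G(1)] elim V(2))
      have B: "mlin_le (length xs) T (e / (C + 1))"
        using \<delta>(2)[OF elim(1)] elim(2) by (simp add: dist_norm T_def)
      have "norm (T ([] @ ?cs y) - T ([] @ ?cs x)) \<le> e / (C + 1) * prod_list (map norm ([] :: 'y list)) * (C * norm (y - x))"
        by (rule elim(3)[rule_format, OF T B]) (use eC in auto)
      also have "\<dots> = e * (C / (C + 1)) * norm (y - x)" by simp
      also have "\<dots> \<le> e * norm (y - x)"
      proof -
        have "C / (C + 1) \<le> 1" using C by simp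
        then have "e * (C / (C + 1)) \<le> e * 1" using e by (intro mult_left_mono) auto
        then show ?thesis by (intro mult_right_mono) auto
      qed
      finally show ?case by (simp add: T_def algebra_simps)
    qed
  qed
  show ?thesis
    by (rule has_derivative_diagonal[of "\<lambda>y z. G (f y) (?cs z)", OF 1 2 3])
qed

text \<open>The mean value inequality on a ball, applied to each fixed list of arguments. Continuity
  of \<Psi> in operator norm makes the remainder uniform in the arguments, which pointwise
  differentiability alone would not give.\<close>

lemma fam_deriv_of_has_derivative:
  assumes S: "open S" and c: "cont_fam (Suc n) S \<Psi>"
    and d: "\<And>x vs. x \<in> S \<Longrightarrow> length vs = n \<Longrightarrow> ((\<lambda>y. \<Phi> y vs) has_derivative (\<lambda>h. \<Psi> x (h # vs))) (at x)"
  shows "fam_deriv n S \<Phi> \<Psi>"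
  unfolding fam_deriv_def
proof (intro ballI allI impI)
  fix x and e :: real assume x: "x \<in> S" and e: "0 < e"
  obtain \<delta> where \<delta>: "\<delta> > 0" "\<And>u. u \<in> S \<Longrightarrow> norm (u - x) < \<delta> \<Longrightarrow>
      mlin_le (Suc n) (\<lambda>vs. \<Psi> u vs - \<Psi> x vs) e"
    using c[unfolded cont_fam_def, THEN conjunct2, rule_format, OF x e] by auto
  obtain r where r: "r > 0" "ball x r \<subseteq> S" using S x by (rule openE)
  define \<rho> where "\<rho> = min \<delta> r"
  have \<rho>: "0 < \<rho>" "ball x \<rho> \<subseteq> S" "\<rho> \<le> \<delta>" using \<delta> r by (auto simp: \<rho>_def)
  have "mlin_le n (\<lambda>vs. \<Phi> y vs - \<Phi> x vs - \<Psi> x ((y - x) # vs)) (e * norm (y - x))"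
    if y: "norm (y - x) < \<rho>" for y
  proof (rule mlin_leI)
    fix vs :: "'a list" assume len: "length vs = n"
    have "norm (\<Phi> y vs - \<Phi> x vs - \<Psi> x ((y - x) # vs)) \<le> norm (y - x) * (e * prod_list (map norm vs))"
    proof (rule differentiable_bound_linearization[of x y "ball x \<rho>" "\<lambda>z. \<Phi> z vs" "\<lambda>z h. \<Psi> z (h # vs)"])
      show "x + t *\<^sub>R (y - x) \<in> ball x \<rho>" if "t \<in> {0..1}" for t
      proof -
        have "\<bar>t\<bar> * norm (y - x) \<le> 1 * norm (y - x)" using that by (intro mult_right_mono) auto
        then show ?thesis using y by (simp add: dist_norm)
      qed
      show "((\<lambda>z. \<Phi> z vs) has_derivative (\<lambda>h. \<Psi> z (h # vs))) (at z within ball x \<rho>)" if "z \<in> ball x \<rho>" for z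
        using d[OF subsetD[OF \<rho>(2) that] len] by (rule has_derivative_at_withinI)
      show "onorm ((\<lambda>h. \<Psi> z (h # vs)) - (\<lambda>h. \<Psi> x (h # vs))) \<le> e * prod_list (map norm vs)" if "z \<in> ball x \<rho>" for z
      proof (rule onorm_bound)
        show "0 \<le> e * prod_list (map norm vs)" using e prod_list_norm_nonneg[of vs] by simp
        fix h
        have "norm (z - x) < \<delta>" using that \<rho>(3) by (simp add: dist_norm norm_minus_commute)
        from mlin_leD[OF \<delta>(2)[OF subsetD[OF \<rho>(2) that] this], of "h # vs"] len
        show "norm (((\<lambda>h. \<Psi> z (h # vs)) - (\<lambda>h. \<Psi> x (h # vs))) h) \<le> e * prod_list (map norm vs) * norm h"
          by (simp add: mult_ac)
      qed
      show "x \<in> ball x \<rho>" using \<rho> by simp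
    qed
    then show "norm (\<Phi> y vs - \<Phi> x vs - \<Psi> x ((y - x) # vs)) \<le> e * norm (y - x) * prod_list (map norm vs)"
      by (simp add: mult_ac)
  qed
  then show "\<exists>\<delta>>0. \<forall>y\<in>S. norm (y - x) < \<delta> \<longrightarrow>
      mlin_le n (\<lambda>vs. \<Phi> y vs - \<Phi> x vs - \<Psi> x ((y - x) # vs)) (e * norm (y - x))"
    by (intro exI[of _ \<rho>] conjI ballI impI \<rho>(1))
qed

section \<open>The chain rule\<close>

text \<open>
  A summand of the Faa di Bruno formula; \<open>snd FI\<close> lists the positions of the arguments fed to the block
  \<open>fst FI\<close>.  By the chain and product rules the derivative of such a family is a sum of families of
  the same form, which makes the induction for compositions go through.
\<close>

definition comp_fam ::
    "('y::real_normed_vector \<Rightarrow> 'y list \<Rightarrow> 'z::real_normed_vector) \<Rightarrow> ('a::real_normed_vector \<Rightarrow> 'y) \<Rightarrow>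
      (('a \<Rightarrow> 'a list \<Rightarrow> 'y) \<times> nat list) list \<Rightarrow> 'a \<Rightarrow> 'a list \<Rightarrow> 'z" where
  "comp_fam G f Fs x vs = G (f x) (map (\<lambda>FI. fst FI x (map ((!) vs) (snd FI))) Fs)"

section \<open>Estimates for the Faa di Bruno summands\<close>

lemma prod_list_concat_map:
  "prod_list (map (\<lambda>FI. prod_list (map g (snd FI))) Fs) = prod_list (map g (concat (map snd Fs)))"
  by (induction Fs) auto

text \<open>The multiset equation says that the blocks partition the argument positions. Order is
  irrelevant for a product of norms, so the estimates of the blocks multiply to an estimate in all
  arguments.\<close>

lemma prod_list_blocks:
  assumes "mset (concat (map snd Fs)) = mset [0..<n]" "length vs = n"
  shows "prod_list (map (\<lambda>FI. prod_list (map norm (map ((!) vs) (snd FI)))) Fs) = prod_list (map norm vs)"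
proof -
  have "prod_list (map (\<lambda>FI. prod_list (map norm (map ((!) vs) (snd FI)))) Fs) =
      prod_list (map (\<lambda>i. norm (vs ! i)) (concat (map snd Fs)))"
    using prod_list_concat_map[of "\<lambda>i. norm (vs ! i)" Fs] by (simp add: o_def)
  also have "\<dots> = prod_mset (image_mset (\<lambda>i. norm (vs ! i)) (mset (concat (map snd Fs))))"
    by (metis mset_map prod_mset_prod_list)
  also have "\<dots> = prod_list (map (\<lambda>i. norm (vs ! i)) [0..<n])"
    unfolding assms(1) by (metis mset_map prod_mset_prod_list)
  also have "map (\<lambda>i. norm (vs ! i)) [0..<n] = map norm vs"
    by (rule nth_equalityI) (use assms(2) in auto)
  finally show ?thesis .
qed

text \<open>The varying position lies in exactly one block and there only once. All other entries
  stay constant, so the expression is linear in that block, which is linear in v.\<close>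

lemma comp_fam_linear:
  fixes G :: "'y::real_normed_vector \<Rightarrow> 'y list \<Rightarrow> 'z::real_normed_vector"
    and f :: "'a::real_normed_vector \<Rightarrow> 'y" and Fs :: "(('a \<Rightarrow> 'a list \<Rightarrow> 'y) \<times> nat list) list"
  assumes G: "bounded_mlin (length Fs) (G (f x))"
    and F: "\<And>FI. FI \<in> set Fs \<Longrightarrow> bounded_mlin (length (snd FI)) (fst FI x)"
    and m: "mset (concat (map snd Fs)) = mset [0..<n]" and len: "length us + Suc (length ws) = n"
  shows "linear (\<lambda>v. comp_fam G f Fs x (us @ v # ws))"
proof -
  let ?k = "length us"
  have dist: "distinct (concat (map snd Fs))"
    using mset_eq_imp_distinct_iff[OF m] by simp
  have "?k \<in> set (concat (map snd Fs))"
    using mset_eq_setD[OF m] len by simp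
  then obtain FI where FI: "FI \<in> set Fs" "?k \<in> set (snd FI)" by auto
  obtain Fs1 Fs2 where Fs: "Fs = Fs1 @ FI # Fs2" using split_list[OF FI(1)] by blast
  obtain I1 I2 where I: "snd FI = I1 @ ?k # I2" using split_list[OF FI(2)] by blast
  have nin: "?k \<notin> set I1" "?k \<notin> set I2" "?k \<notin> set (concat (map snd Fs1))" "?k \<notin> set (concat (map snd Fs2))"
    using dist unfolding Fs by (auto simp: I)
  \<comment> \<open>The 0 is a placeholder for v: blocks that avoid its position cannot tell the
    difference.\<close>
  have nth: "map ((!) (us @ v # ws)) J = map ((!) (us @ 0 # ws)) J" if "?k \<notin> set J" for v J
    using that by (auto simp: nth_append nth_Cons' intro!: map_cong)
  define J1 J2 where "J1 = map ((!) (us @ 0 # ws)) I1" and "J2 = map ((!) (us @ 0 # ws)) I2"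
  define A where "A Gs = map (\<lambda>FI. fst FI x (map ((!) (us @ 0 # ws)) (snd FI))) Gs"
    for Gs :: "(('a \<Rightarrow> 'a list \<Rightarrow> 'y) \<times> nat list) list"
  have A: "map (\<lambda>FI. fst FI x (map ((!) (us @ v # ws)) (snd FI))) Gs = A Gs"
    if "?k \<notin> set (concat (map snd Gs))" for v and Gs :: "(('a \<Rightarrow> 'a list \<Rightarrow> 'y) \<times> nat list) list"
    unfolding A_def
  proof (rule map_cong[OF refl])
    fix FI assume "FI \<in> set Gs"
    then have "?k \<notin> set (snd FI)" using that by auto
    from nth[OF this, of v]
    show "fst FI x (map ((!) (us @ v # ws)) (snd FI)) = fst FI x (map ((!) (us @ 0 # ws)) (snd FI))"
      by (simp only:)
  qed
  have eq: "comp_fam G f Fs x (us @ v # ws) = G (f x) (A Fs1 @ fst FI x (J1 @ v # J2) # A Fs2)" for v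
    by (simp only: comp_fam_def Fs map_append list.map A[OF nin(3), of v] A[OF nin(4), of v] I
        nth[OF nin(1), of v] nth[OF nin(2), of v] J1_def J2_def nth_append_length)
  have 1: "linear (\<lambda>v. fst FI x (J1 @ v # J2))"
    by (rule bounded_mlin_linear[OF F[OF FI(1)]]) (simp add: I J1_def J2_def)
  have 2: "linear (\<lambda>a. G (f x) (A Fs1 @ a # A Fs2))"
    by (rule bounded_mlin_linear[OF G]) (simp add: Fs A_def)
  show ?thesis
    using linear_compose[OF 1 2] by (simp add: eq o_def)
qed

text \<open>The change from x to y is split in two: first G moves from f y to f x while the entries
  are taken at y, then the entries move while G (f x) is fixed. Each part receives e / 2.\<close>

lemma cont_fam_comp:
  fixes G :: "'y::real_normed_vector \<Rightarrow> 'y list \<Rightarrow> 'z::real_normed_vector"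
    and f :: "'a::real_normed_vector \<Rightarrow> 'y" and Fs :: "(('a \<Rightarrow> 'a list \<Rightarrow> 'y) \<times> nat list) list"
  assumes G: "cont_fam (length Fs) V G"
    and F: "\<And>FI. FI \<in> set Fs \<Longrightarrow> cont_fam (length (snd FI)) S (fst FI)"
    and f: "continuous_on S f" "f ` S \<subseteq> V"
    and m: "mset (concat (map snd Fs)) = mset [0..<n]"
  shows "cont_fam n S (comp_fam G f Fs)"
proof (rule cont_famI)
  fix x assume x: "x \<in> S"
  let ?r = "length Fs"
  let ?p = "\<lambda>vs FI. prod_list (map norm (map ((!) vs) (snd FI)))"
  have fx: "f x \<in> V" using f x by blast
  have Gx: "bounded_mlin ?r (G (f x))" by (rule cont_famD[OF G fx])
  have Fx: "bounded_mlin (length (snd FI)) (fst FI x)" if "FI \<in> set Fs" for FI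
    by (rule cont_famD[OF F[OF that] x])
  obtain B where B: "0 < B" "mlin_le ?r (G (f x)) B" using Gx by (rule bounded_mlinE)
  have "\<forall>FI\<in>set Fs. \<exists>C>0. mlin_le (length (snd FI)) (fst FI x) C"
    using Fx bounded_mlinE by blast
  then obtain C where C: "\<And>FI. FI \<in> set Fs \<Longrightarrow> 0 < C FI \<and> mlin_le (length (snd FI)) (fst FI x) (C FI)"
    by metis
  \<comment> \<open>One more than the bounds at x, so that entries at y, which differ by at most
    \<eta> \<le> 1 times their weight, still satisfy the bound with M.\<close>
  define M where "M = 1 + sum C (set Fs)"
  have CM: "C FI \<le> M - 1" if "FI \<in> set Fs" for FI
    unfolding M_def using member_le_sum[OF that, of C] C by (simp add: less_imp_le)
  have M: "1 \<le> M" unfolding M_def using C by (simp add: sum_nonneg less_imp_le)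
  have Fle: "norm (fst FI x (map ((!) vs) (snd FI))) \<le> (M - 1) * ?p vs FI" if "FI \<in> set Fs" for FI vs
    by (rule mlin_leD[OF mlin_le_mono[OF conjunct2[OF C[OF that]] CM[OF that]]]) simp
  have p0: "0 \<le> ?p vs FI" for vs :: "'a list" and FI :: "('a \<Rightarrow> 'a list \<Rightarrow> 'y) \<times> nat list"
    by (rule prod_list_norm_nonneg)
  have FleM: "norm (fst FI x (map ((!) vs) (snd FI))) \<le> M * ?p vs FI" if "FI \<in> set Fs" for FI vs
    using Fle[OF that, of vs] p0[of vs FI] by (simp add: algebra_simps)
  have bound: "norm (comp_fam G f Fs x vs) \<le> B * M ^ ?r * prod_list (map norm vs)" if vs: "length vs = n" for vs
  proof -
    have "norm (comp_fam G f Fs x vs) \<le> B * prod_list (map norm (map (\<lambda>FI. fst FI x (map ((!) vs) (snd FI))) Fs))"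
      unfolding comp_fam_def by (rule mlin_leD[OF B(2)]) simp
    also have "\<dots> \<le> B * (M ^ ?r * prod_list (map (?p vs) Fs))"
      by (intro mult_left_mono prod_list_norm_le FleM) (use B M in auto)
    also have "\<dots> = B * M ^ ?r * prod_list (map norm vs)"
      unfolding prod_list_blocks[OF m vs] by simp
    finally show ?thesis .
  qed
  show "bounded_mlin n (comp_fam G f Fs x)"
    unfolding bounded_mlin_def
  proof (intro conjI allI impI)
    show "linear (\<lambda>v. comp_fam G f Fs x (us @ v # ws))" if "length us + Suc (length ws) = n" for us ws
      by (rule comp_fam_linear[of Fs G f x, OF Gx Fx m that])
    show "\<exists>B. mlin_le n (comp_fam G f Fs x) B"
      using bound by (intro exI mlin_leI)
  qed
  fix e :: real assume e: "0 < e"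
  \<comment> \<open>The allowed change of an entry. The 1 under \<open>min\<close> is the room left
    in M; the quotient makes the telescoping bound at most e / 2, and the 1 in its denominator keeps
    it positive.\<close>
  define \<eta> where "\<eta> = min 1 (e / (2 * (B * real ?r * M ^ ?r + 1)))"
  have Q: "0 \<le> B * real ?r * M ^ ?r" using B M by simp
  then have \<eta>: "0 < \<eta>" "\<eta> \<le> 1" unfolding \<eta>_def using e by auto
  have \<eta>e: "B * real ?r * M ^ ?r * \<eta> \<le> e / 2"
  proof -
    have "B * real ?r * M ^ ?r * \<eta> \<le> (B * real ?r * M ^ ?r + 1) * (e / (2 * (B * real ?r * M ^ ?r + 1)))"
      using Q \<eta> by (intro mult_mono) (auto simp: \<eta>_def)
    also have "\<dots> = e / 2" using Q by (simp add: add_nonneg_pos field_simps)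
    finally show ?thesis .
  qed
  define \<kappa> where "\<kappa> = e / (2 * M ^ ?r)"
  have \<kappa>: "0 < \<kappa>" "\<kappa> * M ^ ?r = e / 2" unfolding \<kappa>_def using e M by auto
  obtain \<delta> where \<delta>: "\<delta> > 0" "\<And>u. u \<in> V \<Longrightarrow> norm (u - f x) < \<delta> \<Longrightarrow>
      mlin_le ?r (\<lambda>vs. G u vs - G (f x) vs) \<kappa>"
    using G[unfolded cont_fam_def, THEN conjunct2, rule_format, OF fx \<kappa>(1)] by auto
  have "eventually (\<lambda>y. dist (f y) (f x) < \<delta>) (at x within S)"
    by (rule tendstoD[OF _ \<delta>(1)]) (use f(1) x in \<open>simp add: continuous_on_def\<close>)
  moreover have "eventually (\<lambda>y. y \<in> S) (at x within S)"
    by (simp add: eventually_at_filter)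
  moreover have "eventually (\<lambda>y. \<forall>FI\<in>set Fs. mlin_le (length (snd FI)) (\<lambda>vs. fst FI y vs - fst FI x vs) \<eta>) (at x within S)"
    by (intro eventually_ball_finite ballI cont_fam_eventually[OF F x \<eta>(1)]) auto
  ultimately show "eventually (\<lambda>y. mlin_le n (\<lambda>vs. comp_fam G f Fs y vs - comp_fam G f Fs x vs) e) (at x within S)"
  proof eventually_elim
    case (elim y)
    show ?case
    proof (rule mlin_leI)
      fix vs :: "'a list" assume vs: "length vs = n"
      define \<alpha> where "\<alpha> FI = fst FI y (map ((!) vs) (snd FI))" for FI :: "('a \<Rightarrow> 'a list \<Rightarrow> 'y) \<times> nat list"
      define \<beta> where "\<beta> FI = fst FI x (map ((!) vs) (snd FI))" for FI :: "('a \<Rightarrow> 'a list \<Rightarrow> 'y) \<times> nat list"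
      define P where "P = prod_list (map norm vs)"
      have P: "0 \<le> P" unfolding P_def by (rule prod_list_norm_nonneg)
      have d: "norm (\<alpha> FI - \<beta> FI) \<le> \<eta> * ?p vs FI" if "FI \<in> set Fs" for FI
        unfolding \<alpha>_def \<beta>_def by (rule mlin_leD[OF elim(3)[rule_format, OF that]]) simp
      have b: "norm (\<beta> FI) \<le> M * ?p vs FI" if "FI \<in> set Fs" for FI
        unfolding \<beta>_def by (rule FleM[OF that])
      have a: "norm (\<alpha> FI) \<le> M * ?p vs FI" if "FI \<in> set Fs" for FI
      proof -
        have "norm (\<alpha> FI) \<le> norm (\<beta> FI) + norm (\<alpha> FI - \<beta> FI)" by (rule norm_triangle_sub)
        also have "\<dots> \<le> (M - 1) * ?p vs FI + \<eta> * ?p vs FI"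
          using Fle[OF that, of vs] d[OF that] by (simp add: \<beta>_def)
        also have "\<dots> \<le> (M - 1) * ?p vs FI + 1 * ?p vs FI"
          using \<eta> p0[of vs FI] by (intro add_left_mono mult_right_mono) auto
        finally show ?thesis by (simp add: algebra_simps)
      qed
      have "norm (G (f y) (map \<alpha> Fs) - G (f x) (map \<alpha> Fs)) \<le> \<kappa> * prod_list (map norm (map \<alpha> Fs))"
        by (rule mlin_leD[OF \<delta>(2)]) (use elim f in \<open>auto simp: dist_norm\<close>)
      also have "\<dots> \<le> \<kappa> * (M ^ ?r * prod_list (map (?p vs) Fs))"
        by (intro mult_left_mono prod_list_norm_le a) (use \<kappa> M in auto)
      also have "\<dots> = \<kappa> * M ^ ?r * P"
        unfolding prod_list_blocks[OF m vs] P_def by simp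
      also have "\<dots> = e / 2 * P" by (simp only: \<kappa>)
      finally have 1: "norm (G (f y) (map \<alpha> Fs) - G (f x) (map \<alpha> Fs)) \<le> e / 2 * P" .
      have "norm (G (f x) ([] @ map \<alpha> Fs) - G (f x) ([] @ map \<beta> Fs)) \<le>
          B * prod_list (map norm ([] :: 'y list)) * (real ?r * \<eta> * M ^ ?r * prod_list (map (?p vs) Fs))"
        by (rule multilinear_telescope[OF Gx B(2) less_imp_le[OF B(1)] M less_imp_le[OF \<eta>(1)]])
          (use a b d in auto)
      also have "\<dots> = (B * real ?r * M ^ ?r * \<eta>) * P"
        unfolding prod_list_blocks[OF m vs] P_def by simp
      also have "\<dots> \<le> e / 2 * P" by (rule mult_right_mono[OF \<eta>e P])
      finally have 2: "norm (G (f x) (map \<alpha> Fs) - G (f x) (map \<beta> Fs)) \<le> e / 2 * P" by simp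
      have "norm ((G (f y) (map \<alpha> Fs) - G (f x) (map \<alpha> Fs)) + (G (f x) (map \<alpha> Fs) - G (f x) (map \<beta> Fs))) \<le>
          e / 2 * P + e / 2 * P"
        by (rule norm_triangle_mono[OF 1 2])
      then show "norm (comp_fam G f Fs y vs - comp_fam G f Fs x vs) \<le> e * prod_list (map norm vs)"
        by (simp add: comp_fam_def \<alpha>_def[abs_def] \<beta>_def[abs_def] P_def)
    qed
  qed
qed

lemma cont_fam_0_continuous_on:
  assumes "cont_fam 0 S (\<lambda>x _. f x)" shows "continuous_on S f"
  unfolding continuous_on_def
proof (intro ballI tendstoI)
  fix x and e :: real assume x: "x \<in> S" and e: "0 < e"
  then have "0 < e / 2" by simp
  from cont_fam_eventually[OF assms x this]
  show "eventually (\<lambda>y. dist (f y) (f x) < e) (at x within S)"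
    by (rule eventually_mono) (use e in \<open>auto simp: mlin_le_def dist_norm\<close>)
qed

text \<open>A new direction of differentiation becomes argument 0, so the old positions move up by
  one.\<close>

definition shift_block :: "'f \<times> nat list \<Rightarrow> 'f \<times> nat list" where
  "shift_block FI = (fst FI, map Suc (snd FI))"

text \<open>The block hit by the derivative also takes the new argument 0, in front because
  \<open>fder\<close> expects its direction there.\<close>

definition deriv_block ::
    "('a::real_normed_vector \<Rightarrow> 'a list \<Rightarrow> 'b::real_normed_vector) \<times> nat list \<Rightarrow> ('a \<Rightarrow> 'a list \<Rightarrow> 'b) \<times> nat list" where
  "deriv_block FI = (fder (fst FI), 0 # map Suc (snd FI))"

lemma mset_concat_shift_block:
  assumes "mset (concat (map snd Fs)) = mset [0..<n]"
  shows "mset (concat (map snd (map shift_block Fs))) = mset (map Suc [0..<n])"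
proof -
  have "concat (map snd (map shift_block Fs)) = map Suc (concat (map snd Fs))"
    by (induction Fs) (auto simp: shift_block_def)
  then show ?thesis using assms by (metis mset_map)
qed

lemma mset_concat_deriv_block:
  assumes "mset (concat (map snd Fs)) = mset [0..<n]" "j < length Fs"
  shows "mset (concat (map snd ((map shift_block Fs)[j := deriv_block (Fs ! j)]))) = mset [0..<Suc n]"
proof -
  have "mset (concat (map snd ((map shift_block Fs)[j := deriv_block (Fs ! j)]))) =
      add_mset 0 (mset (concat (map snd (map shift_block Fs))))"
    using assms(2)
  proof (induction Fs arbitrary: j)
    case (Cons FI Fs)
    then show ?case by (cases j) (auto simp: shift_block_def deriv_block_def)
  qed simp
  then show ?thesis
    unfolding mset_concat_shift_block[OF assms(1)]
    by (metis list.simps(9) map_Suc_upt mset.simps(2) upt_conv_Cons zero_less_Suc)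
qed

text \<open>Each differentiation costs one order in G or in a single block. The other ingredients
  are lowered by \<open>Cfam_Suc_imp\<close>, so that the induction hypothesis meets them all at
  order \<open>j\<close>, and it must hold for every \<open>n\<close>, G and \<open>Fs\<close>
  because rank and blocks grow.\<close>

lemma Cfam_comp:
  fixes G :: "'y::real_normed_vector \<Rightarrow> 'y list \<Rightarrow> 'z::real_normed_vector"
    and f :: "'a::real_normed_vector \<Rightarrow> 'y" and Fs :: "(('a \<Rightarrow> 'a list \<Rightarrow> 'y) \<times> nat list) list"
  assumes S: "open S" and V: "open V" and fS: "f ` S \<subseteq> V"
  shows "Cfam j (length Fs) V G \<Longrightarrow> (\<And>FI. FI \<in> set Fs \<Longrightarrow> Cfam j (length (snd FI)) S (fst FI)) \<Longrightarrow>
    Cfam j 0 S (\<lambda>x _. f x) \<Longrightarrow> mset (concat (map snd Fs)) = mset [0..<n] \<Longrightarrow>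
    Cfam j n S (comp_fam G f Fs)"
proof (induction j arbitrary: n G Fs)
  case 0
  then show ?case using fS by (auto intro!: cont_fam_comp[where V = V] cont_fam_0_continuous_on)
next
  case (Suc j)
  note G = Suc.prems(1) and F = Suc.prems(2) and f = Suc.prems(3) and m = Suc.prems(4)
  note G' = Cfam_SucD[OF G V] and F' = Cfam_SucD[OF F S] and f' = Cfam_SucD[OF f S]
  define f1 where "f1 = fder (\<lambda>x _. f x)"
  \<comment> \<open>The first summand differentiates G, which adds the derivative of f as a block of
    its own with position 0; in the i-th summand of the sum the derivative falls on the i-th
    block.\<close>
  define \<Psi> where "\<Psi> x ws = comp_fam (fder G) f ((f1, [0]) # map shift_block Fs) x ws +
     (\<Sum>i<length Fs. comp_fam G f ((map shift_block Fs)[i := deriv_block (Fs ! i)]) x ws)" for x ws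
  have 1: "Cfam j (Suc n) S (comp_fam (fder G) f ((f1, [0]) # map shift_block Fs))"
  proof (rule Suc.IH)
    show "Cfam j (length ((f1, [0]) # map shift_block Fs)) V (fder G)" using G'(2) by simp
    show "Cfam j (length (snd FI)) S (fst FI)" if "FI \<in> set ((f1, [0]) # map shift_block Fs)" for FI
      using that f'(2) Cfam_Suc_imp[OF F] by (auto simp: shift_block_def f1_def simp del: Cfam.simps)
    show "Cfam j 0 S (\<lambda>x _. f x)" by (rule Cfam_Suc_imp[OF f])
    have "mset (concat (map snd ((f1, [0]) # map shift_block Fs))) = add_mset 0 (mset (map Suc [0..<n]))"
      using mset_concat_shift_block[OF m] by simp
    then show "mset (concat (map snd ((f1, [0]) # map shift_block Fs))) = mset [0..<Suc n]"
      by (metis map_Suc_upt mset.simps(2) upt_conv_Cons zero_less_Suc)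
  qed
  have 2: "Cfam j (Suc n) S (comp_fam G f ((map shift_block Fs)[i := deriv_block (Fs ! i)]))"
    if i: "i < length Fs" for i
  proof (rule Suc.IH)
    show "Cfam j (length ((map shift_block Fs)[i := deriv_block (Fs ! i)])) V G"
      using Cfam_Suc_imp[OF G] by simp
    show "Cfam j (length (snd FI)) S (fst FI)"
      if "FI \<in> set ((map shift_block Fs)[i := deriv_block (Fs ! i)])" for FI
    proof -
      have "FI = deriv_block (Fs ! i) \<or> FI \<in> shift_block ` set Fs"
        using subsetD[OF set_update_subset_insert that] by auto
      then show ?thesis
        using F'(2)[OF nth_mem[OF i]] Cfam_Suc_imp[OF F]
        by (auto simp: shift_block_def deriv_block_def simp del: Cfam.simps)
    qed
    show "Cfam j 0 S (\<lambda>x _. f x)" by (rule Cfam_Suc_imp[OF f])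
    show "mset (concat (map snd ((map shift_block Fs)[i := deriv_block (Fs ! i)]))) = mset [0..<Suc n]"
      by (rule mset_concat_deriv_block[OF m i])
  qed
  have C\<Psi>: "Cfam j (Suc n) S \<Psi>"
    unfolding \<Psi>_def by (intro Cfam_add[OF 1] Cfam_sum 2) auto
  show ?case
  proof (rule Cfam_SucI[OF _ _ C\<Psi>])
    show "cont_fam n S (comp_fam G f Fs)"
      by (intro cont_fam_comp[OF Cfam_cont[OF G] Cfam_cont[OF F] cont_fam_0_continuous_on[OF Cfam_cont[OF f]] fS m])
    show "fam_deriv n S (comp_fam G f Fs) \<Psi>"
    proof (rule fam_deriv_of_has_derivative[OF S Cfam_cont[OF C\<Psi>]])
      fix x and vs :: "'a list" assume x: "x \<in> S" and vs: "length vs = n"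
      let ?\<alpha> = "\<lambda>FI y. fst FI y (map ((!) vs) (snd FI))"
      let ?\<alpha>' = "\<lambda>FI h. fder (fst FI) x (h # map ((!) vs) (snd FI))"
      have fd: "(f has_derivative (\<lambda>h. f1 x [h])) (at x)"
        using fam_deriv_has_derivative[OF f'(1) Cfam_cont[OF f'(2)] S x, of "[]"] by (simp add: f1_def)
      have d: "(?\<alpha> FI has_derivative ?\<alpha>' FI) (at x)" if "FI \<in> set Fs" for FI
        by (rule fam_deriv_has_derivative[OF F'(1)[OF that] Cfam_cont[OF F'(2)[OF that]] S x]) simp
      have fx: "f x \<in> V" using fS x by blast
      have main: "((\<lambda>y. G (f y) (map (\<lambda>FI. ?\<alpha> FI y) Fs)) has_derivative
         (\<lambda>h. fder G (f x) (f1 x [h] # map (\<lambda>FI. ?\<alpha> FI x) Fs) +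
           (\<Sum>i<length Fs. G (f x) ((map (\<lambda>FI. ?\<alpha> FI x) Fs)[i := ?\<alpha>' (Fs ! i) h])))) (at x)"
        by (rule family_has_derivative[OF Cfam_cont[OF G] Cfam_cont[OF G'(2)] G'(1) V fx fd d])
      have sh: "map (\<lambda>FI. fst FI x (map ((!) (h # vs)) (snd FI))) (map shift_block Fs) = map (\<lambda>FI. ?\<alpha> FI x) Fs" for h
        by (simp add: shift_block_def o_def)
      have "\<Psi> x (h # vs) = fder G (f x) (f1 x [h] # map (\<lambda>FI. ?\<alpha> FI x) Fs) +
           (\<Sum>i<length Fs. G (f x) ((map (\<lambda>FI. ?\<alpha> FI x) Fs)[i := ?\<alpha>' (Fs ! i) h]))" for h
        unfolding \<Psi>_def comp_fam_def map_update sh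
        by (simp add: deriv_block_def sh[unfolded map_map] o_def shift_block_def)
      then show "((\<lambda>y. comp_fam G f Fs y vs) has_derivative (\<lambda>h. \<Psi> x (h # vs))) (at x)"
        using main by (simp add: comp_fam_def)
    qed
  qed
qed

lemma smooth_map_on_compose:
  assumes "smooth_map_on k V g" "smooth_map_on k S f" "f ` S \<subseteq> V"
  shows "smooth_map_on k S (\<lambda>x. g (f x))"
  unfolding smooth_map_on_iff_Cfam
proof (intro conjI allI impI)
  show S: "open S" using assms(2) by (rule smooth_map_on_open)
  fix j assume j: "enat j \<le> k"
  \<comment> \<open>With no blocks and no arguments a summand is the composition itself.\<close>
  have "Cfam j 0 S (comp_fam (\<lambda>y _. g y) f [])"
    by (rule Cfam_comp[OF S smooth_map_on_open[OF assms(1)] assms(3)])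
      (use assms j in \<open>auto simp: smooth_map_on_iff_Cfam\<close>)
  then show "Cfam j 0 S (\<lambda>x _. g (f x))" by (simp add: comp_fam_def[abs_def])
qed

section \<open>Functions of one real variable, and products\<close>

lemma norm_prod_list: "\<bar>prod_list vs\<bar> = prod_list (map norm (vs :: real list))"
  by (induction vs) (auto simp: abs_mult)

text \<open>In one variable the n-th derivative multiplies \<open>D n x\<close> with the product of
  its arguments, so the sequence of ordinary derivatives yields all the families required.\<close>

lemma smooth_map_on_real:
  fixes D :: "nat \<Rightarrow> real \<Rightarrow> real"
  assumes D: "\<And>n x. (D n has_real_derivative D (Suc n) x) (at x)"
  shows "smooth_map_on k UNIV (D 0)"
proof -
  have c: "cont_fam n UNIV (\<lambda>x vs. D i x * prod_list vs)" for i n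
  proof (rule cont_famI)
    fix x :: real
    show "bounded_mlin n (\<lambda>vs. D i x * prod_list vs)"
      unfolding bounded_mlin_def
    proof (intro conjI allI impI)
      show "linear (\<lambda>v. D i x * prod_list (us @ v # ws))" for us ws
        by (rule linearI) (auto simp: algebra_simps)
      show "\<exists>B. mlin_le n (\<lambda>vs. D i x * prod_list vs) B"
        by (rule exI[of _ "\<bar>D i x\<bar>"]) (simp add: mlin_le_def abs_mult norm_prod_list)
    qed
    fix e :: real assume e: "0 < e"
    have "isCont (D i) x" using D DERIV_isCont by blast
    then have "eventually (\<lambda>y. dist (D i y) (D i x) < e) (at x)"
      using e by (intro tendstoD) (auto simp: isCont_def)
    then show "eventually (\<lambda>y. mlin_le n (\<lambda>vs. D i y * prod_list vs - D i x * prod_list vs) e) (at x)"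
    proof eventually_elim
      case (elim y)
      show ?case
      proof (rule mlin_leI)
        fix vs :: "real list"
        have "\<bar>D i y * prod_list vs - D i x * prod_list vs\<bar> = \<bar>D i y - D i x\<bar> * prod_list (map norm vs)"
          by (metis abs_mult left_diff_distrib norm_prod_list)
        also have "\<dots> \<le> e * prod_list (map norm vs)"
          using elim by (intro mult_right_mono prod_list_norm_nonneg) (simp add: dist_real_def)
        finally show "norm (D i y * prod_list vs - D i x * prod_list vs) \<le> e * prod_list (map norm vs)"
          by simp
      qed
    qed
  qed
  have "Cfam j n UNIV (\<lambda>x vs. D i x * prod_list vs)" for j n i
  proof (induction j arbitrary: n i)
    case 0
    show ?case by (simp add: c)
  next
    case (Suc j)
    have "fam_deriv n UNIV (\<lambda>x vs. D i x * prod_list vs) (\<lambda>x vs. D (Suc i) x * prod_list vs)"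
    proof (rule fam_deriv_of_has_derivative[OF open_UNIV c])
      show "((\<lambda>y. D i y * prod_list vs) has_derivative (\<lambda>h. D (Suc i) x * prod_list (h # vs))) (at x)" for x vs
        using has_derivative_mult_left[OF D[of i x, unfolded has_field_derivative_def], of "prod_list vs"]
        by (simp add: mult_ac)
    qed
    from Cfam_SucI[OF c this Suc] show ?case .
  qed
  from this[of _ 0 0] have "Cfam j 0 UNIV (\<lambda>x _. D 0 x)" for j
    by (subst Cfam_cong[where \<Psi> = "\<lambda>x vs. D 0 x * prod_list vs"]) auto
  then show ?thesis by (simp add: smooth_map_on_iff_Cfam)
qed

text \<open>Polarization: f g = ((f + g)^2 - (f - g)^2) / 4. Products thus reduce to composition
  with the square function, and no Leibniz formula for higher derivatives is required.\<close>

lemma smooth_map_on_mult: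
  fixes f g :: "'a::real_normed_vector \<Rightarrow> real"
  assumes f: "smooth_map_on k S f" and g: "smooth_map_on k S g"
  shows "smooth_map_on k S (\<lambda>x. f x * g x)"
proof -
  define D :: "nat \<Rightarrow> real \<Rightarrow> real" where
    "D n x = (if n = 0 then x\<^sup>2 else if n = 1 then 2 * x else if n = 2 then 2 else 0)" for n x
  have "(D n has_real_derivative D (Suc n) x) (at x)" for n x
  proof -
    consider "n = 0" | "n = 1" | "n = 2" | "n > 2" by linarith
    then show ?thesis
      by cases (auto simp: D_def[abs_def] intro!: derivative_eq_intros)
  qed
  then have sq: "smooth_map_on k UNIV (D 0)" by (rule smooth_map_on_real)
  have sq: "smooth_map_on k S (\<lambda>x. (h x)\<^sup>2)" if "smooth_map_on k S h" for h :: "'a \<Rightarrow> real"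
    using smooth_map_on_compose[OF sq that] by (simp add: D_def)
  have "smooth_map_on k S (\<lambda>x. (1/4) *\<^sub>R ((f x + g x)\<^sup>2 + (-1) *\<^sub>R (f x + (-1) *\<^sub>R g x)\<^sup>2))"
    by (intro smooth_map_on_scaleR smooth_map_on_add sq f g)
  then show ?thesis
    by (rule smooth_map_on_cong) (simp add: power2_eq_square algebra_simps)
qed

lemma smooth_map_on_one_minus:
  fixes f :: "'a::real_normed_vector \<Rightarrow> real"
  assumes "smooth_map_on k S f"
  shows "smooth_map_on k S (\<lambda>x. 1 - f x)"
  using smooth_map_on_add[OF smooth_map_on_const[OF smooth_map_on_open[OF assms], of k 1]
      smooth_map_on_scaleR[OF assms, of "-1"]] by simp

section \<open>A smooth cutoff function\<close>

text \<open>\<open>flat_deriv n\<close> is the \<open>n\<close>-th derivative of \<open>exp (- 1 / x)\<close>, extended by \<open>0\<close> to \<open>x \<le> 0\<close>.\<close>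

primrec flat_poly :: "nat \<Rightarrow> real poly" where
  "flat_poly 0 = 1"
| "flat_poly (Suc n) = [:0, 0, 1:] * (flat_poly n - pderiv (flat_poly n))"

definition flat_deriv :: "nat \<Rightarrow> real \<Rightarrow> real" where
  "flat_deriv n x = (if x \<le> 0 then 0 else poly (flat_poly n) (inverse x) * exp (- inverse x))"

lemma poly_exp_minus_tendsto_0: "((\<lambda>u::real. poly p u * exp (- u)) \<longlongrightarrow> 0) at_top"
proof -
  have "((\<lambda>u::real. \<Sum>i\<le>degree p. coeff p i * (u ^ i / exp u)) \<longlongrightarrow> 0) at_top"
    by (intro tendsto_null_sum tendsto_mult_right_zero tendsto_power_div_exp_0)
  then show ?thesis
    by (simp add: poly_altdef exp_minus divide_inverse sum_distrib_right mult.assoc)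
qed

text \<open>With u = 1 / x the derivative of p(u) exp (- u) is u^2 (p(u) - p'(u)) exp (- u), which
  is the recursion of \<open>flat_poly\<close>. At 0 the right difference quotient is u p(u) exp (-
  u), and it tends to 0.\<close>

lemma flat_deriv_DERIV: "(flat_deriv n has_real_derivative flat_deriv (Suc n) x) (at x)"
proof -
  consider "x < 0" | "x > 0" | "x = 0" by linarith
  then show ?thesis
  proof cases
    case 1
    have "(flat_deriv n has_real_derivative 0) (at x)"
      by (rule has_field_derivative_transform_within_open[OF DERIV_const[of 0], of "{..<0}"])
        (use 1 in \<open>auto simp: flat_deriv_def\<close>)
    then show ?thesis using 1 by (simp add: flat_deriv_def)
  next
    case 2
    have "((\<lambda>x. poly (flat_poly n) (inverse x) * exp (- inverse x)) has_real_derivative flat_deriv (Suc n) x) (at x)"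
      using 2 by (auto intro!: derivative_eq_intros
          simp: flat_deriv_def power2_eq_square algebra_simps)
    then show ?thesis
      by (rule has_field_derivative_transform_within_open[where S = "{0<..}"])
        (use 2 in \<open>auto simp: flat_deriv_def\<close>)
  next
    case 3
    have "((\<lambda>y. (flat_deriv n y - flat_deriv n 0) / (y - 0)) \<longlongrightarrow> 0) (at_left 0)"
      by (rule tendsto_eventually) (auto simp: eventually_at_filter flat_deriv_def)
    moreover have "((\<lambda>y. (flat_deriv n y - flat_deriv n 0) / (y - 0)) \<longlongrightarrow> 0) (at_right 0)"
    proof -
      have "((\<lambda>y. poly ([:0, 1:] * flat_poly n) (inverse y) * exp (- inverse y)) \<longlongrightarrow> 0) (at_right 0)"
        by (rule filterlim_compose[OF poly_exp_minus_tendsto_0 filterlim_inverse_at_top_right])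
      moreover have "eventually (\<lambda>y. poly ([:0, 1:] * flat_poly n) (inverse y) * exp (- inverse y) =
          (flat_deriv n y - flat_deriv n 0) / (y - 0)) (at_right 0)"
        by (auto simp: eventually_at_filter flat_deriv_def divide_inverse)
      ultimately show ?thesis by (rule Lim_transform_eventually)
    qed
    ultimately have "((\<lambda>y. (flat_deriv n y - flat_deriv n 0) / (y - 0)) \<longlongrightarrow> 0) (at 0)"
      by (rule filterlim_split_at)
    then show ?thesis using 3 by (simp add: has_field_derivative_iff flat_deriv_def)
  qed
qed

lemma flat_deriv_0: "flat_deriv 0 x = (if x \<le> 0 then 0 else exp (- inverse x))"
  by (simp add: flat_deriv_def)

lemma flat_deriv_0_mono: "x \<le> y \<Longrightarrow> flat_deriv 0 x \<le> flat_deriv 0 y"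
  by (auto simp: flat_deriv_0)

lemma flat_deriv_0_nonneg: "0 \<le> flat_deriv 0 x"
  by (simp add: flat_deriv_0)

text \<open>\<psi> 1 - \<alpha> t is at most 0 for t \<le> 0 and equals \<psi> 1 for t \<ge> 1.
  Applying \<psi> once more flattens the left part, and division by the number c normalizes the
  right one; nesting takes the place of the usual quotient of functions. The derivative is bounded
  by compactness on [0, 1] and vanishes elsewhere. The bound B is what keeps differentials bounded
  after cutting off.\<close>

lemma smooth_cutoff:
  "\<exists>(\<theta> :: real \<Rightarrow> real) \<theta>' B. (\<forall>k. smooth_map_on k UNIV \<theta>) \<and>
    (\<forall>t\<le>0. \<theta> t = 0) \<and> (\<forall>t\<ge>1. \<theta> t = 1) \<and> (\<forall>t. 0 \<le> \<theta> t \<and> \<theta> t \<le> 1) \<and>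
    (\<forall>t. (\<theta> has_real_derivative \<theta>' t) (at t) \<and> \<bar>\<theta>' t\<bar> \<le> B)"
proof -
  define \<psi> where "\<psi> = flat_deriv 0"
  define \<alpha> where "\<alpha> t = \<psi> (1 - t)" for t
  define c where "c = \<psi> (\<psi> 1)"
  define \<theta> where "\<theta> t = (1 / c) *\<^sub>R \<psi> (\<psi> 1 + (-1) *\<^sub>R \<alpha> t)" for t
  have c: "0 < c" unfolding c_def \<psi>_def by (simp add: flat_deriv_0)
  have sm: "smooth_map_on k UNIV \<psi>" for k
    unfolding \<psi>_def by (rule smooth_map_on_real) (rule flat_deriv_DERIV)
  have id: "smooth_map_on k UNIV (\<lambda>x::real. x)" for k
  proof -
    define D :: "nat \<Rightarrow> real \<Rightarrow> real" where "D n x = (if n = 0 then x else if n = 1 then 1 else 0)" for n x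
    have "(D n has_real_derivative D (Suc n) x) (at x)" for n x
    proof -
      consider "n = 0" | "n = 1" | "n > 1" by linarith
      then show ?thesis by cases (auto simp: D_def[abs_def] intro!: derivative_eq_intros)
    qed
    from smooth_map_on_real[of D, OF this, of k] show ?thesis by (simp add: D_def[abs_def])
  qed
  have \<alpha>: "smooth_map_on k UNIV \<alpha>" for k
    unfolding \<alpha>_def[abs_def] by (rule smooth_map_on_compose[OF sm smooth_map_on_one_minus[OF id]]) simp
  have 1: "smooth_map_on k UNIV \<theta>" for k
    unfolding \<theta>_def[abs_def]
    by (intro smooth_map_on_scaleR smooth_map_on_compose[OF sm] smooth_map_on_add smooth_map_on_const \<alpha>) auto
  have 2: "\<theta> t = 0" if "t \<le> 0" for t
  proof -
    have "\<psi> 1 \<le> \<alpha> t" unfolding \<alpha>_def \<psi>_def by (rule flat_deriv_0_mono) (use that in simp)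
    then show ?thesis by (simp add: \<theta>_def \<psi>_def flat_deriv_0)
  qed
  have 3: "\<theta> t = 1" if "1 \<le> t" for t
    using that c by (simp add: \<theta>_def \<alpha>_def \<psi>_def flat_deriv_0 c_def)
  have 4: "0 \<le> \<theta> t" for t
    using c flat_deriv_0_nonneg[of "\<psi> 1 + (-1) *\<^sub>R \<alpha> t"] by (simp add: \<theta>_def \<psi>_def)
  have 5: "\<theta> t \<le> 1" for t
  proof -
    have "\<psi> (\<psi> 1 + (-1) *\<^sub>R \<alpha> t) \<le> c"
      unfolding \<psi>_def c_def
      by (rule flat_deriv_0_mono) (use flat_deriv_0_nonneg in \<open>simp add: \<alpha>_def \<psi>_def\<close>)
    then show ?thesis using c by (simp add: \<theta>_def)
  qed
  obtain D where D: "\<And>x. x \<in> UNIV \<Longrightarrow> (\<theta> has_derivative D x) (at x)"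
    "\<And>v. continuous_on UNIV (\<lambda>x. D x v)"
    by (rule smooth_map_on_C1[OF 1[of 1] order_refl]) (rule that)
  define \<theta>' where "\<theta>' t = D t 1" for t
  have 6: "(\<theta> has_real_derivative \<theta>' t) (at t)" for t
  proof -
    have "linear (D t)" using D(1)[of t] has_derivative_linear by blast
    have "D t = (*) (\<theta>' t)"
    proof
      fix h show "D t h = \<theta>' t * h"
        using linear_scale[OF \<open>linear (D t)\<close>, of h 1] by (simp add: \<theta>'_def mult.commute)
    qed
    then show ?thesis using D(1)[of t] by (simp add: has_field_derivative_def)
  qed
  have "compact (\<theta>' ` {0..1})"
    unfolding \<theta>'_def by (intro compact_continuous_image continuous_on_subset[OF D(2)]) auto
  then obtain B where B: "\<And>t. t \<in> {0..1} \<Longrightarrow> \<bar>\<theta>' t\<bar> \<le> B"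
    using compact_imp_bounded[THEN bounded_iff[THEN iffD1]] by (metis imageI real_norm_def)
  have out: "\<theta>' t = 0" if "t < 0 \<or> 1 < t" for t
  proof (cases "t < 0")
    case True
    have "(\<theta> has_real_derivative 0) (at t)"
      by (rule has_field_derivative_transform_within_open[OF DERIV_const[of 0], of "{..<0}"])
        (use True 2 in auto)
    then show ?thesis using 6 DERIV_unique by blast
  next
    case False
    have "(\<theta> has_real_derivative 0) (at t)"
      by (rule has_field_derivative_transform_within_open[OF DERIV_const[of 1], of "{1<..}"])
        (use False that 3 in auto)
    then show ?thesis using 6 DERIV_unique by blast
  qed
  have "0 \<le> B" using B[of 0] by simp
  then have 7: "\<bar>\<theta>' t\<bar> \<le> B" for t
    using B[of t] out[of t] by (cases "t \<in> {0..1}") auto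
  show ?thesis
    by (intro exI[of _ \<theta>] exI[of _ \<theta>'] exI[of _ B] conjI allI impI 1 2 3 4 5 6 7)
qed

section \<open>Differential bounds and smoothness on the manifold\<close>

locale weak_uniform_finsler =
  fixes A :: "('m::topological_space, 'x::banach) chart set"
    and N :: "'m \<Rightarrow> ('m, 'x) tangent \<Rightarrow> real" and l :: enat and K :: real
  assumes l: "1 \<le> l" and K: "1 \<le> K" and finsler: "weak_uniform_finsler_manifold l K A N"
begin

section \<open>Charts, transition maps and tangent vectors\<close>

lemma is_chartD:
  assumes "c \<in> A"
  shows "open (fst c)" "open (chart_image c)" "continuous_on (fst c) (snd c)"
    "continuous_on (chart_image c) (chart_inv c)"
    "p \<in> fst c \<Longrightarrow> chart_inv c (snd c p) = p" "p \<in> fst c \<Longrightarrow> snd c p \<in> chart_image c"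
    "y \<in> chart_image c \<Longrightarrow> snd c (chart_inv c y) = y" "y \<in> chart_image c \<Longrightarrow> chart_inv c y \<in> fst c"
proof -
  have "is_chart c" using assms finsler
    by (auto simp: weak_uniform_finsler_manifold_def banach_manifold_def)
  then show "open (fst c)" "open (chart_image c)" "continuous_on (fst c) (snd c)"
    "continuous_on (chart_image c) (chart_inv c)"
    "p \<in> fst c \<Longrightarrow> chart_inv c (snd c p) = p" "p \<in> fst c \<Longrightarrow> snd c p \<in> chart_image c"
    "y \<in> chart_image c \<Longrightarrow> snd c (chart_inv c y) = y" "y \<in> chart_image c \<Longrightarrow> chart_inv c y \<in> fst c"
    by (auto simp: is_chart_def homeomorphism_def chart_image_def)
qed

lemma charts_atD: "c \<in> charts_at A p \<Longrightarrow> c \<in> A" "c \<in> charts_at A p \<Longrightarrow> p \<in> fst c"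
  by (auto simp: charts_at_def)

lemma charts_at_nonempty: obtains c where "c \<in> charts_at A p"
proof -
  have "p \<in> (\<Union>c\<in>A. fst c)"
    using finsler by (simp add: weak_uniform_finsler_manifold_def banach_manifold_def)
  then show ?thesis using that by (auto simp: charts_at_def)
qed

lemma open_chart_inv_preimage:
  assumes "c \<in> A" "open W" shows "open {y \<in> chart_image c. chart_inv c y \<in> W}"
proof -
  have "open (chart_image c \<inter> chart_inv c -` W)"
    using continuous_open_preimage[OF is_chartD(4,2)[OF assms(1)] assms(2)] .
  moreover have "chart_image c \<inter> chart_inv c -` W = {y \<in> chart_image c. chart_inv c y \<in> W}" by auto
  ultimately show ?thesis by simp
qed

lemma open_chart_preimage:
  assumes "c \<in> A" "open W" shows "open {p \<in> fst c. snd c p \<in> W}"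
proof -
  have "open (fst c \<inter> snd c -` W)"
    using continuous_open_preimage[OF is_chartD(3,1)[OF assms(1)] assms(2)] .
  moreover have "fst c \<inter> snd c -` W = {p \<in> fst c. snd c p \<in> W}" by auto
  ultimately show ?thesis by simp
qed

lemma transition_smooth:
  assumes "c \<in> A" "d \<in> A"
  shows "smooth_map_on l (snd c ` (fst c \<inter> fst d)) (transition c d)"
  using assms finsler
  by (auto simp: weak_uniform_finsler_manifold_def banach_manifold_def compatible_def)

lemma transition_C1:
  assumes "c \<in> A" "d \<in> A"
  shows "p \<in> fst c \<Longrightarrow> p \<in> fst d \<Longrightarrow> (transition c d has_derivative transition_deriv p c d) (at (snd c p))"
    and "continuous_on (snd c ` (fst c \<inter> fst d)) (\<lambda>y. transition_deriv (chart_inv c y) c d v)"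
proof -
  obtain D where D: "\<And>x. x \<in> snd c ` (fst c \<inter> fst d) \<Longrightarrow> (transition c d has_derivative D x) (at x)"
    "\<And>v. continuous_on (snd c ` (fst c \<inter> fst d)) (\<lambda>x. D x v)"
    using smooth_map_on_C1[OF transition_smooth[OF assms] l] by blast
  have eq: "transition_deriv p c d = D (snd c p)" if "p \<in> fst c" "p \<in> fst d" for p
    unfolding transition_deriv_def by (rule frechet_derivative_at[symmetric]) (use that in \<open>auto intro: D\<close>)
  show "(transition c d has_derivative transition_deriv p c d) (at (snd c p))" if "p \<in> fst c" "p \<in> fst d"
    unfolding eq[OF that] by (rule D) (use that in auto)
  show "continuous_on (snd c ` (fst c \<inter> fst d)) (\<lambda>y. transition_deriv (chart_inv c y) c d v)"
    by (rule continuous_on_eq[OF D(2)[of v]]) (auto simp: eq is_chartD[OF assms(1)])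
qed

text \<open>The chain rule for transition maps; because of it \<open>tangent_vec\<close> produces
  compatible families.\<close>

lemma transition_deriv_cocycle:
  assumes "c \<in> charts_at A p" "d \<in> charts_at A p" "e \<in> charts_at A p"
  shows "transition_deriv p d e (transition_deriv p c d v) = transition_deriv p c e v"
proof -
  note c = charts_atD[OF assms(1)] and d = charts_atD[OF assms(2)] and e = charts_atD[OF assms(3)]
  have sd: "transition c d (snd c p) = snd d p" by (simp add: transition_def is_chartD[OF c(1)] c)
  have "((\<lambda>y. transition d e (transition c d y)) has_derivative
      (\<lambda>v. transition_deriv p d e (transition_deriv p c d v))) (at (snd c p))"
    by (rule has_derivative_compose[OF transition_C1(1)[OF c(1) d(1) c(2) d(2)]])
      (use transition_C1(1)[OF d(1) e(1) d(2) e(2)] in \<open>simp add: sd\<close>)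
  then have "(transition c e has_derivative
      (\<lambda>v. transition_deriv p d e (transition_deriv p c d v))) (at (snd c p))"
    by (rule has_derivative_transform_within_open[where s = "{y \<in> chart_image c. chart_inv c y \<in> fst d}"])
      (auto simp: transition_def is_chartD[OF c(1)] is_chartD[OF d(1)] c d open_chart_inv_preimage)
  from has_derivative_unique[OF this transition_C1(1)[OF c(1) e(1) c(2) e(2)]]
  show ?thesis by (rule fun_cong)
qed

lemma tangent_vec_in_tangent_space:
  assumes "c \<in> charts_at A p" shows "tangent_vec A c p v \<in> tangent_space A p"
  unfolding tangent_space_def
  by (auto simp: tangent_vec_def transition_deriv_cocycle[OF assms])

lemma tangent_vec_transition:
  assumes "c \<in> charts_at A p" "d \<in> charts_at A p"
  shows "tangent_vec A d p (transition_deriv p c d v) = tangent_vec A c p v"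
  by (rule ext) (simp add: tangent_vec_def transition_deriv_cocycle[OF assms])

lemma tangent_space_eq_tangent_vec:
  assumes "\<xi> \<in> tangent_space A p" "c \<in> charts_at A p"
  shows "\<xi> = tangent_vec A c p (\<xi> c)"
proof
  fix d show "\<xi> d = tangent_vec A c p (\<xi> c) d"
  proof (cases "d \<in> charts_at A p")
    case True
    have "\<xi> d = transition_deriv p c d (\<xi> c)"
      by (rule assms(1)[unfolded tangent_space_def mem_Collect_eq, THEN conjunct1, rule_format, OF assms(2) True])
    then show ?thesis using True by (simp only: tangent_vec_def if_True)
  next
    case False
    have "\<xi> d = 0"
      by (rule assms(1)[unfolded tangent_space_def mem_Collect_eq, THEN conjunct2, rule_format, OF False])
    then show ?thesis using False by (simp only: tangent_vec_def if_False)
  qed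
qed

section \<open>Tangent norms and pointwise bounds on differentials\<close>

lemma N_nonneg: "\<xi> \<in> tangent_space A p \<Longrightarrow> 0 \<le> N p \<xi>"
  using finsler
  by (auto simp: weak_uniform_finsler_manifold_def finsler_P1_def is_norm_on_tangent_def)

lemma N_tangent_vec_nonneg: "c \<in> charts_at A p \<Longrightarrow> 0 \<le> N p (tangent_vec A c p v)"
  by (intro N_nonneg tangent_vec_in_tangent_space)

text \<open>Differentiability at p together with a bound on the dual norm of the differential,
  stated in coordinates and without a supremum. One chart is asked for, which makes it easy to
  establish; \<open>diff_boundE\<close> passes to any other chart.\<close>

definition diff_bound :: "('m \<Rightarrow> real) \<Rightarrow> 'm \<Rightarrow> real \<Rightarrow> bool" where
  "diff_bound g p C \<longleftrightarrow> (\<exists>c\<in>charts_at A p. \<exists>T. (g \<circ> chart_inv c has_derivative T) (at (snd c p)) \<and>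
     (\<forall>v. \<bar>T v\<bar> \<le> C * N p (tangent_vec A c p v)))"

lemma diff_boundE:
  assumes "diff_bound g p C" and d: "d \<in> charts_at A p"
  obtains T where "(g \<circ> chart_inv d has_derivative T) (at (snd d p))"
    "\<And>v. \<bar>T v\<bar> \<le> C * N p (tangent_vec A d p v)"
proof -
  obtain c T where c: "c \<in> charts_at A p" and T: "(g \<circ> chart_inv c has_derivative T) (at (snd c p))"
    "\<And>v. \<bar>T v\<bar> \<le> C * N p (tangent_vec A c p v)"
    using assms(1) unfolding diff_bound_def by auto
  note c' = charts_atD[OF c] and d' = charts_atD[OF d]
  have sd: "transition d c (snd d p) = snd c p" by (simp add: transition_def is_chartD[OF d'(1)] d')
  have "((\<lambda>y. (g \<circ> chart_inv c) (transition d c y)) has_derivative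
      (\<lambda>v. T (transition_deriv p d c v))) (at (snd d p))"
    by (rule has_derivative_compose[OF transition_C1(1)[OF d'(1) c'(1) d'(2) c'(2)]]) (simp only: sd T(1))
  then have "(g \<circ> chart_inv d has_derivative (\<lambda>v. T (transition_deriv p d c v))) (at (snd d p))"
    by (rule has_derivative_transform_within_open[where s = "{y \<in> chart_image d. chart_inv d y \<in> fst c}"])
      (auto simp: transition_def is_chartD[OF c'(1)] is_chartD[OF d'(1)] c' d' open_chart_inv_preimage)
  then show ?thesis
    by (rule that) (use T(2) tangent_vec_transition[OF d c] in metis)
qed

lemma diff_boundI:
  "c \<in> charts_at A p \<Longrightarrow> (g \<circ> chart_inv c has_derivative T) (at (snd c p)) \<Longrightarrow>
    (\<And>v. \<bar>T v\<bar> \<le> C * N p (tangent_vec A c p v)) \<Longrightarrow> diff_bound g p C"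
  unfolding diff_bound_def by blast

lemma diff_bound_mono:
  assumes "diff_bound g p C" "C \<le> C'" shows "diff_bound g p C'"
proof -
  obtain c where c: "c \<in> charts_at A p" by (rule charts_at_nonempty)
  obtain T where T: "(g \<circ> chart_inv c has_derivative T) (at (snd c p))"
    "\<And>v. \<bar>T v\<bar> \<le> C * N p (tangent_vec A c p v)" by (rule diff_boundE[OF assms(1) c]) (rule that)
  show ?thesis
    by (rule diff_boundI[OF c T(1)])
      (rule order_trans[OF T(2) mult_right_mono[OF assms(2) N_tangent_vec_nonneg[OF c]]])
qed

lemma diff_bound_local:
  assumes g: "diff_bound g p C" and W: "open W" "p \<in> W" and eq: "\<And>q. q \<in> W \<Longrightarrow> g q = g' q"
  shows "diff_bound g' p C"
proof -
  obtain c where c: "c \<in> charts_at A p" by (rule charts_at_nonempty)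
  note c' = charts_atD[OF c]
  obtain T where T: "(g \<circ> chart_inv c has_derivative T) (at (snd c p))"
    "\<And>v. \<bar>T v\<bar> \<le> C * N p (tangent_vec A c p v)" by (rule diff_boundE[OF g c]) (rule that)
  have "(g' \<circ> chart_inv c has_derivative T) (at (snd c p))"
    by (rule has_derivative_transform_within_open[OF T(1) open_chart_inv_preimage[OF c'(1) W(1)]])
      (auto simp: is_chartD[OF c'(1)] c' W eq)
  then show ?thesis using T(2) by (rule diff_boundI[OF c])
qed

lemma diff_bound_const: "0 \<le> C \<Longrightarrow> diff_bound (\<lambda>_. a) p C"
proof -
  assume C: "0 \<le> C"
  obtain c where c: "c \<in> charts_at A p" by (rule charts_at_nonempty)
  show ?thesis
    by (rule diff_boundI[OF c, of _ "\<lambda>_. 0"])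
      (use C N_tangent_vec_nonneg[OF c] in \<open>auto simp: o_def\<close>)
qed

lemma diff_bound_add:
  assumes "diff_bound g p C" "diff_bound h p D"
  shows "diff_bound (\<lambda>q. g q + h q) p (C + D)"
proof -
  obtain c where c: "c \<in> charts_at A p" by (rule charts_at_nonempty)
  obtain T where T: "(g \<circ> chart_inv c has_derivative T) (at (snd c p))"
    "\<And>v. \<bar>T v\<bar> \<le> C * N p (tangent_vec A c p v)" by (rule diff_boundE[OF assms(1) c]) (rule that)
  obtain U where U: "(h \<circ> chart_inv c has_derivative U) (at (snd c p))"
    "\<And>v. \<bar>U v\<bar> \<le> D * N p (tangent_vec A c p v)" by (rule diff_boundE[OF assms(2) c]) (rule that)
  show ?thesis
  proof (rule diff_boundI[OF c])
    show "((\<lambda>q. g q + h q) \<circ> chart_inv c has_derivative (\<lambda>v. T v + U v)) (at (snd c p))"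
      using has_derivative_add[OF T(1) U(1)] by (simp add: o_def)
    show "\<bar>T v + U v\<bar> \<le> (C + D) * N p (tangent_vec A c p v)" for v
      using T(2)[of v] U(2)[of v] by (simp add: distrib_right abs_le_iff) 
  qed
qed

lemma diff_bound_mult:
  assumes "diff_bound g p C" "diff_bound h p D"
  shows "diff_bound (\<lambda>q. g q * h q) p (\<bar>g p\<bar> * D + \<bar>h p\<bar> * C)"
proof -
  obtain c where c: "c \<in> charts_at A p" by (rule charts_at_nonempty)
  note c' = charts_atD[OF c]
  obtain T where T: "(g \<circ> chart_inv c has_derivative T) (at (snd c p))"
    "\<And>v. \<bar>T v\<bar> \<le> C * N p (tangent_vec A c p v)" by (rule diff_boundE[OF assms(1) c]) (rule that)
  obtain U where U: "(h \<circ> chart_inv c has_derivative U) (at (snd c p))"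
    "\<And>v. \<bar>U v\<bar> \<le> D * N p (tangent_vec A c p v)" by (rule diff_boundE[OF assms(2) c]) (rule that)
  show ?thesis
  proof (rule diff_boundI[OF c])
    show "((\<lambda>q. g q * h q) \<circ> chart_inv c has_derivative (\<lambda>v. g p * U v + T v * h p)) (at (snd c p))"
      using has_derivative_mult[OF T(1) U(1)] by (simp add: o_def is_chartD[OF c'(1)] c')
    fix v
    have "\<bar>g p * U v + T v * h p\<bar> \<le> \<bar>g p\<bar> * \<bar>U v\<bar> + \<bar>T v\<bar> * \<bar>h p\<bar>"
      by (metis abs_mult abs_triangle_ineq)
    also have "\<dots> \<le> \<bar>g p\<bar> * (D * N p (tangent_vec A c p v)) + (C * N p (tangent_vec A c p v)) * \<bar>h p\<bar>"
      using T(2)[of v] U(2)[of v] by (intro add_mono mult_left_mono mult_right_mono) auto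
    finally show "\<bar>g p * U v + T v * h p\<bar> \<le> (\<bar>g p\<bar> * D + \<bar>h p\<bar> * C) * N p (tangent_vec A c p v)"
      by (simp add: algebra_simps)
  qed
qed

lemma diff_bound_sum:
  assumes "finite I" "\<And>i. i \<in> I \<Longrightarrow> diff_bound (g i) p (C i)"
  shows "diff_bound (\<lambda>q. \<Sum>i\<in>I. g i q) p (\<Sum>i\<in>I. C i)"
  using assms
proof (induction I rule: finite_induct)
  case empty
  show ?case using diff_bound_const[of 0 0 p] by simp
next
  case (insert i I)
  have "diff_bound (g i) p (C i)" "diff_bound (\<lambda>q. \<Sum>i\<in>I. g i q) p (\<Sum>i\<in>I. C i)"
    using insert by auto
  from diff_bound_add[OF this] show ?case using insert(1,2) by simp
qed

lemma diff_bound_real_compose: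
  assumes g: "diff_bound g p C" and t: "(\<theta> has_real_derivative t) (at (g p))"
  shows "diff_bound (\<lambda>q. \<theta> (g q)) p (\<bar>t\<bar> * C)"
proof -
  obtain c where c: "c \<in> charts_at A p" by (rule charts_at_nonempty)
  note c' = charts_atD[OF c]
  obtain T where T: "(g \<circ> chart_inv c has_derivative T) (at (snd c p))"
    "\<And>v. \<bar>T v\<bar> \<le> C * N p (tangent_vec A c p v)" by (rule diff_boundE[OF g c]) (rule that)
  show ?thesis
  proof (rule diff_boundI[OF c])
    have "((\<lambda>q. \<theta> ((g \<circ> chart_inv c) q)) has_derivative (\<lambda>v. t * T v)) (at (snd c p))"
      by (rule has_derivative_compose[OF T(1)])
        (use t in \<open>simp add: has_field_derivative_def is_chartD[OF c'(1)] c'\<close>)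
    then show "((\<lambda>q. \<theta> (g q)) \<circ> chart_inv c has_derivative (\<lambda>v. t * T v)) (at (snd c p))"
      by (simp add: o_def)
    show "\<bar>t * T v\<bar> \<le> \<bar>t\<bar> * C * N p (tangent_vec A c p v)" for v
      using mult_left_mono[OF T(2)[of v], of "\<bar>t\<bar>"] by (simp add: abs_mult mult.assoc)
  qed
qed

lemma dual_norm_differential_le:
  assumes g: "diff_bound g p C" and C: "0 \<le> C"
  shows "dual_norm A N p (differential A g p) \<le> ereal C"
  unfolding dual_norm_def
proof (rule SUP_least)
  fix \<xi> assume "\<xi> \<in> {\<xi> \<in> tangent_space A p. N p \<xi> \<le> 1}"
  then have \<xi>: "\<xi> \<in> tangent_space A p" "N p \<xi> \<le> 1" by auto
  define c where "c = (SOME c. c \<in> charts_at A p)"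
  have c: "c \<in> charts_at A p" unfolding c_def using charts_at_nonempty by (metis someI_ex)
  obtain T where T: "(g \<circ> chart_inv c has_derivative T) (at (snd c p))"
    "\<And>v. \<bar>T v\<bar> \<le> C * N p (tangent_vec A c p v)" by (rule diff_boundE[OF g c]) (rule that)
  have "differential A g p \<xi> = T (\<xi> c)"
    unfolding differential_def Let_def c_def[symmetric] frechet_derivative_at[OF T(1), symmetric] ..
  also have "\<bar>T (\<xi> c)\<bar> \<le> C * N p \<xi>"
    using T(2)[of "\<xi> c"] tangent_space_eq_tangent_vec[OF \<xi>(1) c] by simp
  also have "\<dots> \<le> C" using mult_left_mono[OF \<xi>(2) C] by simp
  finally show "ereal \<bar>differential A g p \<xi>\<bar> \<le> ereal C" by simp
qed

section \<open>Smoothness near a point\<close>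

definition smooth_near :: "enat \<Rightarrow> ('m \<Rightarrow> real) \<Rightarrow> 'm \<Rightarrow> bool" where
  "smooth_near m g p \<longleftrightarrow> (\<exists>c\<in>charts_at A p. \<exists>V. snd c p \<in> V \<and> V \<subseteq> chart_image c \<and>
     smooth_map_on m V (g \<circ> chart_inv c))"

text \<open>Change of charts composes with a transition map, which is only of class C^l. This is
  where the order of the final function is limited by l.\<close>

lemma smooth_nearE:
  assumes "smooth_near m g p" "m \<le> l" and d: "d \<in> charts_at A p"
  obtains V where "snd d p \<in> V" "V \<subseteq> chart_image d" "smooth_map_on m V (g \<circ> chart_inv d)"
proof -
  obtain c V where c: "c \<in> charts_at A p" and V: "snd c p \<in> V" "V \<subseteq> chart_image c"
    "smooth_map_on m V (g \<circ> chart_inv c)" using assms(1) unfolding smooth_near_def by auto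
  note c' = charts_atD[OF c] and d' = charts_atD[OF d]
  define S where "S = snd d ` (fst d \<inter> fst c)"
  define W where "W = {y \<in> S. transition d c y \<in> V}"
  have S: "smooth_map_on m S (transition d c)"
    unfolding S_def by (rule smooth_map_on_le[OF transition_smooth[OF d'(1) c'(1)] assms(2)])
  have oS: "open S" by (rule smooth_map_on_open[OF S])
  have "continuous_on S (transition d c)"
  proof -
    have "\<And>y. y \<in> S \<Longrightarrow> isCont (transition d c) y"
      unfolding S_def using transition_C1(1)[OF d'(1) c'(1)] has_derivative_continuous by blast
    then show ?thesis by (simp add: continuous_at_imp_continuous_on)
  qed
  from continuous_open_preimage[OF this oS smooth_map_on_open[OF V(3)]]
  have "open (S \<inter> transition d c -` V)" .
  moreover have "S \<inter> transition d c -` V = W" by (auto simp: W_def)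
  ultimately have oW: "open W" by simp
  have "smooth_map_on m W (\<lambda>y. (g \<circ> chart_inv c) (transition d c y))"
    by (rule smooth_map_on_compose[OF V(3) smooth_map_on_subset[OF S oW]]) (auto simp: W_def)
  then have "smooth_map_on m W (g \<circ> chart_inv d)"
    by (rule smooth_map_on_cong)
      (auto simp: W_def S_def transition_def is_chartD[OF c'(1)] is_chartD[OF d'(1)])
  moreover have "snd d p \<in> W"
    using V c' d' by (auto simp: W_def S_def transition_def is_chartD[OF d'(1)])
  moreover have "W \<subseteq> chart_image d" by (auto simp: W_def S_def chart_image_def)
  ultimately show ?thesis by (rule that[rotated 2])
qed

lemma smooth_function_of_smooth_near:
  assumes "\<And>p. smooth_near m g p" "m \<le> l"
  shows "smooth_function A m g"
  unfolding smooth_function_def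
proof
  fix c assume c: "c \<in> A"
  show "smooth_map_on m (chart_image c) (g \<circ> chart_inv c)"
  proof (rule smooth_map_on_local[OF is_chartD(2)[OF c]])
    fix y assume y: "y \<in> chart_image c"
    then have "c \<in> charts_at A (chart_inv c y)" using c by (simp add: charts_at_def is_chartD[OF c])
    from smooth_nearE[OF assms(1,2) this]
    show "\<exists>U f'. y \<in> U \<and> smooth_map_on m U f' \<and> (\<forall>z\<in>U. f' z = (g \<circ> chart_inv c) z)"
      using y by (metis is_chartD(7)[OF c])
  qed
qed

lemma smooth_near_local:
  assumes g: "smooth_near m g p" and W: "open W" "p \<in> W" and eq: "\<And>q. q \<in> W \<Longrightarrow> g q = g' q"
  shows "smooth_near m g' p"
proof -
  obtain c V where c: "c \<in> charts_at A p" and V: "snd c p \<in> V" "V \<subseteq> chart_image c"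
    "smooth_map_on m V (g \<circ> chart_inv c)" using g unfolding smooth_near_def by auto
  note c' = charts_atD[OF c]
  define U where "U = V \<inter> {y \<in> chart_image c. chart_inv c y \<in> W}"
  have "open U" unfolding U_def
    by (intro open_Int smooth_map_on_open[OF V(3)] open_chart_inv_preimage c' W)
  then have "smooth_map_on m U (g \<circ> chart_inv c)"
    by (rule smooth_map_on_subset[OF V(3)]) (auto simp: U_def)
  then have "smooth_map_on m U (g' \<circ> chart_inv c)"
    by (rule smooth_map_on_cong) (auto simp: U_def eq)
  moreover have "snd c p \<in> U" "U \<subseteq> chart_image c"
    using V c' W by (auto simp: U_def is_chartD[OF c'(1)])
  ultimately show ?thesis using c unfolding smooth_near_def by blast
qed

lemma smooth_near_const: "smooth_near m (\<lambda>_. a) p"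
proof -
  obtain c where c: "c \<in> charts_at A p" by (rule charts_at_nonempty)
  note c' = charts_atD[OF c]
  have "smooth_map_on m (chart_image c) ((\<lambda>_. a) \<circ> chart_inv c)"
    using smooth_map_on_const[OF is_chartD(2)[OF c'(1)], of m a] by (simp add: o_def)
  then show ?thesis using c is_chartD(6)[OF c'] unfolding smooth_near_def by blast
qed

lemma smooth_near2E:
  assumes "smooth_near m g p" "smooth_near m h p" "m \<le> l"
  obtains c V where "c \<in> charts_at A p" "snd c p \<in> V" "V \<subseteq> chart_image c"
    "smooth_map_on m V (g \<circ> chart_inv c)" "smooth_map_on m V (h \<circ> chart_inv c)"
proof -
  obtain c where c: "c \<in> charts_at A p" by (rule charts_at_nonempty)
  obtain V where V: "snd c p \<in> V" "V \<subseteq> chart_image c" "smooth_map_on m V (g \<circ> chart_inv c)"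
    by (rule smooth_nearE[OF assms(1,3) c]) (rule that)
  obtain W where W: "snd c p \<in> W" "W \<subseteq> chart_image c" "smooth_map_on m W (h \<circ> chart_inv c)"
    by (rule smooth_nearE[OF assms(2,3) c]) (rule that)
  have o: "open (V \<inter> W)" by (intro open_Int smooth_map_on_open[OF V(3)] smooth_map_on_open[OF W(3)])
  show ?thesis
    by (rule that[OF c, of "V \<inter> W"])
      (use V W in \<open>auto intro: smooth_map_on_subset[OF V(3) o] smooth_map_on_subset[OF W(3) o]\<close>)
qed

lemma smooth_near_add:
  assumes "smooth_near m g p" "smooth_near m h p" "m \<le> l"
  shows "smooth_near m (\<lambda>q. g q + h q) p"
proof -
  obtain c V where V: "c \<in> charts_at A p" "snd c p \<in> V" "V \<subseteq> chart_image c"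
    "smooth_map_on m V (g \<circ> chart_inv c)" "smooth_map_on m V (h \<circ> chart_inv c)"
    by (rule smooth_near2E[OF assms]) (rule that)
  have "smooth_map_on m V ((\<lambda>q. g q + h q) \<circ> chart_inv c)"
    using smooth_map_on_add[OF V(4,5)] by (simp add: o_def)
  then show ?thesis using V unfolding smooth_near_def by blast
qed

lemma smooth_near_mult:
  assumes "smooth_near m g p" "smooth_near m h p" "m \<le> l"
  shows "smooth_near m (\<lambda>q. g q * h q) p"
proof -
  obtain c V where V: "c \<in> charts_at A p" "snd c p \<in> V" "V \<subseteq> chart_image c"
    "smooth_map_on m V (g \<circ> chart_inv c)" "smooth_map_on m V (h \<circ> chart_inv c)"
    by (rule smooth_near2E[OF assms]) (rule that)
  have "smooth_map_on m V ((\<lambda>q. g q * h q) \<circ> chart_inv c)"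
    using smooth_map_on_mult[OF V(4,5)] by (simp add: o_def)
  then show ?thesis using V unfolding smooth_near_def by blast
qed

lemma smooth_near_sum:
  assumes "finite I" "\<And>i. i \<in> I \<Longrightarrow> smooth_near m (g i) p" "m \<le> l"
  shows "smooth_near m (\<lambda>q. \<Sum>i\<in>I. g i q) p"
  using assms
proof (induction I rule: finite_induct)
  case empty
  show ?case using smooth_near_const[of m 0 p] by simp
next
  case (insert i I)
  have "smooth_near m (g i) p" "smooth_near m (\<lambda>q. \<Sum>i\<in>I. g i q) p"
    using insert by auto
  from smooth_near_add[OF this insert.prems(2)] show ?case using insert(1,2) by simp
qed

lemma smooth_near_compose_chart:
  assumes "c \<in> charts_at A p" "smooth_map_on m UNIV h"
  shows "smooth_near m (\<lambda>q. h (snd c q)) p"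
proof -
  note c' = charts_atD[OF assms(1)]
  have "smooth_map_on m (chart_image c) h"
    by (rule smooth_map_on_subset[OF assms(2) is_chartD(2)[OF c'(1)]]) simp
  then have "smooth_map_on m (chart_image c) ((\<lambda>q. h (snd c q)) \<circ> chart_inv c)"
    by (rule smooth_map_on_cong) (simp add: is_chartD[OF c'(1)])
  then show ?thesis using assms(1) is_chartD(6)[OF c'] unfolding smooth_near_def by blast
qed

end
section \<open>Path length\<close>

text \<open>Take W together with all open sets whose closure misses p; by the Hausdorff property
  they cover the space. In a locally finite refinement the members not contained in W have closures
  missing p, and by local finiteness the closure of their union is the union of these closures. Its
  complement is V.\<close>

lemma paracompact_regular:
  assumes P: "paracompact_topology (euclidean :: 'a::topological_space topology)"
    and W: "open (W :: 'a set)" "p \<in> W"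
  obtains V where "open V" "p \<in> V" "closure V \<subseteq> W"
proof -
  have sep: "\<exists>U. open U \<and> q \<in> U \<and> p \<notin> closure U" if qp: "q \<noteq> p" for q
  proof -
    have "Hausdorff_space (euclidean :: 'a topology)" using P by (simp add: paracompact_topology_def)
    then obtain U V where UV: "open U" "open V" "q \<in> U" "p \<in> V" "U \<inter> V = {}"
      unfolding Hausdorff_space_def disjnt_def open_openin[symmetric] using qp by (metis UNIV_I topspace_euclidean)
    then have "closure U \<inter> V = {}" using open_Int_closure_eq_empty by blast
    then show ?thesis using UV by blast
  qed
  define \<U> where "\<U> = insert W {U. open U \<and> p \<notin> closure U}"
  have "q \<in> \<Union>\<U>" for q
    using sep[of q] W by (cases "q = p") (auto simp: \<U>_def)
  then have "(\<forall>U\<in>\<U>. openin euclidean U) \<and> \<Union>\<U> = topspace euclidean"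
    using W by (auto simp: \<U>_def)
  then have "\<exists>\<V>. (\<forall>V\<in>\<V>. openin euclidean V \<and> (\<exists>U\<in>\<U>. V \<subseteq> U)) \<and> \<Union>\<V> = topspace euclidean \<and>
      locally_finite_in euclidean \<V>"
    using P[unfolded paracompact_topology_def, THEN conjunct2, THEN spec[of _ \<U>]] by (rule rev_mp)
  then obtain \<V> where \<V>': "\<forall>V\<in>\<V>. openin euclidean V \<and> (\<exists>U\<in>\<U>. V \<subseteq> U)" "\<Union>\<V> = topspace euclidean"
    "locally_finite_in euclidean \<V>"
    by (elim exE conjE) (rule that)
  have \<V>: "\<And>V. V \<in> \<V> \<Longrightarrow> open V \<and> (\<exists>U\<in>\<U>. V \<subseteq> U)" "\<Union>\<V> = UNIV"
    "locally_finite_in euclidean \<V>"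
    using \<V>' by (simp_all only: open_openin topspace_euclidean)
  define \<W> where "\<W> = {V \<in> \<V>. \<not> V \<subseteq> W}"
  have cl: "closure (\<Union>\<W>) = \<Union>(closure ` \<W>)"
    using closure_of_locally_finite_Union[OF locally_finite_in_subset[OF \<V>(3), of \<W>]]
    by (auto simp: \<W>_def)
  have "p \<notin> closure V" if "V \<in> \<W>" for V
  proof -
    have "V \<in> \<V>" "\<not> V \<subseteq> W" using that by (auto simp: \<W>_def)
    then obtain U where "V \<subseteq> U" "U \<in> \<U>" "U \<noteq> W" using \<V>(1) by blast
    then have "closure V \<subseteq> closure U" "p \<notin> closure U" by (auto simp: \<U>_def closure_mono)
    then show ?thesis by blast
  qed
  then have p: "p \<in> - closure (\<Union>\<W>)" unfolding cl by blast
  have "- W \<subseteq> \<Union>\<W>"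
  proof
    fix q assume "q \<in> - W"
    moreover have "q \<in> \<Union>\<V>" unfolding \<V>(2) by (rule UNIV_I)
    then obtain V where "V \<in> \<V>" "q \<in> V" by (rule UnionE)
    ultimately have "V \<in> \<W>" unfolding \<W>_def by blast
    with \<open>q \<in> V\<close> show "q \<in> \<Union>\<W>" by (rule UnionI[rotated])
  qed
  moreover have "open (\<Union>\<W>)"
  proof (intro open_Union ballI)
    fix V assume "V \<in> \<W>"
    then have "V \<in> \<V>" by (simp add: \<W>_def)
    from \<V>(1)[OF this] show "open V" by (rule conjunct1)
  qed
  ultimately have "closure (- closure (\<Union>\<W>)) \<subseteq> W"
    by (metis (no_types, lifting) closure_complement Compl_subset_Compl_iff closure_subset double_complement
        interior_maximal order_trans)
  then show ?thesis using p by (intro that[of "- closure (\<Union>\<W>)"]) auto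
qed

context weak_uniform_finsler
begin

section \<open>Continuity of the norm and of the speed of a path\<close>

lemma topspace_tangent_topology: "topspace (tangent_topology A) = tangent_bundle A"
proof (rule antisym)
  show "topspace (tangent_topology A) \<subseteq> tangent_bundle A"
    using openin_tangent_topology[of A "topspace (tangent_topology A)"] by simp
  have "openin (tangent_topology A) (tangent_bundle A)"
    unfolding openin_tangent_topology
  proof (intro conjI ballI)
    fix c assume c: "c \<in> A"
    have "tangent_preimage A c (tangent_bundle A) = chart_image c \<times> UNIV"
      using c by (auto simp: tangent_preimage_def tangent_bundle_def charts_at_def is_chartD[OF c]
          intro!: tangent_vec_in_tangent_space)
    then show "open (tangent_preimage A c (tangent_bundle A))"
      by (simp add: open_Times is_chartD[OF c])
  qed simp
  then show "tangent_bundle A \<subseteq> topspace (tangent_topology A)" by (rule openin_subset)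
qed

text \<open>Continuity for the final topology, read off in a single bundle chart.\<close>

lemma N_continuous_in_chart:
  assumes c: "c \<in> A"
  shows "continuous_on (chart_image c \<times> UNIV)
    (\<lambda>z. N (chart_inv c (fst z)) (tangent_vec A c (chart_inv c (fst z)) (snd z)))"
proof -
  have o: "open (chart_image c \<times> (UNIV :: 'x set))" by (simp add: open_Times is_chartD[OF c])
  have "open ((\<lambda>z. N (chart_inv c (fst z)) (tangent_vec A c (chart_inv c (fst z)) (snd z))) -` B \<inter> chart_image c \<times> UNIV)"
    if B: "open B" for B
  proof -
    define W where "W = {w \<in> topspace (tangent_topology A). (\<lambda>(x, \<xi>). N x \<xi>) w \<in> B}"
    have "continuous_map (tangent_topology A) euclideanreal (\<lambda>(x, \<xi>). N x \<xi>)"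
      using finsler by (simp add: weak_uniform_finsler_manifold_def)
    then have "openin (tangent_topology A) W"
      unfolding W_def by (rule openin_continuous_map_preimage) (use B in simp)
    then have "open (tangent_preimage A c W)" using c by (simp add: openin_tangent_topology)
    moreover have "tangent_preimage A c W =
        (\<lambda>z. N (chart_inv c (fst z)) (tangent_vec A c (chart_inv c (fst z)) (snd z))) -` B \<inter> chart_image c \<times> UNIV"
      using c by (auto simp: tangent_preimage_def W_def topspace_tangent_topology tangent_bundle_def
          charts_at_def is_chartD[OF c] intro!: tangent_vec_in_tangent_space)
    ultimately show ?thesis by simp
  qed
  then show ?thesis by (simp add: continuous_on_open_vimage[OF o])
qed

text \<open>The velocity from inside the interval, so that it also exists at the end points.\<close>

definition inner_velocity :: "(real \<Rightarrow> 'm) \<Rightarrow> real \<Rightarrow> real \<Rightarrow> real \<Rightarrow> ('m, 'x) tangent" where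
  "inner_velocity \<gamma> s t \<tau> =
     (\<lambda>d. if d \<in> charts_at A (\<gamma> \<tau>) then vector_derivative (snd d \<circ> \<gamma>) (at \<tau> within {s..t}) else 0)"

lemma C1_path_chart:
  assumes \<gamma>: "C1_path A \<gamma> s t" and st: "s < t" and c: "c \<in> A"
  shows "\<tau> \<in> {s..t} \<Longrightarrow> \<gamma> \<tau> \<in> fst c \<Longrightarrow>
      (snd c \<circ> \<gamma> has_vector_derivative inner_velocity \<gamma> s t \<tau> c) (at \<tau> within {s..t})"
    and "continuous_on {\<tau>\<in>{s..t}. \<gamma> \<tau> \<in> fst c} (\<lambda>\<tau>. inner_velocity \<gamma> s t \<tau> c)"
proof -
  obtain \<gamma>' where \<gamma>': "continuous_on {\<tau>\<in>{s..t}. \<gamma> \<tau> \<in> fst c} \<gamma>'"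
    "\<And>\<tau>. \<tau> \<in> {s..t} \<Longrightarrow> \<gamma> \<tau> \<in> fst c \<Longrightarrow> (snd c \<circ> \<gamma> has_vector_derivative \<gamma>' \<tau>) (at \<tau> within {s..t})"
    using \<gamma> c unfolding C1_path_def by meson
  have eq: "inner_velocity \<gamma> s t \<tau> c = \<gamma>' \<tau>" if "\<tau> \<in> {s..t}" "\<gamma> \<tau> \<in> fst c" for \<tau>
    using vector_derivative_within_cbox[of s t \<tau> "snd c \<circ> \<gamma>" "\<gamma>' \<tau>"] st that \<gamma>'(2)[OF that] c
    by (simp add: inner_velocity_def charts_at_def)
  show "\<tau> \<in> {s..t} \<Longrightarrow> \<gamma> \<tau> \<in> fst c \<Longrightarrow>
      (snd c \<circ> \<gamma> has_vector_derivative inner_velocity \<gamma> s t \<tau> c) (at \<tau> within {s..t})"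
    using \<gamma>'(2)[of \<tau>] by (simp add: eq)
  show "continuous_on {\<tau>\<in>{s..t}. \<gamma> \<tau> \<in> fst c} (\<lambda>\<tau>. inner_velocity \<gamma> s t \<tau> c)"
    by (rule continuous_on_eq[OF \<gamma>'(1)]) (simp add: eq)
qed

lemma C1_path_eventually_in_chart:
  assumes \<gamma>: "C1_path A \<gamma> s t" and c: "c \<in> A" and \<tau>: "\<tau> \<in> {s..t}" "\<gamma> \<tau> \<in> fst c"
  shows "eventually (\<lambda>\<sigma>. \<gamma> \<sigma> \<in> fst c) (at \<tau> within {s..t})"
proof -
  have "(\<gamma> \<longlongrightarrow> \<gamma> \<tau>) (at \<tau> within {s..t})"
    using \<gamma> \<tau> by (simp add: C1_path_def continuous_on_def)
  then show ?thesis by (rule topological_tendstoD) (use is_chartD(1)[OF c] \<tau> in auto)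
qed

lemma inner_velocity_eq_tangent_vec:
  assumes \<gamma>: "C1_path A \<gamma> s t" and st: "s < t" and \<tau>: "\<tau> \<in> {s..t}" and c: "c \<in> charts_at A (\<gamma> \<tau>)"
  shows "inner_velocity \<gamma> s t \<tau> = tangent_vec A c (\<gamma> \<tau>) (inner_velocity \<gamma> s t \<tau> c)"
proof
  fix d
  note c' = charts_atD[OF c]
  show "inner_velocity \<gamma> s t \<tau> d = tangent_vec A c (\<gamma> \<tau>) (inner_velocity \<gamma> s t \<tau> c) d"
  proof (cases "d \<in> charts_at A (\<gamma> \<tau>)")
    case True
    note d' = charts_atD[OF True]
    let ?v = "inner_velocity \<gamma> s t \<tau> c" and ?T = "transition_deriv (\<gamma> \<tau>) c d"
    have T: "(transition c d has_derivative ?T) (at ((snd c \<circ> \<gamma>) \<tau>))"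
      using transition_C1(1)[OF c'(1) d'(1) c'(2) d'(2)] by simp
    have "((\<lambda>\<sigma>. transition c d ((snd c \<circ> \<gamma>) \<sigma>)) has_derivative (\<lambda>h. ?T (h *\<^sub>R ?v))) (at \<tau> within {s..t})"
      by (rule has_derivative_compose[OF C1_path_chart(1)[OF \<gamma> st c'(1) \<tau> c'(2), unfolded has_vector_derivative_def] T])
    then have "(snd d \<circ> \<gamma> has_derivative (\<lambda>h. ?T (h *\<^sub>R ?v))) (at \<tau> within {s..t})"
      by (rule has_derivative_transform_eventually)
        (use C1_path_eventually_in_chart[OF \<gamma> c'(1) \<tau> c'(2)] \<tau> in
          \<open>auto elim!: eventually_mono simp: transition_def is_chartD[OF c'(1)] c'\<close>)
    moreover have "?T (h *\<^sub>R ?v) = h *\<^sub>R ?T ?v" for h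
      by (rule linear_scale[OF has_derivative_linear[OF T]])
    ultimately have "(snd d \<circ> \<gamma> has_vector_derivative ?T ?v) (at \<tau> within {s..t})"
      by (simp add: has_vector_derivative_def)
    then have "vector_derivative (snd d \<circ> \<gamma>) (at \<tau> within cbox s t) = ?T ?v"
      using vector_derivative_within_cbox[of s t \<tau> "snd d \<circ> \<gamma>"] st \<tau> by simp
    then show ?thesis using True by (simp add: inner_velocity_def tangent_vec_def)
  qed (simp add: inner_velocity_def tangent_vec_def)
qed

lemma inner_speed_continuous:
  assumes \<gamma>: "C1_path A \<gamma> s t" and st: "s < t"
  shows "continuous_on {s..t} (\<lambda>\<tau>. N (\<gamma> \<tau>) (inner_velocity \<gamma> s t \<tau>))"
  unfolding continuous_on_def
proof
  fix \<tau> assume \<tau>: "\<tau> \<in> {s..t}"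
  obtain c where c: "c \<in> charts_at A (\<gamma> \<tau>)" by (rule charts_at_nonempty)
  note c' = charts_atD[OF c]
  define E where "E = {\<tau>\<in>{s..t}. \<gamma> \<tau> \<in> fst c}"
  have cont: "continuous_on {s..t} \<gamma>" using \<gamma> by (simp add: C1_path_def)
  have "continuous_on E (\<lambda>\<sigma>. (snd c (\<gamma> \<sigma>), inner_velocity \<gamma> s t \<sigma> c))"
  proof (intro continuous_on_Pair)
    show "continuous_on E (\<lambda>\<sigma>. snd c (\<gamma> \<sigma>))"
      by (rule continuous_on_compose2[OF is_chartD(3)[OF c'(1)] continuous_on_subset[OF cont]]) (auto simp: E_def)
    show "continuous_on E (\<lambda>\<sigma>. inner_velocity \<gamma> s t \<sigma> c)"
      unfolding E_def by (rule C1_path_chart(2)[OF \<gamma> st c'(1)])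
  qed
  moreover have "(\<lambda>\<sigma>. (snd c (\<gamma> \<sigma>), inner_velocity \<gamma> s t \<sigma> c)) ` E \<subseteq> chart_image c \<times> UNIV"
    by (auto simp: E_def is_chartD[OF c'(1)])
  ultimately have "continuous_on E (\<lambda>\<sigma>. (\<lambda>z. N (chart_inv c (fst z)) (tangent_vec A c (chart_inv c (fst z)) (snd z)))
      (snd c (\<gamma> \<sigma>), inner_velocity \<gamma> s t \<sigma> c))"
    by (rule continuous_on_compose2[OF N_continuous_in_chart[OF c'(1)]])
  then have "continuous_on E (\<lambda>\<sigma>. N (chart_inv c (snd c (\<gamma> \<sigma>)))
      (tangent_vec A c (chart_inv c (snd c (\<gamma> \<sigma>))) (inner_velocity \<gamma> s t \<sigma> c)))"
    by simp
  then have "continuous_on E (\<lambda>\<sigma>. N (\<gamma> \<sigma>) (inner_velocity \<gamma> s t \<sigma>))"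
  proof (rule continuous_on_eq)
    fix \<sigma> assume "\<sigma> \<in> E"
    then have \<sigma>: "\<sigma> \<in> {s..t}" "\<gamma> \<sigma> \<in> fst c" by (auto simp: E_def)
    then have "c \<in> charts_at A (\<gamma> \<sigma>)" using c' by (simp add: charts_at_def)
    from inner_velocity_eq_tangent_vec[OF \<gamma> st \<sigma>(1) this]
    show "N (chart_inv c (snd c (\<gamma> \<sigma>))) (tangent_vec A c (chart_inv c (snd c (\<gamma> \<sigma>))) (inner_velocity \<gamma> s t \<sigma> c)) =
        N (\<gamma> \<sigma>) (inner_velocity \<gamma> s t \<sigma>)"
      using is_chartD(5)[OF c'(1) \<sigma>(2)] by simp
  qed
  then have lim: "((\<lambda>\<sigma>. N (\<gamma> \<sigma>) (inner_velocity \<gamma> s t \<sigma>)) \<longlongrightarrow> N (\<gamma> \<tau>) (inner_velocity \<gamma> s t \<tau>)) (at \<tau> within E)"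
    using \<tau> c' by (simp add: continuous_on_def E_def)
  \<comment> \<open>E is relatively open in {s..t}, so limits at \<tau> within E and within {s..t}
    agree.\<close>
  obtain U where U: "open U" "U \<inter> {s..t} = \<gamma> -` fst c \<inter> {s..t}"
    using cont[unfolded continuous_on_open_invariant, rule_format, OF is_chartD(1)[OF c'(1)]] by auto
  have E: "E = U \<inter> {s..t}" unfolding U(2) by (auto simp: E_def)
  have "\<tau> \<in> E" using \<tau> c' by (simp add: E_def)
  then have "at \<tau> within {s..t} = at \<tau> within E"
    by (intro at_within_nhd[of \<tau> U]) (auto simp: E U(1))
  then show "((\<lambda>\<sigma>. N (\<gamma> \<sigma>) (inner_velocity \<gamma> s t \<sigma>)) \<longlongrightarrow> N (\<gamma> \<tau>) (inner_velocity \<gamma> s t \<tau>)) (at \<tau> within {s..t})"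
    using lim by simp
qed

text \<open>The fundamental theorem of calculus for u along the path, whose derivative is bounded by
  C times the speed. It is applied to the inner velocity, which is continuous up to the end points;
  the two-sided \<open>velocity\<close> can differ from it only at s and t, so the integral is the
  same.\<close>

lemma C1_path_increment_le:
  assumes \<gamma>: "C1_path A \<gamma> s t" and st: "s < t" and u: "\<And>p. diff_bound u p C"
  shows "(\<lambda>\<tau>. N (\<gamma> \<tau>) (velocity A \<gamma> \<tau>)) integrable_on {s..t}"
    and "\<bar>u (\<gamma> t) - u (\<gamma> s)\<bar> \<le> C * integral {s..t} (\<lambda>\<tau>. N (\<gamma> \<tau>) (velocity A \<gamma> \<tau>))"
proof -
  let ?n = "\<lambda>\<tau>. N (\<gamma> \<tau>) (inner_velocity \<gamma> s t \<tau>)" and ?v = "\<lambda>\<tau>. N (\<gamma> \<tau>) (velocity A \<gamma> \<tau>)"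
  have int: "?n integrable_on {s..t}"
    by (rule integrable_continuous_real[OF inner_speed_continuous[OF \<gamma> st]])
  have eq: "?v \<tau> = ?n \<tau>" if "\<tau> \<in> {s..t} - {s, t}" for \<tau>
  proof -
    have "at \<tau> within {s..t} = at \<tau>" using that by (intro at_within_Icc_at) auto
    then show ?thesis by (simp only: velocity_def inner_velocity_def)
  qed
  show "?v integrable_on {s..t}"
    by (rule integrable_spike_finite[of "{s, t}", OF _ eq int]) auto
  have inteq: "integral {s..t} ?n = integral {s..t} ?v"
    by (rule integral_spike[of "{s, t}", OF _ eq]) auto
  have "\<exists>D. (u \<circ> \<gamma> has_vector_derivative D) (at \<tau> within {s..t}) \<and> \<bar>D\<bar> \<le> C * ?n \<tau>" if \<tau>: "\<tau> \<in> {s..t}" for \<tau>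
  proof -
    obtain c where c: "c \<in> charts_at A (\<gamma> \<tau>)" by (rule charts_at_nonempty)
    note c' = charts_atD[OF c]
    let ?w = "inner_velocity \<gamma> s t \<tau> c"
    obtain T where T: "(u \<circ> chart_inv c has_derivative T) (at (snd c (\<gamma> \<tau>)))"
      "\<And>v. \<bar>T v\<bar> \<le> C * N (\<gamma> \<tau>) (tangent_vec A c (\<gamma> \<tau>) v)"
      by (rule diff_boundE[OF u c]) (rule that)
    have "((\<lambda>\<sigma>. (u \<circ> chart_inv c) ((snd c \<circ> \<gamma>) \<sigma>)) has_derivative (\<lambda>h. T (h *\<^sub>R ?w))) (at \<tau> within {s..t})"
      by (rule has_derivative_compose[OF C1_path_chart(1)[OF \<gamma> st c'(1) \<tau> c'(2), unfolded has_vector_derivative_def]])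
        (simp only: o_apply[of "snd c" \<gamma>] T(1))
    then have "(u \<circ> \<gamma> has_derivative (\<lambda>h. T (h *\<^sub>R ?w))) (at \<tau> within {s..t})"
      by (rule has_derivative_transform_eventually)
        (use C1_path_eventually_in_chart[OF \<gamma> c'(1) \<tau> c'(2)] \<tau> in
          \<open>auto elim!: eventually_mono simp: is_chartD[OF c'(1)] c'\<close>)
    moreover have "T (h *\<^sub>R ?w) = h *\<^sub>R T ?w" for h
      by (rule linear_scale[OF has_derivative_linear[OF T(1)]])
    ultimately have "(u \<circ> \<gamma> has_vector_derivative T ?w) (at \<tau> within {s..t})"
      by (simp add: has_vector_derivative_def)
    moreover have "\<bar>T ?w\<bar> \<le> C * ?n \<tau>"
      using T(2)[of ?w] inner_velocity_eq_tangent_vec[OF \<gamma> st \<tau> c] by simp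
    ultimately show ?thesis by blast
  qed
  then obtain D where D: "\<And>\<tau>. \<tau> \<in> {s..t} \<Longrightarrow> (u \<circ> \<gamma> has_vector_derivative D \<tau>) (at \<tau> within {s..t})"
    "\<And>\<tau>. \<tau> \<in> {s..t} \<Longrightarrow> \<bar>D \<tau>\<bar> \<le> C * ?n \<tau>" by metis
  have "(D has_integral (u \<circ> \<gamma>) t - (u \<circ> \<gamma>) s) {s..t}"
    by (rule fundamental_theorem_of_calculus[OF less_imp_le[OF st] D(1)])
  then have "D integrable_on {s..t}" "u (\<gamma> t) - u (\<gamma> s) = integral {s..t} D"
    by (auto simp: has_integral_integrable integral_unique)
  moreover have "norm (integral {s..t} D) \<le> integral {s..t} (\<lambda>\<tau>. C * ?n \<tau>)"
    by (rule integral_norm_bound_integral)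
      (use \<open>D integrable_on {s..t}\<close> int D(2) in \<open>auto intro: integrable_on_mult_right\<close>)
  ultimately show "\<bar>u (\<gamma> t) - u (\<gamma> s)\<bar> \<le> C * integral {s..t} ?v" using inteq by simp
qed

lemma piecewise_C1_path_increment_le:
  assumes \<gamma>: "piecewise_C1_path A \<gamma> a b" and u: "\<And>p. diff_bound u p C"
  shows "\<bar>u (\<gamma> b) - u (\<gamma> a)\<bar> \<le> C * path_len A N \<gamma> a b"
proof -
  let ?v = "\<lambda>\<tau>. N (\<gamma> \<tau>) (velocity A \<gamma> \<tau>)"
  obtain n and \<tau> :: "nat \<Rightarrow> real" where \<tau>: "\<tau> 0 = a" "\<tau> n = b"
    "\<And>i. i < n \<Longrightarrow> \<tau> i < \<tau> (Suc i)" "\<And>i. i < n \<Longrightarrow> C1_path A \<gamma> (\<tau> i) (\<tau> (Suc i))"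
    using \<gamma> unfolding piecewise_C1_path_def by blast
  have "i \<le> n \<Longrightarrow> a \<le> \<tau> i \<and> ?v integrable_on {a..\<tau> i} \<and>
      \<bar>u (\<gamma> (\<tau> i)) - u (\<gamma> a)\<bar> \<le> C * integral {a..\<tau> i} ?v" for i
  proof (induction i)
    case 0
    then show ?case using \<tau>(1) integrable_on_refl[of ?v a] by simp
  next
    case (Suc i)
    then have IH: "a \<le> \<tau> i" "?v integrable_on {a..\<tau> i}"
      "\<bar>u (\<gamma> (\<tau> i)) - u (\<gamma> a)\<bar> \<le> C * integral {a..\<tau> i} ?v" and i: "i < n" by auto
    note st = C1_path_increment_le[OF \<tau>(4)[OF i] \<tau>(3)[OF i] u]
    have le: "\<tau> i \<le> \<tau> (Suc i)" using \<tau>(3)[OF i] by simp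
    have int: "?v integrable_on {a..\<tau> (Suc i)}"
      by (rule Henstock_Kurzweil_Integration.integrable_combine[OF IH(1) le IH(2) st(1)])
    have "integral {a..\<tau> i} ?v + integral {\<tau> i..\<tau> (Suc i)} ?v = integral {a..\<tau> (Suc i)} ?v"
      by (rule Henstock_Kurzweil_Integration.integral_combine[OF IH(1) le int])
    then have "C * integral {a..\<tau> (Suc i)} ?v = C * integral {a..\<tau> i} ?v + C * integral {\<tau> i..\<tau> (Suc i)} ?v"
      by (simp flip: distrib_left)
    then show ?case using int IH(1,3) le st(2) by auto
  qed
  from this[of n] show ?thesis using \<tau>(2) by (simp add: path_len_def)
qed

text \<open>The increment of the zero function is at most 1 times the length.\<close>

lemma path_len_nonneg:
  assumes "piecewise_C1_path A \<gamma> a b" shows "0 \<le> path_len A N \<gamma> a b"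
  using piecewise_C1_path_increment_le[OF assms diff_bound_const[of 1 0]] by simp

section \<open>The Finsler distance against differentials and chart segments\<close>

lemma finsler_dist_nonneg: "0 \<le> finsler_dist A N p q"
  unfolding finsler_dist_def by (rule Inf_greatest) (auto simp: path_len_nonneg)

lemma lipschitz_bound_of_diff_bound:
  assumes u: "\<And>p. diff_bound u p C" and C: "0 \<le> C"
  shows "lipschitz_bound (finsler_dist A N) u C"
  unfolding lipschitz_bound_def
proof (intro conjI allI impI C)
  fix p q assume fin: "finsler_dist A N p q < \<infinity>"
  then obtain r where r: "finsler_dist A N p q = ereal r"
    using finsler_dist_nonneg[of p q] by (cases "finsler_dist A N p q") auto
  have "\<bar>u p - u q\<bar> \<le> C * r"
  proof (rule field_le_epsilon)
    fix e :: real assume e: "0 < e"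
    \<comment> \<open>Dividing by C + 1 rather than C also covers C = 0.\<close>
    have e': "0 < e / (C + 1)" using e C by simp
    then have "finsler_dist A N p q < ereal (r + e / (C + 1))" by (simp add: r)
    then obtain \<gamma> a b where \<gamma>: "piecewise_C1_path A \<gamma> a b" "\<gamma> a = p" "\<gamma> b = q"
      "path_len A N \<gamma> a b < r + e / (C + 1)"
      unfolding finsler_dist_def Inf_less_iff by auto
    have "\<bar>u p - u q\<bar> \<le> C * path_len A N \<gamma> a b"
      using piecewise_C1_path_increment_le[OF \<gamma>(1) u] \<gamma> by (simp add: abs_minus_commute)
    also have "\<dots> \<le> C * (r + e / (C + 1))" using \<gamma>(4) C by (intro mult_left_mono) auto
    also have "\<dots> \<le> C * r + e"
    proof -
      have "C * (e / (C + 1)) \<le> (C + 1) * (e / (C + 1))" using e' by (intro mult_right_mono) auto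
      also have "\<dots> = e" using C by simp
      finally show ?thesis by (simp add: distrib_left)
    qed
    finally show "\<bar>u p - u q\<bar> \<le> C * r + e" .
  qed
  then show "ereal \<bar>u p - u q\<bar> \<le> ereal C * finsler_dist A N p q" by (simp add: r)
qed

text \<open>The straight segment in the chart is a path with constant coordinate velocity z - y, so
  B bounds its speed on a parameter interval of length 1.\<close>

lemma finsler_dist_segment_le:
  assumes c: "c \<in> A" and seg: "\<And>\<tau>. \<tau> \<in> {0..1} \<Longrightarrow> y + \<tau> *\<^sub>R (z - y) \<in> chart_image c"
    and B: "0 \<le> B" "\<And>p. p \<in> fst c \<Longrightarrow> N p (tangent_vec A c p (z - y)) \<le> B"
  shows "finsler_dist A N (chart_inv c y) (chart_inv c z) \<le> ereal B"
proof -
  define \<gamma> where "\<gamma> \<tau> = chart_inv c (y + \<tau> *\<^sub>R (z - y))" for \<tau> :: real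
  have in_c: "\<gamma> \<tau> \<in> fst c" "snd c (\<gamma> \<tau>) = y + \<tau> *\<^sub>R (z - y)" if "\<tau> \<in> {0..1}" for \<tau>
    using seg[OF that] by (auto simp: \<gamma>_def is_chartD[OF c])
  have cont_line: "continuous_on S (\<lambda>\<tau>. y + \<tau> *\<^sub>R (z - y))" for S by (intro continuous_intros)
  have cont: "continuous_on {0..1} \<gamma>"
    unfolding \<gamma>_def by (rule continuous_on_compose2[OF is_chartD(4)[OF c] cont_line]) (use seg in auto)
  have deriv: "(snd d \<circ> \<gamma> has_vector_derivative transition_deriv (\<gamma> \<tau>) c d (z - y)) (at \<tau> within {0..1})"
    if d: "d \<in> A" and \<tau>: "\<tau> \<in> {0..1}" "\<gamma> \<tau> \<in> fst d" for d \<tau>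
  proof -
    let ?T = "transition_deriv (\<gamma> \<tau>) c d"
    have T: "(transition c d has_derivative ?T) (at (y + \<tau> *\<^sub>R (z - y)))"
      using transition_C1(1)[OF c d in_c(1)[OF \<tau>(1)] \<tau>(2)] by (simp add: in_c(2)[OF \<tau>(1)])
    have line: "((\<lambda>\<tau>. y + \<tau> *\<^sub>R (z - y)) has_derivative (\<lambda>h. h *\<^sub>R (z - y))) (at \<tau> within {0..1})"
      by (auto intro!: derivative_eq_intros)
    have "((\<lambda>\<sigma>. transition c d (y + \<sigma> *\<^sub>R (z - y))) has_derivative (\<lambda>h. ?T (h *\<^sub>R (z - y)))) (at \<tau> within {0..1})"
      by (rule has_derivative_compose[OF line T])
    moreover have "?T (h *\<^sub>R (z - y)) = h *\<^sub>R ?T (z - y)" for h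
      by (rule linear_scale[OF has_derivative_linear[OF T]])
    ultimately show ?thesis
      by (simp add: has_vector_derivative_def transition_def \<gamma>_def o_def)
  qed
  have "C1_path A \<gamma> 0 1"
    unfolding C1_path_def
  proof (intro conjI ballI cont)
    fix d assume d: "d \<in> A"
    have "continuous_on {\<tau>\<in>{0..1}. \<gamma> \<tau> \<in> fst d} (\<lambda>\<tau>. transition_deriv (chart_inv c (y + \<tau> *\<^sub>R (z - y))) c d (z - y))"
    proof (rule continuous_on_compose2[OF transition_C1(2)[OF c d] cont_line])
      show "(\<lambda>\<tau>. y + \<tau> *\<^sub>R (z - y)) ` {\<tau>\<in>{0..1}. \<gamma> \<tau> \<in> fst d} \<subseteq> snd c ` (fst c \<inter> fst d)"
        using in_c by (force simp: image_iff)
    qed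
    then show "\<exists>\<gamma>'. continuous_on {\<tau>\<in>{0..1}. \<gamma> \<tau> \<in> fst d} \<gamma>' \<and>
        (\<forall>\<tau>\<in>{0..1}. \<gamma> \<tau> \<in> fst d \<longrightarrow> (snd d \<circ> \<gamma> has_vector_derivative \<gamma>' \<tau>) (at \<tau> within {0..1}))"
      using deriv[OF d] by (intro exI[of _ "\<lambda>\<tau>. transition_deriv (\<gamma> \<tau>) c d (z - y)"]) (simp add: \<gamma>_def)
  qed
  then have pw: "piecewise_C1_path A \<gamma> 0 1"
    unfolding piecewise_C1_path_def by (intro conjI exI[of _ 1] exI[of _ real]) auto
  have vel: "velocity A \<gamma> \<tau> = tangent_vec A c (\<gamma> \<tau>) (z - y)" if \<tau>: "\<tau> \<in> {0..1} - {0, 1}" for \<tau>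
  proof
    fix d
    have \<tau>': "\<tau> \<in> {0..1}" and at: "at \<tau> within {0..1} = at \<tau>" using \<tau> by (auto intro: at_within_Icc_at)
    show "velocity A \<gamma> \<tau> d = tangent_vec A c (\<gamma> \<tau>) (z - y) d"
      using vector_derivative_at[OF deriv[OF _ \<tau>', unfolded at]]
      by (auto simp: velocity_def tangent_vec_def charts_at_def)
  qed
  \<comment> \<open>At 0 and 1 the two-sided velocity depends on values of the path outside [0, 1],
    so these two points are overwritten by B. In the second case \<open>integral\<close> has its
    default value 0, which is at most B.\<close>
  have len: "path_len A N \<gamma> 0 1 \<le> B"
  proof (cases "(\<lambda>\<tau>. N (\<gamma> \<tau>) (velocity A \<gamma> \<tau>)) integrable_on {0..1}")
    case True
    have "integral {0..1} (\<lambda>\<tau>. N (\<gamma> \<tau>) (velocity A \<gamma> \<tau>)) =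
        integral {0..1} (\<lambda>\<tau>. if \<tau> \<in> {0, 1} then B else N (\<gamma> \<tau>) (velocity A \<gamma> \<tau>))"
      by (rule integral_spike[of "{0, 1}"]) auto
    also have "\<dots> \<le> integral {0..1} (\<lambda>_::real. B)"
    proof (rule integral_le)
      show "(\<lambda>\<tau>. if \<tau> \<in> {0, 1} then B else N (\<gamma> \<tau>) (velocity A \<gamma> \<tau>)) integrable_on {0..1}"
        by (rule integrable_spike_finite[of "{0, 1}", OF _ _ True]) auto
      show "(if \<tau> \<in> {0, 1} then B else N (\<gamma> \<tau>) (velocity A \<gamma> \<tau>)) \<le> B" if "\<tau> \<in> {0..1}" for \<tau>
        using vel[of \<tau>] B(2)[OF in_c(1)[OF that]] that by auto
    qed auto
    also have "\<dots> = B" by simp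
    finally show ?thesis by (simp add: path_len_def)
  next
    case False
    then show ?thesis using B(1) by (simp add: path_len_def not_integrable_integral)
  qed
  have "finsler_dist A N (chart_inv c y) (chart_inv c z) \<le> ereal (path_len A N \<gamma> 0 1)"
    unfolding finsler_dist_def
    by (rule Inf_lower) (use pw in \<open>force simp: \<gamma>_def\<close>)
  also have "\<dots> \<le> ereal B" using len by simp
  finally show ?thesis .
qed

end
section \<open>Local approximation\<close>

lemma lipschitz_bound_iff_real:
  assumes "\<And>p q. 0 \<le> d p q"
  shows "lipschitz_bound d u L \<longleftrightarrow> 0 \<le> L \<and> (\<forall>p q r. d p q = ereal r \<longrightarrow> \<bar>u p - u q\<bar> \<le> L * r)"
proof
  assume "lipschitz_bound d u L"
  then have L: "0 \<le> L" and *: "\<And>p q. d p q < \<infinity> \<Longrightarrow> ereal \<bar>u p - u q\<bar> \<le> ereal L * d p q"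
    by (auto simp: lipschitz_bound_def)
  have "\<bar>u p - u q\<bar> \<le> L * r" if "d p q = ereal r" for p q r
    using *[of p q] that by simp
  then show "0 \<le> L \<and> (\<forall>p q r. d p q = ereal r \<longrightarrow> \<bar>u p - u q\<bar> \<le> L * r)" using L by blast
next
  assume *: "0 \<le> L \<and> (\<forall>p q r. d p q = ereal r \<longrightarrow> \<bar>u p - u q\<bar> \<le> L * r)"
  have "ereal \<bar>u p - u q\<bar> \<le> ereal L * d p q" if fin: "d p q < \<infinity>" for p q
  proof -
    obtain r where "d p q = ereal r" using fin assms[of p q] by (cases "d p q") auto
    then show ?thesis using * by simp
  qed
  then show "lipschitz_bound d u L" using * by (auto simp: lipschitz_bound_def)
qed

lemma lipschitz_bound_SUP:
  assumes d: "\<And>p q. 0 \<le> d p q" and L: "0 \<le> L" and F: "F \<noteq> {}"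
    and u: "\<And>u. u \<in> F \<Longrightarrow> lipschitz_bound d u L" "\<And>u p. u \<in> F \<Longrightarrow> 0 \<le> u p \<and> u p \<le> (1::real)"
  shows "lipschitz_bound d (\<lambda>p. SUP u\<in>F. u p) L" "0 \<le> (SUP u\<in>F. u p) \<and> (SUP u\<in>F. u p) \<le> 1"
proof -
  have bdd: "bdd_above ((\<lambda>u. u p) ` F)" for p using u(2) by (auto intro!: bdd_aboveI[of _ 1])
  obtain u0 where u0: "u0 \<in> F" using F by blast
  show "0 \<le> (SUP u\<in>F. u p) \<and> (SUP u\<in>F. u p) \<le> 1"
    using u(2) cSUP_upper[OF u0 bdd, of p] u(2)[OF u0, of p] by (auto intro: cSUP_least[OF F])
  have le: "(SUP u\<in>F. u p) \<le> (SUP u\<in>F. u q) + s" if "\<And>u. u \<in> F \<Longrightarrow> \<bar>u p - u q\<bar> \<le> s" for p q s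
  proof (rule cSUP_least[OF F])
    fix u assume uF: "u \<in> F"
    show "u p \<le> (SUP u\<in>F. u q) + s"
      using cSUP_upper[OF uF bdd, of q] that[OF uF] by linarith
  qed
  show "lipschitz_bound d (\<lambda>p. SUP u\<in>F. u p) L"
    unfolding lipschitz_bound_iff_real[OF d]
  proof (intro conjI L allI impI)
    fix p q r assume r: "d p q = ereal r"
    have *: "\<bar>u p - u q\<bar> \<le> L * r" if "u \<in> F" for u
      using u(1)[OF that] r unfolding lipschitz_bound_iff_real[OF d] by blast
    then have "\<bar>u q - u p\<bar> \<le> L * r" if "u \<in> F" for u
      using that by (simp add: abs_minus_commute)
    from le[of q p, OF this] le[of p q, OF *]
    show "\<bar>(SUP u\<in>F. u p) - (SUP u\<in>F. u q)\<bar> \<le> L * r" by (simp add: abs_le_iff)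
  qed
qed

lemma equivalent_normD:
  assumes "equivalent_norm \<nu>"
  shows "\<nu> (x + y) \<le> \<nu> x + \<nu> y" "\<nu> (r *\<^sub>R x) = \<bar>r\<bar> * \<nu> x" "0 \<le> \<nu> x" "\<nu> 0 = 0" "\<nu> (x - y) = \<nu> (y - x)"
    "\<nu> (x - z) \<le> \<nu> (x - y) + \<nu> (y - z)"
proof -
  have t: "\<nu> (x + y) \<le> \<nu> x + \<nu> y" and s: "\<nu> (r *\<^sub>R x) = \<bar>r\<bar> * \<nu> x" for x y r
    using assms by (auto simp: equivalent_norm_def)
  show "\<nu> (x + y) \<le> \<nu> x + \<nu> y" "\<nu> (r *\<^sub>R x) = \<bar>r\<bar> * \<nu> x" by (rule t, rule s)
  show "\<nu> 0 = 0" using s[of 0 0] by simp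
  show "\<nu> (x - y) = \<nu> (y - x)" using s[of "-1" "x - y"] by simp
  show "\<nu> (x - z) \<le> \<nu> (x - y) + \<nu> (y - z)" using t[of "x - y" "y - z"] by simp
  obtain a where "0 < a" "a * norm x \<le> \<nu> x" using assms unfolding equivalent_norm_def by blast
  then show "0 \<le> \<nu> x" by (meson less_imp_le mult_nonneg_nonneg norm_ge_zero order_trans)
qed

text \<open>The classical infimum formula. The domain is parametrized by \<phi>, so a function on
  the manifold is extended directly in terms of its chart coordinates.\<close>

lemma McShane_extension:
  fixes \<phi> :: "'i \<Rightarrow> 'x::real_normed_vector"
  assumes \<nu>: "equivalent_norm \<nu>" and L: "0 \<le> L" and I: "I \<noteq> {}"
    and u: "\<And>p q. p \<in> I \<Longrightarrow> q \<in> I \<Longrightarrow> \<bar>u p - u q\<bar> \<le> L * \<nu> (\<phi> p - \<phi> q)"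
  obtains F where "\<And>p. p \<in> I \<Longrightarrow> F (\<phi> p) = u p" "\<And>y z. \<bar>F y - F z\<bar> \<le> L * \<nu> (y - z)"
proof -
  define F where "F y = (INF q\<in>I. u q + L * \<nu> (y - \<phi> q))" for y
  obtain x where x: "x \<in> I" using I by blast
  have "u x - L * \<nu> (\<phi> x - y) \<le> u q + L * \<nu> (y - \<phi> q)" if "q \<in> I" for y q
  proof -
    have "L * \<nu> (\<phi> x - \<phi> q) \<le> L * (\<nu> (\<phi> x - y) + \<nu> (y - \<phi> q))"
      by (rule mult_left_mono[OF equivalent_normD(6)[OF \<nu>] L])
    then show ?thesis using u[OF x that] by (simp add: distrib_left)
  qed
  then have bdd: "bdd_below ((\<lambda>q. u q + L * \<nu> (y - \<phi> q)) ` I)" for y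
    by (intro bdd_belowI[of _ "u x - L * \<nu> (\<phi> x - y)"]) auto
  have le: "F y \<le> F z + L * \<nu> (y - z)" for y z
  proof -
    have "F y - L * \<nu> (y - z) \<le> F z"
      unfolding F_def[of z]
    proof (rule cINF_greatest[OF I])
      fix q assume q: "q \<in> I"
      have "L * \<nu> (y - \<phi> q) \<le> L * (\<nu> (y - z) + \<nu> (z - \<phi> q))"
        by (rule mult_left_mono[OF equivalent_normD(6)[OF \<nu>] L])
      moreover have "F y \<le> u q + L * \<nu> (y - \<phi> q)" unfolding F_def by (rule cINF_lower[OF bdd q])
      ultimately show "F y - L * \<nu> (y - z) \<le> u q + L * \<nu> (z - \<phi> q)" by (simp add: distrib_left)
    qed
    then show ?thesis by simp
  qed
  show ?thesis
  proof (rule that)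
    fix p assume p: "p \<in> I"
    have "F (\<phi> p) \<le> u p + L * \<nu> (\<phi> p - \<phi> p)" unfolding F_def by (rule cINF_lower[OF bdd p])
    moreover have "u p \<le> F (\<phi> p)" unfolding F_def
    proof (rule cINF_greatest[OF I])
      show "u p \<le> u q + L * \<nu> (\<phi> p - \<phi> q)" if "q \<in> I" for q using u[OF p that] by linarith
    qed
    ultimately show "F (\<phi> p) = u p" by (simp add: equivalent_normD(4)[OF \<nu>])
  next
    show "\<bar>F y - F z\<bar> \<le> L * \<nu> (y - z)" for y z
      using le[of y z] le[of z y] equivalent_normD(5)[OF \<nu>, of y z] by (simp add: abs_le_iff)
  qed
qed

text \<open>Difference quotients along the line y + t v are at most M \<nu> v in absolute value,
  because \<nu> is homogeneous; the bound survives t \<rightarrow> 0.\<close>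

lemma has_derivative_le_of_lipschitz:
  fixes h :: "'x::real_normed_vector \<Rightarrow> real"
  assumes T: "(h has_derivative T) (at y)" and h: "\<And>z. \<bar>h z - h y\<bar> \<le> M * \<nu> (z - y)"
    and \<nu>: "\<And>r. \<nu> (r *\<^sub>R v) = \<bar>r\<bar> * \<nu> v"
  shows "\<bar>T v\<bar> \<le> M * \<nu> v"
proof -
  have "((\<lambda>t. h (y + t *\<^sub>R v)) has_derivative (\<lambda>t. T (t *\<^sub>R v))) (at 0)"
    by (rule has_derivative_compose[of "\<lambda>t. y + t *\<^sub>R v" "\<lambda>t. t *\<^sub>R v"])
      (use T in \<open>auto intro!: derivative_eq_intros\<close>)
  then have "((\<lambda>t. h (y + t *\<^sub>R v)) has_real_derivative T v) (at 0)"
    unfolding has_field_derivative_def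
    by (rule has_derivative_eq_rhs) (auto simp: linear_scale[OF has_derivative_linear[OF T]])
  then have "((\<lambda>t. (h (y + t *\<^sub>R v) - h y) / t) \<longlongrightarrow> T v) (at 0)"
    by (simp add: DERIV_def)
  then have "((\<lambda>t. \<bar>(h (y + t *\<^sub>R v) - h y) / t\<bar>) \<longlongrightarrow> \<bar>T v\<bar>) (at 0)"
    by (rule tendsto_rabs)
  moreover have "eventually (\<lambda>t. \<bar>(h (y + t *\<^sub>R v) - h y) / t\<bar> \<le> M * \<nu> v) (at 0)"
  proof -
    have "\<bar>(h (y + t *\<^sub>R v) - h y) / t\<bar> \<le> M * \<nu> v" if "t \<noteq> 0" for t
      using h[of "y + t *\<^sub>R v"] that by (simp add: \<nu> divide_le_eq mult_ac)
    then show ?thesis by (simp add: eventually_at_filter)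
  qed
  ultimately show ?thesis by (rule tendsto_upperbound) simp
qed

locale star_finsler = weak_uniform_finsler A N l K
  for A :: "('m::topological_space, 'x::banach) chart set"
    and N :: "'m \<Rightarrow> ('m, 'x) tangent \<Rightarrow> real" and l :: enat and K :: real +
  fixes k :: enat and C0 :: real
  assumes k: "1 \<le> k" and C0: "1 \<le> C0"
    and star: "\<And>\<nu> :: 'x \<Rightarrow> real. equivalent_norm \<nu> \<Longrightarrow> property_star k \<nu> C0"
begin

section \<open>Chart balls\<close>

definition chart_norm :: "'m \<Rightarrow> ('m, 'x) chart \<Rightarrow> 'x \<Rightarrow> real" where
  "chart_norm x c v = N x (tangent_vec A c x v)"

text \<open>The two inequalities are weak uniformity at x with the divisions cleared. The ball
  singles out a convex piece of the chart image, in which straight segments remain.\<close>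

definition good_ball :: "'m \<Rightarrow> ('m, 'x) chart \<Rightarrow> real \<Rightarrow> bool" where
  "good_ball x c r \<longleftrightarrow> c \<in> charts_at A x \<and> 0 < r \<and> ball (snd c x) r \<subseteq> chart_image c \<and>
     (\<forall>p\<in>fst c. \<forall>v. chart_norm x c v \<le> K * N p (tangent_vec A c p v) \<and>
        N p (tangent_vec A c p v) \<le> K * chart_norm x c v)"

definition chart_ball :: "'m \<Rightarrow> ('m, 'x) chart \<Rightarrow> real \<Rightarrow> 'm set" where
  "chart_ball x c r = {q \<in> fst c. snd c q \<in> ball (snd c x) r}"

lemma equivalent_chart_norm: "c \<in> charts_at A x \<Longrightarrow> equivalent_norm (chart_norm x c)"
  using finsler unfolding chart_norm_def
  by (auto simp: weak_uniform_finsler_manifold_def finsler_P1_def)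

lemma good_ballD:
  assumes "good_ball x c r"
  shows "c \<in> A" "x \<in> fst c" "c \<in> charts_at A x" "0 < r" "ball (snd c x) r \<subseteq> chart_image c"
    "p \<in> fst c \<Longrightarrow> chart_norm x c v \<le> K * N p (tangent_vec A c p v)"
    "p \<in> fst c \<Longrightarrow> N p (tangent_vec A c p v) \<le> K * chart_norm x c v"
    "equivalent_norm (chart_norm x c)"
  using assms by (auto simp: good_ball_def charts_at_def intro: equivalent_chart_norm)

lemma chart_ball_open: "good_ball x c r \<Longrightarrow> open (chart_ball x c r)"
  unfolding chart_ball_def by (intro open_chart_preimage good_ballD) auto

lemma center_in_chart_ball: "good_ball x c r \<Longrightarrow> x \<in> chart_ball x c r"
  by (auto simp: chart_ball_def dest: good_ballD)

lemma chart_ball_charts_at: "good_ball x c r \<Longrightarrow> p \<in> chart_ball x c r \<Longrightarrow> c \<in> charts_at A p"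
  by (auto simp: chart_ball_def charts_at_def dest: good_ballD)

lemma good_ball_exists:
  assumes "open W" "x \<in> W"
  obtains c r where "good_ball x c r" "chart_ball x c r \<subseteq> W"
proof -
  have "weak_uniform K A N" using finsler by (simp add: weak_uniform_finsler_manifold_def)
  then obtain c where c: "c \<in> charts_at A x" and wu: "\<And>p v. p \<in> fst c \<Longrightarrow>
      1 / K * N x (tangent_vec A c x v) \<le> N p (tangent_vec A c p v) \<and>
      N p (tangent_vec A c p v) \<le> K * N x (tangent_vec A c x v)"
    unfolding weak_uniform_def by blast
  note c' = charts_atD[OF c]
  have "open {y \<in> chart_image c. chart_inv c y \<in> W}"
    by (rule open_chart_inv_preimage[OF c'(1) assms(1)])
  moreover have "snd c x \<in> {y \<in> chart_image c. chart_inv c y \<in> W}"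
    using assms(2) c' by (simp add: is_chartD[OF c'(1)])
  ultimately obtain r where r: "0 < r" "ball (snd c x) r \<subseteq> {y \<in> chart_image c. chart_inv c y \<in> W}"
    by (rule openE)
  have "chart_norm x c v \<le> K * N p (tangent_vec A c p v)" if "p \<in> fst c" for p v
    using wu[OF that, of v] K by (simp add: chart_norm_def field_simps)
  then have "good_ball x c r"
    using c r wu by (auto simp: good_ball_def chart_norm_def)
  moreover have "chart_ball x c r \<subseteq> W"
  proof
    fix q assume "q \<in> chart_ball x c r"
    then have q: "q \<in> fst c" "snd c q \<in> ball (snd c x) r" by (auto simp: chart_ball_def)
    from subsetD[OF r(2) q(2)] show "q \<in> W" using is_chartD(5)[OF c'(1) q(1)] by simp
  qed
  ultimately show ?thesis by (rule that)
qed

abbreviation "d \<equiv> finsler_dist A N"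

lemma lipschitz_in_chart_ball:
  assumes g: "good_ball x c r" and u: "lipschitz_bound d u L"
    and p: "p \<in> chart_ball x c r" and q: "q \<in> chart_ball x c r"
  shows "\<bar>u p - u q\<bar> \<le> (L * K) * chart_norm x c (snd c p - snd c q)"
proof -
  note c = good_ballD[OF g]
  let ?y = "snd c p" and ?z = "snd c q"
  have pq: "p \<in> fst c" "q \<in> fst c" "?y \<in> ball (snd c x) r" "?z \<in> ball (snd c x) r"
    using p q by (auto simp: chart_ball_def)
  have L: "0 \<le> L" using u by (simp add: lipschitz_bound_def)
  let ?B = "K * chart_norm x c (?z - ?y)"
  have "d (chart_inv c ?y) (chart_inv c ?z) \<le> ereal ?B"
  proof (rule finsler_dist_segment_le[OF c(1)])
    fix \<tau> :: real assume "\<tau> \<in> {0..1}"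
    then have "?y + \<tau> *\<^sub>R (?z - ?y) \<in> closed_segment ?y ?z"
      by (auto simp: closed_segment_def algebra_simps intro!: exI[of _ \<tau>])
    moreover have "closed_segment ?y ?z \<subseteq> ball (snd c x) r"
      by (rule closed_segment_subset[OF pq(3,4) convex_ball])
    ultimately show "?y + \<tau> *\<^sub>R (?z - ?y) \<in> chart_image c" using c(5) by blast
  next
    show "0 \<le> ?B" using K equivalent_normD(3)[OF c(8)] by simp
  next
    show "N p' (tangent_vec A c p' (?z - ?y)) \<le> ?B" if "p' \<in> fst c" for p' by (rule c(7)[OF that])
  qed
  then have le: "d p q \<le> ereal ?B" using pq by (simp add: is_chartD[OF c(1)])
  then obtain s where s: "d p q = ereal s" "s \<le> ?B"
    using finsler_dist_nonneg[of p q] by (cases "d p q") auto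
  have "\<bar>u p - u q\<bar> \<le> L * s"
    using u s(1) unfolding lipschitz_bound_iff_real[OF finsler_dist_nonneg] by blast
  also have "\<dots> \<le> L * ?B" by (rule mult_left_mono[OF s(2) L])
  finally show ?thesis using equivalent_normD(5)[OF c(8), of ?z ?y] by (simp add: mult.assoc)
qed

text \<open>Links \<open>d\<close> with the topology of M: conditions on Lipschitz functions, in
  particular on the \<open>w n x\<close> below, describe open sets.\<close>

lemma lipschitz_continuous:
  assumes u: "lipschitz_bound d u L"
  shows "continuous_on UNIV u"
  unfolding continuous_on_def
proof
  fix x
  obtain c r where g: "good_ball x c r" using good_ball_exists[OF open_UNIV UNIV_I] by blast
  note c = good_ballD[OF g]
  obtain b where b: "0 < b" "\<And>v. chart_norm x c v \<le> b * norm v"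
    using c(8) unfolding equivalent_norm_def by blast
  have L: "0 \<le> L" using u by (simp add: lipschitz_bound_def)
  define M where "M = L * K * b + 1"
  have M: "0 < M" "L * K * b \<le> M" using L K b by (auto simp: M_def intro: add_nonneg_pos)
  show "(u \<longlongrightarrow> u x) (at x)"
  proof (rule tendstoI)
    fix e :: real assume e: "0 < e"
    define W where "W = chart_ball x c r \<inter> {p \<in> fst c. snd c p \<in> ball (snd c x) (e / M)}"
    have "open W" unfolding W_def
      by (intro open_Int chart_ball_open[OF g] open_chart_preimage[OF c(1)] open_ball)
    moreover have "x \<in> W" using center_in_chart_ball[OF g] c e M by (simp add: W_def)
    moreover have "dist (u p) (u x) < e" if "p \<in> W" for p
    proof -
      have "\<bar>u p - u x\<bar> \<le> (L * K) * chart_norm x c (snd c p - snd c x)"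
        by (rule lipschitz_in_chart_ball[OF g u]) (use that center_in_chart_ball[OF g] in \<open>auto simp: W_def\<close>)
      also have "\<dots> \<le> (L * K) * (b * norm (snd c p - snd c x))"
        using L K by (intro mult_left_mono b) auto
      also have "\<dots> = (L * K * b) * norm (snd c p - snd c x)" by simp
      also have "\<dots> \<le> M * norm (snd c p - snd c x)" using M by (intro mult_right_mono) auto
      also have "\<dots> < M * (e / M)"
        using that M by (intro mult_strict_left_mono) (auto simp: W_def dist_norm norm_minus_commute)
      finally show ?thesis using M by (simp add: dist_real_def)
    qed
    ultimately show "eventually (\<lambda>p. dist (u p) (u x) < e) (at x)"
      unfolding eventually_at_topological by blast
  qed
qed

text \<open>The property of X is applied to the norm of the tangent space at x, and \<open>L\<close>
  is a Lipschitz constant for that norm. The factor K arises when the differential at p is measured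
  in the norm at p instead. The extension and its smoothing live on all of X, but they say something
  about u only over the ball.\<close>

lemma local_smooth_approximation:
  assumes g: "good_ball x c r" and L: "0 \<le> L" and e: "0 < e"
    and u: "\<And>p q. p \<in> chart_ball x c r \<Longrightarrow> q \<in> chart_ball x c r \<Longrightarrow>
      \<bar>u p - u q\<bar> \<le> L * chart_norm x c (snd c p - snd c q)"
  obtains h where "\<And>p. p \<in> chart_ball x c r \<Longrightarrow> \<bar>h p - u p\<bar> < e"
    "\<And>p. p \<in> chart_ball x c r \<Longrightarrow> diff_bound h p (C0 * K * L)"
    "\<And>p. p \<in> chart_ball x c r \<Longrightarrow> smooth_near (min l k) h p"
proof -
  note c = good_ballD[OF g]
  define \<nu> where "\<nu> = chart_norm x c"
  have \<nu>: "equivalent_norm \<nu>" unfolding \<nu>_def by (rule c(8))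
  let ?d = "\<lambda>y z. ereal (\<nu> (y - z))"
  have d0: "0 \<le> ?d y z" for y z using equivalent_normD(3)[OF \<nu>] by simp
  obtain F where F: "\<And>p. p \<in> chart_ball x c r \<Longrightarrow> F (snd c p) = u p"
    "\<And>y z. \<bar>F y - F z\<bar> \<le> L * \<nu> (y - z)"
    using McShane_extension[OF \<nu> L, of "chart_ball x c r" u "snd c"] u center_in_chart_ball[OF g]
    unfolding \<nu>_def by blast
  have LF: "lipschitz_bound ?d F L"
    unfolding lipschitz_bound_iff_real[OF d0] using F(2) L by auto
  then have FF: "lipschitz_fun ?d F" by (auto simp: lipschitz_fun_def)
  from star[OF \<nu>, unfolded property_star_def Let_def, rule_format, OF FF e]
  obtain h where h: "lipschitz_fun ?d h" "smooth_map_on k UNIV h" "\<And>y. \<bar>F y - h y\<bar> < e"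
    "Lip ?d h \<le> C0 * Lip ?d F" by blast
  have "Lip ?d h \<le> C0 * L"
    using h(4) mult_left_mono[OF lipschitz_bound_Lip(2)[OF FF d0 LF], of C0] C0 by linarith
  moreover have "lipschitz_bound ?d h (Lip ?d h)" by (rule lipschitz_bound_Lip(1)[OF h(1) d0])
  ultimately have hL: "\<bar>h y - h z\<bar> \<le> C0 * L * \<nu> (y - z)" for y z
    unfolding lipschitz_bound_iff_real[OF d0]
    using mult_right_mono[OF _ equivalent_normD(3)[OF \<nu>, of "y - z"], of "Lip ?d h" "C0 * L"]
    by (auto intro: order_trans)
  obtain D where D: "\<And>y. y \<in> UNIV \<Longrightarrow> (h has_derivative D y) (at y)"
    by (rule smooth_map_on_C1[OF h(2) k]) (rule that)
  show ?thesis
  proof (rule that[of "\<lambda>p. h (snd c p)"])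
    fix p assume p: "p \<in> chart_ball x c r"
    then have pc: "p \<in> fst c" by (simp add: chart_ball_def)
    have cp: "c \<in> charts_at A p" by (rule chart_ball_charts_at[OF g p])
    show "\<bar>h (snd c p) - u p\<bar> < e"
      using h(3)[of "snd c p"] F(1)[OF p] by (simp add: abs_minus_commute)
    show "smooth_near (min l k) (\<lambda>p. h (snd c p)) p"
      by (rule smooth_near_compose_chart[OF cp smooth_map_on_le[OF h(2)]]) simp
    show "diff_bound (\<lambda>p. h (snd c p)) p (C0 * K * L)"
    proof (rule diff_boundI[OF cp])
      show "((\<lambda>p. h (snd c p)) \<circ> chart_inv c has_derivative D (snd c p)) (at (snd c p))"
        by (rule has_derivative_transform_within_open[OF D[OF UNIV_I] is_chartD(2)[OF c(1)]])
          (use pc in \<open>auto simp: is_chartD[OF c(1)]\<close>)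
      fix v
      have "\<bar>D (snd c p) v\<bar> \<le> (C0 * L) * \<nu> v"
        by (rule has_derivative_le_of_lipschitz[OF D[OF UNIV_I] hL equivalent_normD(2)[OF \<nu>]])
      also have "\<dots> \<le> (C0 * L) * (K * N p (tangent_vec A c p v))"
        using C0 L c(6)[OF pc] by (intro mult_left_mono) (auto simp: \<nu>_def)
      finally show "\<bar>D (snd c p) v\<bar> \<le> C0 * K * L * N p (tangent_vec A c p v)"
        by (simp add: mult_ac)
    qed
  qed
qed

text \<open>Cut off a smoothing of the chart distance \<open>w\<close> from x. The preimage of a
  smaller coordinate ball could accumulate at points of M outside the chart, where extension by 0
  would fail to be differentiable. Regularity prevents this: the function is 0 off V, and points off
  the chart ball have the neighbourhood \<open>- closure V\<close>. A differential bound then gives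
  a Lipschitz bound, rescaled to 1.\<close>

lemma bump_exists:
  assumes g: "good_ball x c r"
  obtains u where "lipschitz_bound d u 1" "\<And>p. 0 \<le> u p \<and> u p \<le> 1"
    "\<And>p. p \<notin> chart_ball x c r \<Longrightarrow> u p = 0" "0 < u x"
proof -
  note c = good_ballD[OF g]
  define \<nu> where "\<nu> = chart_norm x c"
  have \<nu>: "equivalent_norm \<nu>" unfolding \<nu>_def by (rule c(8))
  obtain a where a: "0 < a" "\<And>v. a * norm v \<le> \<nu> v" using \<nu> unfolding equivalent_norm_def by blast
  have "paracompact_topology (euclidean :: 'm topology)"
    using finsler by (simp add: weak_uniform_finsler_manifold_def)
  then obtain V where V: "open V" "x \<in> V" "closure V \<subseteq> chart_ball x c r"
    by (rule paracompact_regular[OF _ chart_ball_open[OF g] center_in_chart_ball[OF g]])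
  have "open {y \<in> chart_image c. chart_inv c y \<in> V}"
    by (rule open_chart_inv_preimage[OF c(1) V(1)])
  moreover have "snd c x \<in> {y \<in> chart_image c. chart_inv c y \<in> V}"
    using V(2) c(2) by (simp add: is_chartD[OF c(1)])
  ultimately obtain \<rho> where \<rho>: "0 < \<rho>" "ball (snd c x) \<rho> \<subseteq> {y \<in> chart_image c. chart_inv c y \<in> V}"
    by (rule openE)
  define s where "s = a * \<rho>"
  have s: "0 < s" using a \<rho> by (simp add: s_def)
  define w where "w p = \<nu> (snd c p - snd c x)" for p
  have far: "s \<le> w p" if "p \<in> fst c" "p \<notin> V" for p
  proof -
    have "snd c p \<notin> ball (snd c x) \<rho>" using \<rho>(2) that is_chartD(5)[OF c(1) that(1)] by fastforce
    then have "\<rho> \<le> norm (snd c p - snd c x)" by (simp add: dist_norm norm_minus_commute)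
    then have "s \<le> a * norm (snd c p - snd c x)" using a by (simp add: s_def)
    also have "\<dots> \<le> w p" unfolding w_def by (rule a(2))
    finally show ?thesis .
  qed
  have wlip: "\<bar>w p - w q\<bar> \<le> 1 * chart_norm x c (snd c p - snd c q)" for p q
    using equivalent_normD(6)[OF \<nu>, of "snd c p" "snd c x" "snd c q"]
      equivalent_normD(6)[OF \<nu>, of "snd c q" "snd c x" "snd c p"]
      equivalent_normD(5)[OF \<nu>, of "snd c p" "snd c q"]
    by (simp add: w_def \<nu>_def[symmetric] abs_le_iff)
  have s4: "0 < s / 4" using s by simp
  obtain h where h: "\<And>p. p \<in> chart_ball x c r \<Longrightarrow> \<bar>h p - w p\<bar> < s / 4"
    "\<And>p. p \<in> chart_ball x c r \<Longrightarrow> diff_bound h p (C0 * K * 1)"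
    "\<And>p. p \<in> chart_ball x c r \<Longrightarrow> smooth_near (min l k) h p"
    by (rule local_smooth_approximation[OF g zero_le_one s4 wlip]) (rule that)
  from smooth_cutoff obtain \<theta> :: "real \<Rightarrow> real" and \<theta>' B where
    \<theta>_cases: "\<forall>t\<le>0. \<theta> t = 0" "\<forall>t\<ge>1. \<theta> t = 1"
    and \<theta>_range: "\<forall>t. 0 \<le> \<theta> t \<and> \<theta> t \<le> 1"
    and \<theta>_deriv: "\<forall>t. (\<theta> has_real_derivative \<theta>' t) (at t) \<and> \<bar>\<theta>' t\<bar> \<le> B"
    by (elim exE conjE) (rule that)
  have \<theta>d: "(\<theta> has_real_derivative \<theta>' t) (at t)" and \<theta>B: "\<bar>\<theta>' t\<bar> \<le> B" for t
    using \<theta>_deriv by auto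
  \<comment> \<open>Equal to 1 up to s / 4 and to 0 from 3 s / 4 on. With smoothing error s / 4
    these ranges are reached at x, where w = 0, and off V, where w \<ge> s.\<close>
  define \<eta> where "\<eta> y = \<theta> (3 / 2 - y * (2 / s))" for y
  have \<eta>0: "\<eta> y = 0" if "3 * s / 4 \<le> y" for y
    unfolding \<eta>_def by (rule \<theta>_cases(1)[rule_format]) (use that s in \<open>simp add: field_simps\<close>)
  have \<eta>1: "\<eta> y = 1" if "y \<le> s / 4" for y
    unfolding \<eta>_def by (rule \<theta>_cases(2)[rule_format]) (use that s in \<open>simp add: field_simps\<close>)
  have \<eta>d: "(\<eta> has_real_derivative \<theta>' (3 / 2 - y * (2 / s)) * (- (2 / s))) (at y)" for y
    unfolding \<eta>_def[abs_def] by (rule DERIV_chain2[OF \<theta>d]) (use s in \<open>auto intro!: derivative_eq_intros\<close>)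
  define \<zeta> where "\<zeta> p = (if p \<in> chart_ball x c r then \<eta> (h p) else 0)" for p
  have B0: "0 \<le> B" using \<theta>B[of 0] by linarith
  define M where "M = B * (2 / s) * (C0 * K * 1)"
  have M: "0 \<le> M" unfolding M_def using B0 s C0 K by simp
  have \<zeta>d: "diff_bound \<zeta> p M" for p
  proof (cases "p \<in> chart_ball x c r")
    case True
    have "diff_bound (\<lambda>q. \<eta> (h q)) p (\<bar>\<theta>' (3 / 2 - h p * (2 / s)) * (- (2 / s))\<bar> * (C0 * K * 1))"
      by (rule diff_bound_real_compose[OF h(2)[OF True] \<eta>d])
    moreover have "\<bar>\<theta>' (3 / 2 - h p * (2 / s)) * (- (2 / s))\<bar> * (C0 * K * 1) \<le> M"
      unfolding M_def abs_mult using \<theta>B s C0 K B0 by (intro mult_mono) auto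
    ultimately have "diff_bound (\<lambda>q. \<eta> (h q)) p M" by (rule diff_bound_mono)
    then show ?thesis
      by (rule diff_bound_local[OF _ chart_ball_open[OF g] True]) (simp add: \<zeta>_def)
  next
    case False
    show ?thesis
    proof (rule diff_bound_local[OF diff_bound_const[OF M, of 0]])
      show "open (- closure V)" "p \<in> - closure V" using False V(3) by auto
      fix q assume "q \<in> - closure V"
      then have q: "q \<notin> V" using closure_subset by blast
      show "0 = \<zeta> q"
      proof (cases "q \<in> chart_ball x c r")
        case True
        then have "q \<in> fst c" by (simp add: chart_ball_def)
        from far[OF this q] h(1)[OF True] have "3 * s / 4 \<le> h q" by linarith
        then show ?thesis by (simp add: \<zeta>_def \<eta>0)
      qed (simp add: \<zeta>_def)
    qed
  qed
  \<comment> \<open>Scaling to Lipschitz constant 1; the summand 1 covers M = 0 and keeps the values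
    in [0, 1].\<close>
  define \<sigma> where "\<sigma> = 1 / (M + 1)"
  have \<sigma>: "0 < \<sigma>" "\<sigma> \<le> 1" "\<sigma> * M \<le> 1" unfolding \<sigma>_def using M by (auto simp: field_simps)
  have \<zeta>01: "0 \<le> \<zeta> p" "\<zeta> p \<le> 1" for p using \<theta>_range by (auto simp: \<zeta>_def \<eta>_def)
  show ?thesis
  proof (rule that[of "\<lambda>p. \<sigma> * \<zeta> p"])
    have "diff_bound (\<lambda>q. \<sigma> * \<zeta> q) p 1" for p
    proof (rule diff_bound_mono[OF diff_bound_real_compose[OF \<zeta>d, of "\<lambda>y. \<sigma> * y" \<sigma>]])
      show "((*) \<sigma> has_real_derivative \<sigma>) (at (\<zeta> p))" by (auto intro!: derivative_eq_intros)
      show "\<bar>\<sigma>\<bar> * M \<le> 1" using \<sigma> by simp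
    qed
    then show "lipschitz_bound d (\<lambda>p. \<sigma> * \<zeta> p) 1" by (rule lipschitz_bound_of_diff_bound) simp
    show "0 \<le> \<sigma> * \<zeta> p \<and> \<sigma> * \<zeta> p \<le> 1" for p
      using \<sigma> \<zeta>01[of p] by (auto intro: mult_le_one)
    show "\<sigma> * \<zeta> p = 0" if "p \<notin> chart_ball x c r" for p using that by (simp add: \<zeta>_def)
    have "w x = 0" by (simp add: w_def equivalent_normD(4)[OF \<nu>])
    then have "\<zeta> x = 1"
      using h(1)[OF center_in_chart_ball[OF g]] center_in_chart_ball[OF g] by (simp add: \<zeta>_def \<eta>1)
    then show "0 < \<sigma> * \<zeta> x" using \<sigma> by simp
  qed
qed

end
section \<open>A countable partition of unity\<close>

lemma (in weak_uniform_finsler) smooth_near_real_compose: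
  assumes \<theta>: "smooth_map_on m UNIV \<theta>" and g: "smooth_near m g p"
  shows "smooth_near m (\<lambda>q. \<theta> (g q)) p"
proof -
  obtain c V where c: "c \<in> charts_at A p" and V: "snd c p \<in> V" "V \<subseteq> chart_image c"
    "smooth_map_on m V (g \<circ> chart_inv c)" using g unfolding smooth_near_def by auto
  have "smooth_map_on m V ((\<lambda>q. \<theta> (g q)) \<circ> chart_inv c)"
    using smooth_map_on_compose[OF \<theta> V(3)] by (simp add: o_def)
  then show ?thesis using c V unfolding smooth_near_def by blast
qed

text \<open>One ball per point, so that M itself indexes the cover. The balls remain a parameter,
  because \<open>smooth_lipschitz_approximation\<close> takes them small enough to control
  \<epsilon>.\<close>

locale finsler_cover = star_finsler A N l K k C0
  for A :: "('m::topological_space, 'x::banach) chart set"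
    and N :: "'m \<Rightarrow> ('m, 'x) tangent \<Rightarrow> real" and l :: enat and K :: real
    and k :: enat and C0 :: real +
  fixes c :: "'m \<Rightarrow> ('m, 'x) chart" and r :: "'m \<Rightarrow> real"
  assumes good: "\<And>x. good_ball x (c x) (r x)"
begin

definition V :: "'m \<Rightarrow> 'm set" where
  "V x = chart_ball x (c x) (r x)"

definition bumps :: "'m \<Rightarrow> ('m \<Rightarrow> real) set" where
  "bumps x = {u. lipschitz_bound d u 1 \<and> (\<forall>p. 0 \<le> u p \<and> u p \<le> 1) \<and> (\<forall>p. p \<notin> V x \<longrightarrow> u p = 0)}"

text \<open>
  \<open>\<psi> x\<close> stands in for the distance to the complement of \<open>V x\<close>: as a supremum of 1-Lipschitz functions it
  is 1-Lipschitz without appeal to symmetry or the triangle inequality for \<open>d\<close>.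
\<close>

definition \<psi> :: "'m \<Rightarrow> 'm \<Rightarrow> real" where
  "\<psi> x p = (SUP u\<in>bumps x. u p)"

definition wo :: "'m rel" where
  "wo = (SOME R. well_order_on UNIV R)"

definition before :: "'m \<Rightarrow> 'm \<Rightarrow> bool" where
  "before y x \<longleftrightarrow> (y, x) \<in> wo \<and> y \<noteq> x"

text \<open>The zero function gives the supremum a nonempty range at the first index.\<close>

definition \<sigma> :: "'m \<Rightarrow> 'm \<Rightarrow> real" where
  "\<sigma> x p = (SUP u\<in>insert (\<lambda>_. 0) {\<psi> y |y. before y x}. u p)"

definition t :: "nat \<Rightarrow> real" where
  "t n = 1 / real (Suc n)"

text \<open>
  Where it is positive, \<open>x\<close> is the first index with \<open>\<psi> x p > t n\<close> and all earlier ones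
  have \<open>\<psi> y p < t n\<close>; hence for fixed \<open>n\<close> the sets \<open>{w n x > 0}\<close> are pairwise disjoint (Stone's trick).
\<close>

definition w :: "nat \<Rightarrow> 'm \<Rightarrow> 'm \<Rightarrow> real" where
  "w n x p = max 0 (min (\<psi> x p - t n) (t n - \<sigma> x p))"

section \<open>Stone's functions: disjointness and covering\<close>

lemma t_pos: "0 < t n"
  by (simp add: t_def)

lemma lipschitz_zero: "lipschitz_bound d (\<lambda>_. 0) 1"
  unfolding lipschitz_bound_iff_real[OF finsler_dist_nonneg]
  by (metis abs_zero diff_self ereal_less_eq(5) finsler_dist_nonneg mult_1 zero_le_one)

lemma zero_in_bumps: "(\<lambda>_. 0) \<in> bumps x"
  by (simp add: bumps_def lipschitz_zero)

lemma \<psi>_lipschitz: "lipschitz_bound d (\<psi> x) 1" and \<psi>_range: "0 \<le> \<psi> x p" "\<psi> x p \<le> 1"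
proof -
  have ne: "bumps x \<noteq> {}" using zero_in_bumps by blast
  note * = lipschitz_bound_SUP[of d 1 "bumps x", OF finsler_dist_nonneg zero_le_one ne]
  show "lipschitz_bound d (\<psi> x) 1"
    unfolding \<psi>_def[abs_def] by (rule *(1)) (auto simp: bumps_def)
  have "0 \<le> (SUP u\<in>bumps x. u p) \<and> (SUP u\<in>bumps x. u p) \<le> 1"
    by (rule *(2)) (auto simp: bumps_def)
  then show "0 \<le> \<psi> x p" "\<psi> x p \<le> 1" by (simp_all add: \<psi>_def)
qed

lemma le_\<psi>: "u \<in> bumps x \<Longrightarrow> u p \<le> \<psi> x p"
  unfolding \<psi>_def by (rule cSUP_upper) (auto simp: bumps_def intro!: bdd_aboveI[of _ 1])

lemma \<psi>_outside: "p \<notin> V x \<Longrightarrow> \<psi> x p = 0"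
proof (rule antisym)
  assume "p \<notin> V x"
  then show "\<psi> x p \<le> 0"
    unfolding \<psi>_def using zero_in_bumps by (intro cSUP_least) (auto simp: bumps_def)
qed (rule \<psi>_range)

lemma \<psi>_center: "0 < \<psi> x x"
proof -
  obtain u where "lipschitz_bound d u 1" "\<And>p. 0 \<le> u p \<and> u p \<le> 1"
    "\<And>p. p \<notin> chart_ball x (c x) (r x) \<Longrightarrow> u p = 0" "0 < u x"
    by (rule bump_exists[OF good[of x]]) (rule that)
  then have "u \<in> bumps x" "0 < u x" by (auto simp: bumps_def V_def)
  then show ?thesis using le_\<psi>[of u x x] by linarith
qed

lemma wo_well_order: "well_order_on UNIV wo"
  unfolding wo_def by (rule someI_ex) (rule well_order_on)

lemma before_total: "x \<noteq> y \<Longrightarrow> before x y \<or> before y x"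
  using wo_well_order unfolding before_def well_order_on_def linear_order_on_def total_on_def by blast

lemma before_least:
  assumes "P x" obtains y where "P y" "\<And>z. before z y \<Longrightarrow> \<not> P z"
proof -
  have "wf (wo - Id)" using wo_well_order by (simp add: well_order_on_def)
  then obtain y where "P y" "\<And>z. (z, y) \<in> wo - Id \<Longrightarrow> z \<notin> {x. P x}"
    using assms by (metis mem_Collect_eq wfE_min)
  then show ?thesis by (intro that[of y]) (auto simp: before_def)
qed

lemma \<sigma>_lipschitz: "lipschitz_bound d (\<sigma> x) 1" and \<sigma>_range: "0 \<le> \<sigma> x p" "\<sigma> x p \<le> 1"
proof -
  let ?F = "insert (\<lambda>_. 0) {\<psi> y |y. before y x}"
  have F: "lipschitz_bound d u 1" "0 \<le> u p \<and> u p \<le> 1" if "u \<in> ?F" for u p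
    using that \<psi>_lipschitz \<psi>_range lipschitz_zero by auto
  have ne: "?F \<noteq> {}" by simp
  note * = lipschitz_bound_SUP[of d 1 ?F, OF finsler_dist_nonneg zero_le_one ne]
  show "lipschitz_bound d (\<sigma> x) 1"
    unfolding \<sigma>_def[abs_def] by (rule *(1)) (fact F)+
  have "0 \<le> (SUP u\<in>?F. u p) \<and> (SUP u\<in>?F. u p) \<le> 1" by (rule *(2)) (fact F)+
  then show "0 \<le> \<sigma> x p" "\<sigma> x p \<le> 1" by (simp_all only: \<sigma>_def)
qed

lemma \<psi>_le_\<sigma>: "before y x \<Longrightarrow> \<psi> y p \<le> \<sigma> x p"
  unfolding \<sigma>_def by (rule cSUP_upper) (auto intro!: bdd_aboveI[of _ 1] \<psi>_range)

lemma \<sigma>_eq_0: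
  assumes "\<And>y. before y x \<Longrightarrow> \<psi> y p = 0" shows "\<sigma> x p = 0"
proof -
  have "(\<lambda>u. u p) ` insert (\<lambda>_. 0) {\<psi> y |y. before y x} = {0}"
    using assms by auto
  then show ?thesis by (simp only: \<sigma>_def cSup_singleton)
qed

lemma w_lipschitz: "lipschitz_bound d (w n x) 1"
  unfolding lipschitz_bound_iff_real[OF finsler_dist_nonneg]
proof (intro conjI zero_le_one allI impI)
  fix p q s assume s: "d p q = ereal s"
  have "\<bar>\<psi> x p - \<psi> x q\<bar> \<le> 1 * s" "\<bar>\<sigma> x p - \<sigma> x q\<bar> \<le> 1 * s"
    using \<psi>_lipschitz[of x] \<sigma>_lipschitz[of x] s
    unfolding lipschitz_bound_iff_real[OF finsler_dist_nonneg] by blast+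
  then show "\<bar>w n x p - w n x q\<bar> \<le> 1 * s" unfolding w_def by linarith
qed

lemma t_le_1: "t n \<le> 1"
  by (simp add: t_def)

lemma w_range: "0 \<le> w n x p" "w n x p \<le> 1"
  using \<sigma>_range(1)[of x p] t_le_1[of n] by (auto simp: w_def)

lemma w_pos_in_V: "0 < w n x p \<Longrightarrow> p \<in> V x"
  using \<psi>_outside[of p x] t_pos[of n] by (cases "p \<in> V x") (auto simp: w_def max_def min_def split: if_splits)

lemma w_disjoint: "0 < w n x p \<Longrightarrow> 0 < w n y p \<Longrightarrow> x = y"
proof (rule ccontr)
  assume pos: "0 < w n x p" "0 < w n y p" and "x \<noteq> y"
  then consider "before x y" | "before y x" using before_total by blast
  then show False
    by cases (use pos \<psi>_le_\<sigma>[of x y p] \<psi>_le_\<sigma>[of y x p] in \<open>auto simp: w_def\<close>)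
qed

text \<open>Let x be the first index with \<psi> x p > 0; some index qualifies by
  \<open>\<psi>_center\<close>. All earlier values vanish, so \<sigma> x p = 0, and any n with 2 t n
  < \<psi> x p makes the minimum equal to t n, the largest value that \<open>w n x\<close> can
  take.\<close>

lemma w_covers: obtains n x where "w n x p = t n"
proof -
  obtain x where x: "0 < \<psi> x p" "\<And>y. before y x \<Longrightarrow> \<not> 0 < \<psi> y p"
    by (rule before_least[of "\<lambda>x. 0 < \<psi> x p", OF \<psi>_center]) (rule that)
  have "\<psi> y p = 0" if "before y x" for y using x(2)[OF that] \<psi>_range(1)[of y p] by linarith
  then have \<sigma>: "\<sigma> x p = 0" by (rule \<sigma>_eq_0)
  obtain n where "inverse (real (Suc n)) < \<psi> x p / 2"
    using reals_Archimedean[of "\<psi> x p / 2"] x(1) by auto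
  then have "w n x p = t n" using t_pos[of n] by (simp add: w_def \<sigma> t_def inverse_eq_divide)
  then show ?thesis by (rule that)
qed

text \<open>All indices must be controlled at once, although infinitely many may be active in every
  neighbourhood of p. The supremum over x of \<open>w n x\<close> is again 1-Lipschitz, hence
  continuous, and it vanishes at p.\<close>

lemma w_vanish_nearby:
  assumes 0: "\<And>x. w n x p = 0" and e: "0 < e"
  obtains W where "open W" "p \<in> W" "\<And>q x. q \<in> W \<Longrightarrow> w n x q < e"
proof -
  define S where "S q = (SUP u\<in>range (w n). u q)" for q
  have "lipschitz_bound d S 1"
    unfolding S_def[abs_def]
    by (rule lipschitz_bound_SUP[OF finsler_dist_nonneg zero_le_one]) (auto simp: w_lipschitz w_range)
  then have "continuous_on UNIV S" by (rule lipschitz_continuous)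
  then have "open (S -` {..<e})" by (intro open_vimage) auto
  moreover have "S p = 0" by (simp add: S_def 0 image_image)
  moreover have "w n x q < e" if "q \<in> S -` {..<e}" for x q
  proof -
    have "w n x q \<le> S q" unfolding S_def
      by (rule cSUP_upper) (auto intro!: bdd_aboveI[of _ 1] w_range)
    then show ?thesis using that by simp
  qed
  ultimately show ?thesis using e by (intro that[of "S -` {..<e}"]) auto
qed

lemma open_w_greater: "open {q. a < w n x q}"
proof -
  have "open (w n x -` {a<..})"
    by (intro open_vimage lipschitz_continuous[OF w_lipschitz]) auto
  moreover have "w n x -` {a<..} = {q. a < w n x q}" by auto
  ultimately show ?thesis by simp
qed

section \<open>Smoothing level by level\<close>

definition idx :: "nat \<Rightarrow> 'm \<Rightarrow> 'm" where
  "idx n p = (SOME x. 0 < w n x p)"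

lemma idx_eq: "0 < w n x p \<Longrightarrow> idx n p = x"
  unfolding idx_def by (rule w_disjoint[OF someI])

lemma local_approximation:
  assumes u: "lipschitz_bound d u L" and e: "0 < e"
  shows "\<exists>h. \<forall>p\<in>V x. \<bar>h p - u p\<bar> < e \<and> diff_bound h p (C0 * K * (L * K)) \<and> smooth_near (min l k) h p"
proof -
  have L: "0 \<le> L * K" using u K by (simp add: lipschitz_bound_def)
  have lip: "\<bar>u p - u q\<bar> \<le> (L * K) * chart_norm x (c x) (snd (c x) p - snd (c x) q)"
    if "p \<in> chart_ball x (c x) (r x)" "q \<in> chart_ball x (c x) (r x)" for p q
    by (rule lipschitz_in_chart_ball[OF good u that])
  obtain h where "\<And>p. p \<in> chart_ball x (c x) (r x) \<Longrightarrow> \<bar>h p - u p\<bar> < e"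
    "\<And>p. p \<in> chart_ball x (c x) (r x) \<Longrightarrow> diff_bound h p (C0 * K * (L * K))"
    "\<And>p. p \<in> chart_ball x (c x) (r x) \<Longrightarrow> smooth_near (min l k) h p"
    by (rule local_smooth_approximation[OF good[of x] L e lip]) (assumption | rule that)+
  then show ?thesis unfolding V_def by blast
qed

text \<open>A single smooth function for the whole level n: locally 1 where some
  \<open>w n x\<close> attains its largest possible value t n, locally 0 where all of them vanish.
  The bound b may depend on n but not on the point.\<close>

definition level_cutoff :: "nat \<Rightarrow> ('m \<Rightarrow> real) \<Rightarrow> real \<Rightarrow> bool" where
  "level_cutoff n z b \<longleftrightarrow> 0 \<le> b \<and>
     (\<forall>p. 0 \<le> z p \<and> z p \<le> 1 \<and> diff_bound z p b \<and> smooth_near (min l k) z p) \<and>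
     (\<forall>p. (\<forall>x. w n x p = 0) \<longrightarrow> (\<exists>W. open W \<and> p \<in> W \<and> (\<forall>q\<in>W. z q = 0))) \<and>
     (\<forall>p x. w n x p = t n \<longrightarrow> (\<exists>W. open W \<and> p \<in> W \<and> (\<forall>q\<in>W. z q = 1)))"

text \<open>Each \<open>w n x\<close> is smoothed in its own chart up to t n / 8, and the result is
  cut off between t n / 4 and t n / 2. Hence z is 0 wherever every \<open>w n x\<close> is below t n
  / 8, which makes the pieces extend smoothly across the boundaries of the disjoint positivity sets,
  and z is 1 wherever some \<open>w n x\<close> exceeds 5 t n / 8.\<close>

lemma level_cutoff_exists: "\<exists>z b. level_cutoff n z b"
proof -
  have t8: "0 < t n / 8" using t_pos[of n] by simp
  have "\<forall>x. \<exists>h. \<forall>p\<in>V x. \<bar>h p - w n x p\<bar> < t n / 8 \<and> diff_bound h p (C0 * K * (1 * K)) \<and> smooth_near (min l k) h p"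
    using local_approximation[OF w_lipschitz t8] by blast
  then obtain h where h': "\<forall>x. \<forall>p\<in>V x. \<bar>h x p - w n x p\<bar> < t n / 8 \<and>
      diff_bound (h x) p (C0 * K * (1 * K)) \<and> smooth_near (min l k) (h x) p"
    by (rule choice[THEN exE])
  have h: "\<bar>h x p - w n x p\<bar> < t n / 8" "diff_bound (h x) p (C0 * K * (1 * K))" "smooth_near (min l k) (h x) p"
    if "p \<in> V x" for x p using h' that by auto
  from smooth_cutoff obtain \<theta> :: "real \<Rightarrow> real" and \<theta>' B where
    \<theta>_smooth: "\<forall>k. smooth_map_on k UNIV \<theta>" and \<theta>_cases: "\<forall>t\<le>0. \<theta> t = 0" "\<forall>t\<ge>1. \<theta> t = 1"
    and \<theta>_range: "\<forall>t. 0 \<le> \<theta> t \<and> \<theta> t \<le> 1"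
    and \<theta>_deriv: "\<forall>t. (\<theta> has_real_derivative \<theta>' t) (at t) \<and> \<bar>\<theta>' t\<bar> \<le> B"
    by (elim exE conjE) (rule that)
  have \<theta>d: "(\<theta> has_real_derivative \<theta>' s) (at s)" and \<theta>B: "\<bar>\<theta>' s\<bar> \<le> B" for s
    using \<theta>_deriv by auto
  have B0: "0 \<le> B" using \<theta>B[of 0] by linarith
  define a where "a = 4 / t n"
  have a: "0 < a" using t_pos[of n] by (simp add: a_def)
  define \<eta> where "\<eta> y = \<theta> (y * a + (-1))" for y
  have \<eta>0: "\<eta> y = 0" if "y \<le> t n / 4" for y
    unfolding \<eta>_def by (rule \<theta>_cases(1)[rule_format]) (use that t_pos[of n] in \<open>simp add: a_def field_simps\<close>)
  have \<eta>1: "\<eta> y = 1" if "t n / 2 \<le> y" for y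
    unfolding \<eta>_def by (rule \<theta>_cases(2)[rule_format]) (use that t_pos[of n] in \<open>simp add: a_def field_simps\<close>)
  have \<eta>d: "(\<eta> has_real_derivative \<theta>' (y * a + (-1)) * a) (at y)" for y
    unfolding \<eta>_def[abs_def] by (rule DERIV_chain2[OF \<theta>d]) (auto intro!: derivative_eq_intros)
  \<comment> \<open>At most one x has \<open>w n x p\<close> positive, so \<open>idx\<close> picks
    the only possible chart.\<close>
  define z where "z p = (if \<exists>x. 0 < w n x p then \<eta> (h (idx n p) p) else 0)" for p
  define b where "b = B * a * (C0 * K * (1 * K))"
  have b: "0 \<le> b" unfolding b_def using B0 a C0 K by simp
  have range: "0 \<le> z p \<and> z p \<le> 1" for p using \<theta>_range by (simp add: z_def \<eta>_def)
  have z_eq: "z q = \<eta> (h x q)" if "0 < w n x q" for x q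
    using that idx_eq[OF that] by (auto simp: z_def)
  have vanish: "\<exists>W. open W \<and> p \<in> W \<and> (\<forall>q\<in>W. z q = 0)" if 0: "\<forall>x. w n x p = 0" for p
  proof -
    obtain W where W: "open W" "p \<in> W" "\<And>q x. q \<in> W \<Longrightarrow> w n x q < t n / 8"
      by (rule w_vanish_nearby[OF 0[rule_format] t8]) (rule that)
    have "z q = 0" if q: "q \<in> W" for q
    proof (cases "\<exists>x. 0 < w n x q")
      case True
      then obtain x where x: "0 < w n x q" by blast
      have "h x q \<le> t n / 4" using h(1)[OF w_pos_in_V[OF x]] W(3)[OF q, of x] by linarith
      then show ?thesis by (simp add: z_eq[OF x] \<eta>0)
    qed (simp add: z_def)
    then show ?thesis using W by blast
  qed
  have main: "diff_bound z p b \<and> smooth_near (min l k) z p" for p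
  proof (cases "\<exists>x. 0 < w n x p")
    case True
    then obtain x where x: "0 < w n x p" by blast
    note pV = w_pos_in_V[OF x]
    have "diff_bound (\<lambda>q. \<eta> (h x q)) p (\<bar>\<theta>' (h x p * a + (-1)) * a\<bar> * (C0 * K * (1 * K)))"
      by (rule diff_bound_real_compose[OF h(2)[OF pV] \<eta>d])
    moreover have "\<bar>\<theta>' (h x p * a + (-1)) * a\<bar> * (C0 * K * (1 * K)) \<le> b"
      unfolding b_def abs_mult using \<theta>B a C0 K B0 by (intro mult_mono) auto
    ultimately have 1: "diff_bound (\<lambda>q. \<eta> (h x q)) p b" by (rule diff_bound_mono)
    have 2: "smooth_near (min l k) (\<lambda>q. \<eta> (h x q)) p"
      unfolding \<eta>_def
      by (intro smooth_near_real_compose[OF \<theta>_smooth[rule_format]] smooth_near_add smooth_near_mult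
          smooth_near_const h(3)[OF pV]) auto
    have o: "open {q. 0 < w n x q}" "p \<in> {q. 0 < w n x q}" using open_w_greater x by auto
    have eq: "\<eta> (h x q) = z q" if "q \<in> {q. 0 < w n x q}" for q using that by (simp add: z_eq)
    show ?thesis using diff_bound_local[OF 1 o eq] smooth_near_local[OF 2 o eq] by simp
  next
    case False
    then have "\<forall>x. w n x p = 0" using w_range(1) by (metis order_less_le)
    from vanish[OF this] obtain W where W: "open W" "p \<in> W" "\<forall>q\<in>W. z q = 0" by blast
    have eq: "0 = z q" if "q \<in> W" for q using W that by simp
    show ?thesis
      using diff_bound_local[OF diff_bound_const[OF b] W(1,2) eq]
        smooth_near_local[OF smooth_near_const W(1,2) eq] by simp
  qed
  have one: "\<exists>W. open W \<and> p \<in> W \<and> (\<forall>q\<in>W. z q = 1)" if wt: "w n x p = t n" for p x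
  proof (intro exI conjI ballI)
    show "open {q. 5 * t n / 8 < w n x q}" by (rule open_w_greater)
    show "p \<in> {q. 5 * t n / 8 < w n x q}" using wt t_pos[of n] by simp
    fix q assume "q \<in> {q. 5 * t n / 8 < w n x q}"
    then have *: "5 * t n / 8 < w n x q" by simp
    then have q: "0 < w n x q" using t_pos[of n] by linarith
    have "t n / 2 \<le> h x q" using h(1)[OF w_pos_in_V[OF q]] * by linarith
    then show "z q = 1" by (simp add: z_eq[OF q] \<eta>1)
  qed
  show ?thesis unfolding level_cutoff_def
    by (intro exI[of _ z] exI[of _ b] conjI allI impI b vanish one) (use range main one in auto)
qed

text \<open>The partial sums telescope to 1 minus the product of the factors 1 - z j. Near p some z
  J is 1, by \<open>w_covers\<close>; there the product is 0 from J + 1 on, so later terms vanish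
  and the sum up to J is 1. Since all factors lie in [0, 1], bounds of differentials simply add up
  under products.\<close>

lemma partition_of_unity:
  "\<exists>\<mu> B. (\<forall>n. 0 \<le> B n) \<and> (\<forall>n p. 0 \<le> \<mu> n p \<and> diff_bound (\<mu> n) p (B n) \<and> smooth_near (min l k) (\<mu> n) p) \<and>
     (\<forall>n p. (\<forall>x. w n x p = 0) \<longrightarrow> (\<exists>W. open W \<and> p \<in> W \<and> (\<forall>q\<in>W. \<mu> n q = 0))) \<and>
     (\<forall>p. \<exists>J W. open W \<and> p \<in> W \<and> (\<forall>q\<in>W. (\<forall>n>J. \<mu> n q = 0) \<and> (\<Sum>n\<le>J. \<mu> n q) = (1::real)))"
proof -
  obtain z b where zb: "\<And>n. level_cutoff n (z n) (b n)"
    using level_cutoff_exists by metis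
  have b: "0 \<le> b n" and z01: "0 \<le> z n p" "z n p \<le> 1" and zd: "diff_bound (z n) p (b n)"
    and zs: "smooth_near (min l k) (z n) p" for n p using zb[of n] by (auto simp: level_cutoff_def)
  have z0: "\<exists>W. open W \<and> p \<in> W \<and> (\<forall>q\<in>W. z n q = 0)" if "\<forall>x. w n x p = 0" for n p
    using zb[of n] that unfolding level_cutoff_def by blast
  have z1: "\<exists>W. open W \<and> p \<in> W \<and> (\<forall>q\<in>W. z n q = 1)" if "w n x p = t n" for n p x
    using zb[of n] that unfolding level_cutoff_def by blast
  define P where "P n q = (\<Prod>j<n. 1 - z j q)" for n q
  define \<mu> where "\<mu> n q = z n q * P n q" for n q
  define B where "B n = (\<Sum>j<n. b j)" for n
  have B: "0 \<le> B n" for n unfolding B_def using b by (intro sum_nonneg) auto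
  have P01: "0 \<le> P n q \<and> P n q \<le> 1" for n q
    unfolding P_def using z01 by (auto intro!: prod_nonneg prod_le_1)
  have one_minus: "diff_bound (\<lambda>q. 1 - z n q) p (b n)" "smooth_near (min l k) (\<lambda>q. 1 - z n q) p" for n p
  proof -
    have "diff_bound (\<lambda>q. (\<lambda>y. 1 - y) (z n q)) p (\<bar>-1\<bar> * b n)"
      by (rule diff_bound_real_compose[OF zd]) (auto intro!: derivative_eq_intros)
    then show "diff_bound (\<lambda>q. 1 - z n q) p (b n)" by simp
    have "smooth_near (min l k) (\<lambda>q. 1 + (-1) * z n q) p"
      by (intro smooth_near_add smooth_near_mult smooth_near_const zs) auto
    then show "smooth_near (min l k) (\<lambda>q. 1 - z n q) p" by simp
  qed
  have mult_le: "\<bar>x\<bar> * D + \<bar>y\<bar> * C \<le> C + D" if "0 \<le> x" "x \<le> 1" "0 \<le> y" "y \<le> 1" "0 \<le> C" "0 \<le> D" for x y C D :: real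
    using that mult_right_mono[of x 1 D] mult_right_mono[of y 1 C] by simp
  have Pd: "diff_bound (P n) p (B n) \<and> smooth_near (min l k) (P n) p" for n p
  proof (induction n)
    case 0
    show ?case
      using diff_bound_const[of 0 1 p] smooth_near_const[of "min l k" 1 p] by (simp add: P_def[abs_def] B_def)
  next
    case (Suc n)
    have eq: "P (Suc n) = (\<lambda>q. P n q * (1 - z n q))" by (simp add: P_def[abs_def])
    have "diff_bound (\<lambda>q. P n q * (1 - z n q)) p (B (Suc n))"
      by (rule diff_bound_mono[OF diff_bound_mult[OF conjunct1[OF Suc.IH] one_minus(1)]])
        (use mult_le[of "P n p" "1 - z n p" "B n" "b n"] P01[of n p] z01[of n p] B[of n] b[of n] in \<open>simp add: B_def\<close>)
    moreover have "smooth_near (min l k) (\<lambda>q. P n q * (1 - z n q)) p"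
      by (rule smooth_near_mult[OF conjunct2[OF Suc.IH] one_minus(2)]) simp
    ultimately show ?case unfolding eq by blast
  qed
  have sum_\<mu>: "(\<Sum>n<m. \<mu> n q) = 1 - P m q" for m q
    by (induction m) (auto simp: P_def \<mu>_def algebra_simps)
  show ?thesis
  \<comment> \<open>\<open>B n\<close> bounds the differential of the product of the first n
    factors; z n adds b n, hence the index \<open>Suc n\<close>.\<close>
  proof (intro exI[of _ \<mu>] exI[of _ "\<lambda>n. B (Suc n)"] conjI allI impI)
    show "0 \<le> B (Suc n)" for n by (rule B)
    show "0 \<le> \<mu> n p" for n p unfolding \<mu>_def using z01 P01 by simp
    show "diff_bound (\<mu> n) p (B (Suc n))" for n p
      unfolding \<mu>_def[abs_def]
      by (rule diff_bound_mono[OF diff_bound_mult[OF zd conjunct1[OF Pd]]])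
        (use mult_le[of "z n p" "P n p" "b n" "B n"] P01[of n p] z01[of n p] B[of n] b[of n] in \<open>simp add: B_def\<close>)
    show "smooth_near (min l k) (\<mu> n) p" for n p
      unfolding \<mu>_def[abs_def] by (rule smooth_near_mult[OF zs conjunct2[OF Pd]]) simp
    show "\<exists>W. open W \<and> p \<in> W \<and> (\<forall>q\<in>W. \<mu> n q = 0)" if "\<forall>x. w n x p = 0" for n p
      using z0[OF that] by (auto simp: \<mu>_def)
  next
    fix p
    obtain J x where "w J x p = t J" by (rule w_covers)
    from z1[OF this] obtain W where W: "open W" "p \<in> W" "\<forall>q\<in>W. z J q = 1" by blast
    have "(\<forall>n>J. \<mu> n q = 0) \<and> (\<Sum>n\<le>J. \<mu> n q) = 1" if q: "q \<in> W" for q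
    proof -
      have zero: "P n q = 0" if "J < n" for n
        unfolding P_def by (rule prod_zero) (use that W(3) q in auto)
      have "(\<Sum>n<Suc J. \<mu> n q) = 1" unfolding sum_\<mu> using zero[of "Suc J"] by simp
      then show ?thesis using zero by (simp add: \<mu>_def lessThan_Suc_atMost)
    qed
    then show "\<exists>J W. open W \<and> p \<in> W \<and> (\<forall>q\<in>W. (\<forall>n>J. \<mu> n q = 0) \<and> (\<Sum>n\<le>J. \<mu> n q) = 1)"
      using W(1,2) by blast
  qed
qed

text \<open>The second assumption on \<epsilon> makes the number \<epsilon> x / 2 an admissible
  error on all of \<open>V x\<close>, so the approximation in that chart may have constant
  accuracy.\<close>

lemma approximation:
  fixes f \<epsilon> :: "'m \<Rightarrow> real"
  assumes f: "lipschitz_bound d f L" and L: "0 < L"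
    and \<epsilon>: "\<And>x. 0 < \<epsilon> x" "\<And>x p. p \<in> V x \<Longrightarrow> \<epsilon> x / 2 < \<epsilon> p"
  shows "\<exists>g. \<forall>p. \<bar>g p - f p\<bar> < \<epsilon> p \<and> diff_bound g p (2 * (C0 * K * (L * K))) \<and> smooth_near (min l k) g p"
proof -
  define C where "C = C0 * K * (L * K)"
  have C: "0 < C" unfolding C_def using C0 K L by simp
  from partition_of_unity obtain \<mu> B where
    B': "\<forall>n. 0 \<le> B n" and \<mu>': "\<forall>n p. 0 \<le> \<mu> n p \<and> diff_bound (\<mu> n) p (B n) \<and> smooth_near (min l k) (\<mu> n) p"
    and \<mu>0: "\<forall>n p. (\<forall>x. w n x p = 0) \<longrightarrow> (\<exists>W. open W \<and> p \<in> W \<and> (\<forall>q\<in>W. \<mu> n q = 0))"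
    and \<mu>1: "\<forall>p. \<exists>J W. open W \<and> p \<in> W \<and> (\<forall>q\<in>W. (\<forall>n>J. \<mu> n q = 0) \<and> (\<Sum>n\<le>J. \<mu> n q) = (1::real))"
    by (elim exE conjE) (rule that)
  have B: "0 \<le> B n" and \<mu>: "0 \<le> \<mu> n p" "diff_bound (\<mu> n) p (B n)" "smooth_near (min l k) (\<mu> n) p" for n p
    using B' \<mu>' by auto
  \<comment> \<open>Chosen so that B n * \<delta> n \<le> C / 2 ^ (n + 1): the errors multiplied by
    the differentials of \<mu> n sum to at most C.\<close>
  define \<delta> where "\<delta> n = C / ((B n + 1) * 2 ^ Suc n)" for n
  have \<delta>: "0 < \<delta> n" "B n * \<delta> n \<le> C / 2 ^ Suc n" for n
  proof -
    have B1: "0 < B n + 1" using B[of n] by linarith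
    then show "0 < \<delta> n" unfolding \<delta>_def using C by (intro divide_pos_pos mult_pos_pos) auto
    have "B n * \<delta> n \<le> (B n + 1) * \<delta> n" using \<open>0 < \<delta> n\<close> by (intro mult_right_mono) auto
    also have "\<dots> = C / 2 ^ Suc n" unfolding \<delta>_def using B1 by simp
    finally show "B n * \<delta> n \<le> C / 2 ^ Suc n" .
  qed
  \<comment> \<open>The accuracy depends on the level and on the chart, so there is one
    approximation for each pair.\<close>
  have "\<forall>nx. \<exists>h. \<forall>p\<in>V (snd nx). \<bar>h p - f p\<bar> < min (\<epsilon> (snd nx) / 2) (\<delta> (fst nx)) \<and>
      diff_bound h p (C0 * K * (L * K)) \<and> smooth_near (min l k) h p"
    by (intro allI local_approximation[OF f]) (use \<epsilon>(1) \<delta>(1) in simp)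
  then obtain H' where H': "\<forall>nx. \<forall>p\<in>V (snd nx). \<bar>H' nx p - f p\<bar> < min (\<epsilon> (snd nx) / 2) (\<delta> (fst nx)) \<and>
      diff_bound (H' nx) p (C0 * K * (L * K)) \<and> smooth_near (min l k) (H' nx) p"
    by (rule choice[THEN exE])
  define H where "H n x = H' (n, x)" for n x
  have H: "\<bar>H n x p - f p\<bar> < \<epsilon> p" "\<bar>H n x p - f p\<bar> \<le> \<delta> n" "diff_bound (H n x) p C"
    "smooth_near (min l k) (H n x) p" if "p \<in> V x" for n x p
  proof -
    from H'[rule_format, of p "(n, x)"] that
    have *: "\<bar>H n x p - f p\<bar> < min (\<epsilon> x / 2) (\<delta> n)" "diff_bound (H n x) p C" "smooth_near (min l k) (H n x) p"
      by (auto simp: H_def C_def)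
    then show "\<bar>H n x p - f p\<bar> < \<epsilon> p" "\<bar>H n x p - f p\<bar> \<le> \<delta> n" "diff_bound (H n x) p C"
      "smooth_near (min l k) (H n x) p" using \<epsilon>(2)[OF that] by auto
  qed
  \<comment> \<open>The default f p keeps G n close to f everywhere; it is harmless for smoothness
    because \<mu> n vanishes near every point where no \<open>w n x\<close> is positive.\<close>
  define G where "G n p = (if \<exists>x. 0 < w n x p then H n (idx n p) p else f p)" for n p
  have G_eq: "G n q = H n x q" if "0 < w n x q" for n x q
    using that idx_eq[OF that] by (auto simp: G_def)
  have G_close: "\<bar>G n p - f p\<bar> < \<epsilon> p" "\<bar>G n p - f p\<bar> \<le> \<delta> n" for n p
  proof -
    have "\<bar>G n p - f p\<bar> < \<epsilon> p \<and> \<bar>G n p - f p\<bar> \<le> \<delta> n"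
    proof (cases "\<exists>x. 0 < w n x p")
      case True
      then obtain x where x: "0 < w n x p" by blast
      from H(1,2)[OF w_pos_in_V[OF x]] show ?thesis by (simp add: G_eq[OF x])
    next
      case False
      then have "G n p = f p" by (simp add: G_def)
      then show ?thesis using \<epsilon>(1)[of p] \<delta>(1)[of n] by simp
    qed
    then show "\<bar>G n p - f p\<bar> < \<epsilon> p" "\<bar>G n p - f p\<bar> \<le> \<delta> n" by auto
  qed
  \<comment> \<open>Here f p is a number, p being fixed, so the Lipschitz function f is never
    differentiated. The summand C / 2 ^ (n + 1) comes from the differential of \<mu> n.\<close>
  have term_ok: "diff_bound (\<lambda>q. \<mu> n q * (G n q + - f p)) p (\<mu> n p * C + C / 2 ^ Suc n) \<and>
      smooth_near (min l k) (\<lambda>q. \<mu> n q * G n q) p" for n p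
  proof (cases "\<exists>x. 0 < w n x p")
    case True
    then obtain x where x: "0 < w n x p" by blast
    note pV = w_pos_in_V[OF x]
    have o: "open {q. 0 < w n x q}" "p \<in> {q. 0 < w n x q}" using open_w_greater x by auto
    have "diff_bound (\<lambda>q. H n x q + - f p) p (C + 0)"
      by (rule diff_bound_add[OF H(3)[OF pV] diff_bound_const]) simp
    from diff_bound_mult[OF \<mu>(2) this]
    have "diff_bound (\<lambda>q. \<mu> n q * (H n x q + - f p)) p (\<bar>\<mu> n p\<bar> * (C + 0) + \<bar>H n x p + - f p\<bar> * B n)" .
    moreover have "\<bar>H n x p + - f p\<bar> * B n \<le> C / 2 ^ Suc n"
    proof -
      have "\<bar>H n x p + - f p\<bar> * B n \<le> \<delta> n * B n" using H(2)[OF pV, of n] B[of n] by (intro mult_right_mono) auto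
      then show ?thesis using \<delta>(2)[of n] by (simp add: mult.commute)
    qed
    ultimately have 1: "diff_bound (\<lambda>q. \<mu> n q * (H n x q + - f p)) p (\<mu> n p * C + C / 2 ^ Suc n)"
      using \<mu>(1)[of n p] by (elim diff_bound_mono) simp
    have 2: "smooth_near (min l k) (\<lambda>q. \<mu> n q * H n x q) p"
      by (rule smooth_near_mult[OF \<mu>(3) H(4)[OF pV]]) simp
    show ?thesis
      by (intro conjI diff_bound_local[OF 1 o] smooth_near_local[OF 2 o]) (simp_all add: G_eq)
  next
    case False
    then have "\<forall>x. w n x p = 0" using w_range(1) by (metis order_less_le)
    then obtain W where W: "open W" "p \<in> W" "\<forall>q\<in>W. \<mu> n q = 0" using \<mu>0 by blast
    have nn: "0 \<le> \<mu> n p * C + C / 2 ^ Suc n" using \<mu>(1)[of n p] C by simp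
    show ?thesis
      by (intro conjI diff_bound_local[OF diff_bound_const[OF nn, of 0] W(1,2)]
          smooth_near_local[OF smooth_near_const[of _ 0] W(1,2)]) (simp_all add: W(3))
  qed
  define g where "g p = (\<Sum>n. \<mu> n p * G n p)" for p
  have "\<bar>g p - f p\<bar> < \<epsilon> p \<and> diff_bound g p (2 * C) \<and> smooth_near (min l k) g p" for p
  proof -
    obtain J W where W: "open W" "p \<in> W"
      and \<mu>W: "\<forall>q\<in>W. (\<forall>n>J. \<mu> n q = 0) \<and> (\<Sum>n\<le>J. \<mu> n q) = 1" using \<mu>1[rule_format, of p] by (elim exE conjE) (rule that)
    have g_eq: "g q = (\<Sum>n\<le>J. \<mu> n q * G n q)" if "q \<in> W" for q
      unfolding g_def by (rule suminf_finite) (use \<mu>W that in auto)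
    \<comment> \<open>As the \<mu> n sum to 1 near p, the same number a can be subtracted from every
      G n and added back once.\<close>
    have g_eq': "(\<Sum>n\<le>J. \<mu> n q * (G n q + - a)) + a = g q" if "q \<in> W" for q a
    proof -
      have "(\<Sum>n\<le>J. \<mu> n q * (G n q + - a)) = (\<Sum>n\<le>J. \<mu> n q * G n q) - (\<Sum>n\<le>J. \<mu> n q) * a"
        by (simp add: sum_subtractf right_diff_distrib sum_distrib_right)
      then show ?thesis using g_eq[OF that] \<mu>W that by simp
    qed
    \<comment> \<open>A maximum over finitely many levels retains the strict inequality with
      \<epsilon> p.\<close>
    define M where "M = Max ((\<lambda>n. \<bar>G n p - f p\<bar>) ` {..J})"
    have M: "\<bar>G n p - f p\<bar> \<le> M" if "n \<le> J" for n unfolding M_def using that by (intro Max_ge) auto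
    have "M < \<epsilon> p" unfolding M_def using G_close(1) by (subst Max_less_iff) auto
    have "g p - f p = (\<Sum>n\<le>J. \<mu> n p * (G n p + - f p))" using g_eq'[OF W(2), of "f p"] by simp
    then have "\<bar>g p - f p\<bar> \<le> (\<Sum>n\<le>J. \<bar>\<mu> n p * (G n p + - f p)\<bar>)" by (simp only: sum_abs)
    also have "\<dots> \<le> (\<Sum>n\<le>J. \<mu> n p * M)"
      using M \<mu>(1) by (intro sum_mono) (auto simp: abs_mult intro!: mult_left_mono)
    also have "\<dots> = M" using \<mu>W W(2) by (simp flip: sum_distrib_right)
    finally have 1: "\<bar>g p - f p\<bar> < \<epsilon> p" using \<open>M < \<epsilon> p\<close> by linarith
    have "diff_bound (\<lambda>q. (\<Sum>n\<le>J. \<mu> n q * (G n q + - f p)) + f p) p ((\<Sum>n\<le>J. \<mu> n p * C + C / 2 ^ Suc n) + 0)"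
      by (intro diff_bound_add diff_bound_sum diff_bound_const) (use term_ok in auto)
    moreover have "(\<Sum>n\<le>J. \<mu> n p * C + C / 2 ^ Suc n) + 0 \<le> 2 * C"
    proof -
      have "(\<Sum>n\<le>J. C / 2 ^ Suc n) = C * (1 - 1 / 2 ^ Suc J)"
        by (induction J) (auto simp: field_simps)
      also have "\<dots> \<le> C * 1" using C by (intro mult_left_mono) auto
      finally have "(\<Sum>n\<le>J. C / 2 ^ Suc n) \<le> C" by simp
      moreover have "(\<Sum>n\<le>J. \<mu> n p * C) = C" using \<mu>W W(2) by (simp flip: sum_distrib_right)
      ultimately show ?thesis by (simp add: sum.distrib)
    qed
    ultimately have "diff_bound (\<lambda>q. (\<Sum>n\<le>J. \<mu> n q * (G n q + - f p)) + f p) p (2 * C)"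
      by (rule diff_bound_mono)
    then have 2: "diff_bound g p (2 * C)"
      by (rule diff_bound_local[OF _ W]) (rule g_eq')
    have "smooth_near (min l k) (\<lambda>q. \<Sum>n\<le>J. \<mu> n q * G n q) p"
      by (rule smooth_near_sum) (use term_ok in auto)
    then have 3: "smooth_near (min l k) g p"
      by (rule smooth_near_local[OF _ W]) (simp add: g_eq)
    show ?thesis using 1 2 3 by blast
  qed
  then show ?thesis unfolding C_def by blast
qed

end

section \<open>The global approximation\<close>

context star_finsler
begin

lemma smooth_lipschitz_approximation:
  fixes f \<epsilon> :: "'m \<Rightarrow> real"
  assumes f: "lipschitz_bound d f L" and \<epsilon>: "continuous_on UNIV \<epsilon>" "\<And>p. 0 < \<epsilon> p"
  shows "\<exists>g. \<forall>p. \<bar>g p - f p\<bar> < \<epsilon> p \<and> diff_bound g p (2 * (C0 * K * (L * K))) \<and> smooth_near (min l k) g p"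
proof (cases "L = 0")
  case True
  \<comment> \<open>With L = 0 there is no error to distribute over the levels, but f is then
    locally constant and serves as g.\<close>
  have "diff_bound f p 0 \<and> smooth_near (min l k) f p" for p
  proof -
    obtain c r where g: "good_ball p c r" by (rule good_ball_exists[OF open_UNIV UNIV_I]) (rule that)
    note o = chart_ball_open[OF g] center_in_chart_ball[OF g]
    have eq: "f p = f q" if "q \<in> chart_ball p c r" for q
      using lipschitz_in_chart_ball[OF g f o(2) that] True by simp
    show ?thesis
      by (intro conjI diff_bound_local[OF diff_bound_const[of 0 "f p"] o eq]
          smooth_near_local[OF smooth_near_const[of _ "f p"] o eq]) auto
  qed
  then show ?thesis using True \<epsilon>(2) by (intro exI[of _ f]) simp
next
  case False
  then have L: "0 < L" using f by (simp add: lipschitz_bound_def)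
  \<comment> \<open>Balls on which \<epsilon> stays above half its value at the center.\<close>
  have "\<exists>c r. good_ball x c r \<and> chart_ball x c r \<subseteq> \<epsilon> -` {\<epsilon> x / 2<..}" for x
  proof -
    have "open (\<epsilon> -` {\<epsilon> x / 2<..})" by (intro open_vimage \<epsilon>) auto
    moreover have "x \<in> \<epsilon> -` {\<epsilon> x / 2<..}" using \<epsilon>(2)[of x] by simp
    ultimately show ?thesis using good_ball_exists by metis
  qed
  then obtain c r where cr: "\<And>x. good_ball x (c x) (r x)" "\<And>x. chart_ball x (c x) (r x) \<subseteq> \<epsilon> -` {\<epsilon> x / 2<..}"
    by metis
  interpret finsler_cover A N l K k C0 c r
    by unfold_locales (rule cr)
  have "\<epsilon> x / 2 < \<epsilon> p" if "p \<in> V x" for x p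
    using subsetD[OF cr(2)[of x], of p] that by (simp add: V_def)
  then show ?thesis by (rule approximation[OF f L \<epsilon>(2)])
qed

end

theorem theorem3p4:
  fixes A :: "('m::topological_space, 'x::banach) chart set"
    and N :: "'m \<Rightarrow> ('m, 'x) tangent \<Rightarrow> real"
    and l k :: enat and K C0 :: real
    and f \<epsilon> :: "'m \<Rightarrow> real"
  assumes "1 \<le> l" and "1 \<le> k" and "1 \<le> K" and "1 \<le> C0"
    and "weak_uniform_finsler_manifold l K A N"
    and "\<forall>\<nu> :: 'x \<Rightarrow> real. equivalent_norm \<nu> \<longrightarrow> property_star k \<nu> C0"
    and "lipschitz_fun (finsler_dist A N) f"
    and "continuous_on UNIV \<epsilon>" and "\<forall>p. 0 < \<epsilon> p"
  shows "\<exists>g. lipschitz_fun (finsler_dist A N) g \<and> smooth_function A (min l k) g \<and>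
           (\<forall>p. \<bar>g p - f p\<bar> < \<epsilon> p \<and>
                dual_norm A N p (differential A g p)
                  \<le> ereal ((2 * C0 * K\<^sup>2) * Lip (finsler_dist A N) f)) \<and>
           Lip (finsler_dist A N) g \<le> (2 * C0 * K\<^sup>2) * Lip (finsler_dist A N) f"
proof -
  interpret star_finsler A N l K k C0
    by unfold_locales (use assms(1-6) in auto)
  let ?L = "Lip d f" and ?C = "(2 * C0 * K\<^sup>2) * Lip d f"
  have f: "lipschitz_bound d f ?L" by (rule lipschitz_bound_Lip(1)[OF assms(7) finsler_dist_nonneg])
  have "2 * (C0 * K * (?L * K)) = ?C" by (simp add: power2_eq_square mult_ac)
  then obtain g where g: "\<bar>g p - f p\<bar> < \<epsilon> p" "diff_bound g p ?C" "smooth_near (min l k) g p" for p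
    using smooth_lipschitz_approximation[OF f assms(8)] assms(9) by metis
  have C: "0 \<le> ?C" using f assms(4) by (simp add: lipschitz_bound_def)
  have lip: "lipschitz_bound d g ?C" by (rule lipschitz_bound_of_diff_bound[OF g(2) C])
  then have g_lip: "lipschitz_fun d g" unfolding lipschitz_fun_def by blast
  show ?thesis
  proof (intro exI[of _ g] conjI allI)
    show "lipschitz_fun d g" by (rule g_lip)
    show "smooth_function A (min l k) g" by (rule smooth_function_of_smooth_near[OF g(3)]) simp
    show "\<bar>g p - f p\<bar> < \<epsilon> p" for p by (rule g(1))
    show "dual_norm A N p (differential A g p) \<le> ereal ?C" for p
      by (rule dual_norm_differential_le[OF g(2) C])
    show "Lip d g \<le> ?C" by (rule lipschitz_bound_Lip(2)[OF g_lip finsler_dist_nonneg lip])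
  qed
qed

end
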